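(* Let $\Gamma$ be the Dynkin diagram of a simple finite dimensional complex Lie algebra of type $X_n$ with simple roots $\alpha_1,\dots,\alpha_n$, and let $\beta=\alpha_{i_0}$ be a simple root corresponding to a branch vertex of $\Gamma$. Let $c$ be the least positive integer such that $c\,w_{\beta^\vee}$ belongs to the co-root lattice $\mathbb{Z}\alpha_1^\vee+\dots+\mathbb{Z}\alpha_n^\vee$ of $X_n$. Then there is a Coxeter transformation $\sigma$ of $X_n^{(1)}$ (with corresponding Coxeter polynomial) such that $$c\,w_{\beta^\vee}=\sum_{i=0}^{n} m_i\,\alpha_i^\vee ,\qquad m_0=0,$$ where $m_0,m_1,\dots,m_n$ are, in a suitable enumeration, the affine exponents of $X_n^{(1)}$ associated with $\sigma$, and $m_{i_0}$ is the affine Coxeter number of $X_n^{(1)}$ associated with $\sigma$.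
   Context: Finite data. Let $\alpha_1,\dots,\alpha_n$ be the simple roots of $X_n$, spanning a real vector space equipped with the Weyl-invariant inner product $(\cdot,\cdot)$ induced by the Killing form, scaled so that long roots have squared length $2$. The co-roots are $\alpha_i^\vee=2\alpha_i/(\alpha_i,\alpha_i)$. The weight $w_{\alpha_i^\vee}$ corresponding to $\alpha_i^\vee$ is the vector (after identifying the space with its dual via the inner product) determined by $(w_{\alpha_i^\vee},\alpha_j^\vee)=\delta_{ij}$ for $1\le j\le n$. The Cartan matrix is $C_{i,j}=2(\alpha_i,\alpha_j)/(\alpha_j,\alpha_j)$. Branch vertices. The vertices of $\Gamma$ are $r_1,\dots,r_n$, with $r_i$ corresponding to $\alpha_i$; $r_i,r_j$ ($i\ne j$) are neighbours if $C_{i,j}\neq0$. Define $b(r_i)=1-\sum_{j\neq i}C_{i,j}$ if $r_i$ has exactly one neighbour, and $b(r_i)=-\sum_{j\ne i}C_{i,j}$ otherwise (sums over $1\le j\le n$). A vertex is a branch vertex if $b$ attains its maximum value on it. (In particular, for type $A_n$ every vertex is a branch vertex.) Affine data. Let $\alpha_0$ be minus the highest root of $X_n$. The affine Cartan matrix of $X_n^{(1)}$ is $C=(C_{i,j})_{0\le i,j\le n}$, $C_{i,j}=2(\alpha_i,\alpha_j)/(\alpha_j,\alpha_j)$. Let $V$ be the $(n+1)$-dimensional real vector space with basis formal symbols $\alpha_0,\alpha_1,\dots,\alpha_n$, and define $\sigma_j\in GL(V)$ by $\sigma_j(\alpha_i)=\alpha_i-C_{i,j}\alpha_j$. A Coxeter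 transformation of $X_n^{(1)}$ is a product $\sigma=\sigma_{\pi(0)}\sigma_{\pi(1)}\cdots\sigma_{\pi(n)}$ with $\pi$ a permutation of $\{0,\dots,n\}$; its characteristic polynomial on $V$ is called a Coxeter polynomial of $X_n^{(1)}$. Let $z=(z_0,\dots,z_n)\in\mathbb{Z}^{n+1}$ be a nonzero vector with $zC=0$ and $\alpha=\sum_i z_i\alpha_i\in V$; each $\sigma_j$ fixes $\alpha$, and the transformation induced by $\sigma$ on $\tilde V=V/\langle\alpha\rangle$ has finite order. This order $h$ is the affine Coxeter number associated with $\sigma$. The roots (with multiplicity) of the Coxeter polynomial of $\sigma$ are $e^{2\pi i m_j/h}$, $j=0,\dots,n$, with integers $0\le m_j\le h$; the root $1$ has multiplicity exactly $2$, and by convention it contributes the values $0$ and $h$. The integers $m_0,\dots,m_n$ (a multiset) are the affine exponents associated with $\sigma$. *)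

theory Defs
  imports "HOL-Analysis.Euclidean_Space" "HOL-Combinatorics.Permutations"
    "Jordan_Normal_Form.Char_Poly"
begin

section \<open>Root systems\<close>

text \<open>
  The real form of the dual of a Cartan subalgebra is an arbitrary Euclidean space. Its inner
  product is invariant under the Weyl group because the Weyl group is generated by orthogonal
  reflections; for an irreducible root system it is therefore the form induced by the Killing
  form up to a scalar, which the predicate \<open>long_roots_normalised\<close> fixes. Simple roots are
  indexed by \<open>1, \<dots>, n\<close>, and \<open>\<alpha> 0\<close> is reserved for minus the highest root.
\<close>

definition cartan_number :: "'a::real_inner \<Rightarrow> 'a \<Rightarrow> real" where
  "cartan_number a b = 2 * inner a b / inner b b"

definition coroot :: "'a::real_inner \<Rightarrow> 'a" where
  "coroot a = (2 / inner a a) *\<^sub>R a"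

definition root_system :: "'a::euclidean_space set \<Rightarrow> bool" where
  "root_system \<Phi> \<longleftrightarrow>
     finite \<Phi> \<and> 0 \<notin> \<Phi> \<and> span \<Phi> = UNIV \<and>
     (\<forall>a\<in>\<Phi>. \<forall>b\<in>\<Phi>. b - cartan_number b a *\<^sub>R a \<in> \<Phi>) \<and>
     (\<forall>a\<in>\<Phi>. \<forall>b\<in>\<Phi>. cartan_number b a \<in> \<int>) \<and>
     (\<forall>a\<in>\<Phi>. \<forall>t. t *\<^sub>R a \<in> \<Phi> \<longrightarrow> t = 1 \<or> t = -1)"

definition irreducible_root_system :: "'a::euclidean_space set \<Rightarrow> bool" where
  "irreducible_root_system \<Phi> \<longleftrightarrow>
     root_system \<Phi> \<and> \<Phi> \<noteq> {} \<and>
     \<not> (\<exists>\<Phi>\<^sub>1 \<Phi>\<^sub>2. \<Phi>\<^sub>1 \<noteq> {} \<and> \<Phi>\<^sub>2 \<noteq> {} \<and> \<Phi> = \<Phi>\<^sub>1 \<union> \<Phi>\<^sub>2 \<and>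
           (\<forall>a\<in>\<Phi>\<^sub>1. \<forall>b\<in>\<Phi>\<^sub>2. inner a b = 0))"

definition long_roots_normalised :: "'a::euclidean_space set \<Rightarrow> bool" where
  "long_roots_normalised \<Phi> \<longleftrightarrow>
     (\<forall>a\<in>\<Phi>. inner a a \<le> 2) \<and> (\<exists>a\<in>\<Phi>. inner a a = 2)"

definition simple_roots :: "'a::euclidean_space set \<Rightarrow> nat \<Rightarrow> (nat \<Rightarrow> 'a) \<Rightarrow> bool" where
  "simple_roots \<Phi> n \<alpha> \<longleftrightarrow>
     \<alpha> ` {1..n} \<subseteq> \<Phi> \<and> inj_on \<alpha> {1..n} \<and> independent (\<alpha> ` {1..n}) \<and>
     (\<forall>g\<in>\<Phi>. \<exists>k::nat \<Rightarrow> nat.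
        g = (\<Sum>i=1..n. real (k i) *\<^sub>R \<alpha> i) \<or> g = - (\<Sum>i=1..n. real (k i) *\<^sub>R \<alpha> i))"

definition highest_root :: "'a::euclidean_space set \<Rightarrow> nat \<Rightarrow> (nat \<Rightarrow> 'a) \<Rightarrow> 'a \<Rightarrow> bool" where
  "highest_root \<Phi> n \<alpha> \<theta> \<longleftrightarrow>
     \<theta> \<in> \<Phi> \<and> (\<forall>g\<in>\<Phi>. \<exists>k::nat \<Rightarrow> nat. \<theta> - g = (\<Sum>i=1..n. real (k i) *\<^sub>R \<alpha> i))"

definition cartan :: "(nat \<Rightarrow> 'a::real_inner) \<Rightarrow> nat \<Rightarrow> nat \<Rightarrow> real" where
  "cartan \<alpha> i j = cartan_number (\<alpha> i) (\<alpha> j)"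

definition coroot_lattice :: "nat \<Rightarrow> (nat \<Rightarrow> 'a::real_inner) \<Rightarrow> 'a set" where
  "coroot_lattice n \<alpha> = {\<Sum>i=1..n. of_int (k i) *\<^sub>R coroot (\<alpha> i) | k :: nat \<Rightarrow> int. True}"

text \<open>\<open>fundamental_weight n \<alpha> i w\<close>: the vector \<open>w\<close> is dual to the co-root of \<open>\<alpha> i\<close>.\<close>

definition fundamental_weight :: "nat \<Rightarrow> (nat \<Rightarrow> 'a::real_inner) \<Rightarrow> nat \<Rightarrow> 'a \<Rightarrow> bool" where
  "fundamental_weight n \<alpha> i w \<longleftrightarrow>
     (\<forall>j\<in>{1..n}. inner w (coroot (\<alpha> j)) = (if j = i then 1 else 0))"

section \<open>Types\<close>

datatype cartan_type =
  TypeA nat | TypeB nat | TypeC nat | TypeD nat | TypeE nat | TypeF4 | TypeG2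

fun valid_type :: "cartan_type \<Rightarrow> bool" where
  "valid_type (TypeA n) \<longleftrightarrow> n \<ge> 1"
| "valid_type (TypeB n) \<longleftrightarrow> n \<ge> 2"
| "valid_type (TypeC n) \<longleftrightarrow> n \<ge> 3"
| "valid_type (TypeD n) \<longleftrightarrow> n \<ge> 4"
| "valid_type (TypeE n) \<longleftrightarrow> n \<in> {6, 7, 8}"
| "valid_type TypeF4 \<longleftrightarrow> True"
| "valid_type TypeG2 \<longleftrightarrow> True"

fun type_rank :: "cartan_type \<Rightarrow> nat" where
  "type_rank (TypeA n) = n"
| "type_rank (TypeB n) = n"
| "type_rank (TypeC n) = n"
| "type_rank (TypeD n) = n"
| "type_rank (TypeE n) = n"
| "type_rank TypeF4 = 4"
| "type_rank TypeG2 = 2"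

definition simply_laced_entry :: "nat set set \<Rightarrow> nat \<Rightarrow> nat \<Rightarrow> int" where
  "simply_laced_entry E i j = (if i = j then 2 else if {i, j} \<in> E then -1 else 0)"

definition path_edges :: "nat \<Rightarrow> nat \<Rightarrow> nat set set" where
  "path_edges a b = {{k, k + 1} | k. a \<le> k \<and> k < b}"

text \<open>
  The nodes are \<open>1, \<dots>, n\<close> in Bourbaki's numbering; an entry \<open>-2\<close> or \<open>-3\<close> in position
  \<open>(i, j)\<close> means that \<open>\<alpha>\<^sub>i\<close> is long and \<open>\<alpha>\<^sub>j\<close> is short.
\<close>

fun type_cartan :: "cartan_type \<Rightarrow> nat \<Rightarrow> nat \<Rightarrow> int" where
  "type_cartan (TypeA n) i j = simply_laced_entry (path_edges 1 n) i j"
| "type_cartan (TypeB n) i j =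
     (if i = n - 1 \<and> j = n then -2 else simply_laced_entry (path_edges 1 n) i j)"
| "type_cartan (TypeC n) i j =
     (if i = n \<and> j = n - 1 then -2 else simply_laced_entry (path_edges 1 n) i j)"
| "type_cartan (TypeD n) i j =
     simply_laced_entry (insert {n - 2, n} (path_edges 1 (n - 1))) i j"
| "type_cartan (TypeE n) i j =
     simply_laced_entry ({{1, 3}, {2, 4}} \<union> path_edges 3 n) i j"
| "type_cartan TypeF4 i j =
     (if i = 2 \<and> j = 3 then -2 else simply_laced_entry (path_edges 1 4) i j)"
| "type_cartan TypeG2 i j =
     (if i = 2 \<and> j = 1 then -3 else simply_laced_entry (path_edges 1 2) i j)"

text \<open>
  The simple roots may be enumerated in any order, so that only the isomorphism class of the
  Dynkin diagram is prescribed.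
\<close>

definition has_type :: "cartan_type \<Rightarrow> nat \<Rightarrow> (nat \<Rightarrow> 'a::real_inner) \<Rightarrow> bool" where
  "has_type X n \<alpha> \<longleftrightarrow>
     valid_type X \<and> n = type_rank X \<and>
     (\<exists>p. bij_betw p {1..n} {1..n} \<and>
        (\<forall>i\<in>{1..n}. \<forall>j\<in>{1..n}. cartan \<alpha> i j = of_int (type_cartan X (p i) (p j))))"

section \<open>Branch vertices\<close>

definition neighbours :: "nat \<Rightarrow> (nat \<Rightarrow> 'a::real_inner) \<Rightarrow> nat \<Rightarrow> nat set" where
  "neighbours n \<alpha> i = {j \<in> {1..n}. j \<noteq> i \<and> cartan \<alpha> i j \<noteq> 0}"

definition branching :: "nat \<Rightarrow> (nat \<Rightarrow> 'a::real_inner) \<Rightarrow> nat \<Rightarrow> real" where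
  "branching n \<alpha> i =
     (if card (neighbours n \<alpha> i) = 1
      then 1 - (\<Sum>j\<in>{1..n} - {i}. cartan \<alpha> i j)
      else - (\<Sum>j\<in>{1..n} - {i}. cartan \<alpha> i j))"

definition branch_vertex :: "nat \<Rightarrow> (nat \<Rightarrow> 'a::real_inner) \<Rightarrow> nat \<Rightarrow> bool" where
  "branch_vertex n \<alpha> i \<longleftrightarrow>
     i \<in> {1..n} \<and> (\<forall>j\<in>{1..n}. branching n \<alpha> j \<le> branching n \<alpha> i)"

section \<open>Affine Coxeter transformations\<close>

text \<open>
  The space \<open>V\<close> with basis \<open>\<alpha>\<^sub>0, \<dots>, \<alpha>\<^sub>n\<close> is \<open>carrier_vec (n + 1)\<close>, the symbol \<open>\<alpha>\<^sub>i\<close> being the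
  \<open>i\<close>-th unit vector, and endomorphisms are matrices acting on column vectors. Column \<open>i\<close> of
  \<open>affine_reflection n C j\<close> thus contains the coordinates of \<open>\<alpha>\<^sub>i - C\<^sub>i\<^sub>j \<alpha>\<^sub>j\<close>.
\<close>

definition affine_reflection :: "nat \<Rightarrow> (nat \<Rightarrow> nat \<Rightarrow> real) \<Rightarrow> nat \<Rightarrow> real mat" where
  "affine_reflection n C j =
     Matrix.mat (n + 1) (n + 1)
       (\<lambda>(k, i). (if k = i then 1 else 0) - (if k = j then C i j else 0))"

definition coxeter_transformation ::
    "nat \<Rightarrow> (nat \<Rightarrow> nat \<Rightarrow> real) \<Rightarrow> (nat \<Rightarrow> nat) \<Rightarrow> real mat" where
  "coxeter_transformation n C p =
     foldr (\<lambda>k M. affine_reflection n C (p k) * M) [0..<n + 1] (1\<^sub>m (n + 1))"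

definition null_vector :: "nat \<Rightarrow> (nat \<Rightarrow> nat \<Rightarrow> real) \<Rightarrow> (nat \<Rightarrow> int) \<Rightarrow> bool" where
  "null_vector n C z \<longleftrightarrow>
     (\<exists>i\<le>n. z i \<noteq> 0) \<and> (\<forall>j\<le>n. (\<Sum>i=0..n. of_int (z i) * C i j) = 0)"

text \<open>The endomorphism of the quotient of \<open>V\<close> by the line through \<open>z\<close> induced by \<open>M\<close> is the identity.\<close>

definition trivial_mod_null :: "nat \<Rightarrow> (nat \<Rightarrow> int) \<Rightarrow> real mat \<Rightarrow> bool" where
  "trivial_mod_null n z M \<longleftrightarrow>
     (\<forall>v\<in>carrier_vec (n + 1). \<exists>t. M *\<^sub>v v - v = t \<cdot>\<^sub>v Matrix.vec (n + 1) (\<lambda>i. of_int (z i)))"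

definition affine_coxeter_number :: "nat \<Rightarrow> (nat \<Rightarrow> int) \<Rightarrow> real mat \<Rightarrow> nat \<Rightarrow> bool" where
  "affine_coxeter_number n z S h \<longleftrightarrow>
     0 < h \<and> trivial_mod_null n z (S ^\<^sub>m h) \<and>
     (\<forall>k. 0 < k \<and> trivial_mod_null n z (S ^\<^sub>m k) \<longrightarrow> h \<le> k)"

text \<open>
  Within the range \<open>{0..h}\<close> only \<open>0\<close> and \<open>h\<close> yield the root \<open>1\<close>. The two conditions on
  \<open>count\<close> express the convention that this double root contributes each of them once.
\<close>

definition affine_exponents :: "real mat \<Rightarrow> nat \<Rightarrow> int multiset \<Rightarrow> bool" where
  "affine_exponents S h M \<longleftrightarrow>
     (\<forall>m\<in>#M. 0 \<le> m \<and> m \<le> int h) \<and>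
     map_poly complex_of_real (char_poly S) =
       (\<Prod>m\<in>#M. [:- cis (2 * pi * real_of_int m / real h), 1:]) \<and>
     count M 0 = 1 \<and> count M (int h) = 1"

end

theory Submission
  imports Defs
begin

text \<open>
  Removing the branch vertex \<open>b\<close> from the Dynkin diagram leaves chains, the legs. Leg \<open>l\<close> has
  \<open>p l - 1\<close> nodes, numbered from the outside, so that \<open>b\<close> itself is at position \<open>p l\<close>. A vector of the
  root space has a coefficient \<open>A\<close> at \<open>b\<close> and coefficients \<open>u l j\<close> at the leg nodes. With
  the boundary values \<open>0\<close> at position \<open>0\<close> and \<open>a l * A\<close> at position \<open>p l\<close>, where \<open>a l\<close> is the number of
  bonds between leg and centre, the pairing with a co-root of the leg is a negative second
  difference. Hence the product \<open>c\<^sub>J\<close> of the reflections of the legs rotates the first differences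
  along every leg (\<open>leg_coxeter_star_vec\<close>): its order is \<open>lcm (p l)\<close> and its characteristic
  polynomial is \<open>(X - 1) * (\<Prod>l. (X ^ p l - 1) / (X - 1))\<close>.

  Modulo the null vector, an affine Coxeter transformation acts on the root space of \<open>X\<^sub>n\<close>, with
  \<open>\<sigma>\<^sub>0\<close> acting as the reflection in the highest root \<open>\<theta>\<close>. For the word \<open>0, b, legs\<close> it is
  \<open>s\<^sub>\<theta> c\<close> with \<open>c = s\<^sub>b c\<^sub>J\<close>. The heart of the proof is that \<open>c ^ s\<close> maps \<open>\<theta>\<close> to \<open>- \<alpha>\<^sub>b\<close>, where \<open>s\<close> is the
  coefficient of \<open>\<alpha>\<^sub>b\<close> in \<open>\<theta>\<close> (\<open>highest_root_in_orbit\<close>). Conjugation with \<open>c ^ s\<close> then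
  turns \<open>s\<^sub>\<theta> c\<close> into \<open>s\<^sub>b s\<^sub>b c\<^sub>J = c\<^sub>J\<close>. So the affine Coxeter number is \<open>h = lcm (p l)\<close>, the Coxeter
  polynomial is \<open>(X - 1) ^ 2 * (\<Prod>l. (X ^ p l - 1) / (X - 1))\<close>, and the affine exponents are
  \<open>0\<close>, \<open>h\<close> and the numbers \<open>h * j / p l\<close> for \<open>0 < j < p l\<close>. Assign \<open>h\<close> to \<open>b\<close> and \<open>h * j / p l\<close> to the
  \<open>j\<close>-th node of leg \<open>l\<close>: along every leg the exponents grow linearly from \<open>0\<close> to \<open>h\<close>.

  The weight \<open>w\<close> is orthogonal to the simple co-roots other than the one of \<open>b\<close>. The second differences of
  its coordinates along the legs therefore vanish, so that these coordinates are proportional to the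
  exponents. A multiple of \<open>w\<close> in the co-root lattice has a coordinate at \<open>b\<close> which is divisible by
  every \<open>p l\<close>, and the smallest positive value of this coordinate is \<open>lcm (p l) = h\<close>
  (\<open>weight_coordinates\<close>).

  The orbit of \<open>- \<alpha>\<^sub>b\<close> under the inverse of \<open>c\<close> is explicit: as long as \<open>\<Sum>l. a l * (t - \<lceil>t / p l\<rceil>) = 2 * t - 1\<close>
  holds for \<open>2 \<le> t \<le> s\<close>, the \<open>s\<close>-th vector of the orbit has the coefficient \<open>s\<close> at \<open>b\<close> and
  \<open>a l * (\<Sum>i<j. \<lceil>(s - i) / p l\<rceil>)\<close> in the legs (\<open>coxeter_orbit\<close>). It is dominant as soon as the
  sum for \<open>t = s + 1\<close> is at most \<open>2 * s\<close>, and then it is the highest root, because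
  \<open>\<alpha>\<^sub>b\<close> is a longest root. The classification enters only in \<open>star_of_type\<close>: it provides
  the legs and a number \<open>s\<close> with these properties.
\<close>

\<comment> \<open>Leg positions start at \<open>1\<close>; index sets such as \<open>{1..n}\<close> are to keep this form.\<close>
declare One_nat_def [simp del]

section \<open>Reflections\<close>

definition reflection :: "'a::real_inner \<Rightarrow> 'a \<Rightarrow> 'a" where
  "reflection a v = v - cartan_number v a *\<^sub>R a"

lemma cartan_number_simps:
  "cartan_number (v + w) a = cartan_number v a + cartan_number w a"
  "cartan_number (v - w) a = cartan_number v a - cartan_number w a"
  "cartan_number (- v) a = - cartan_number v a"
  "cartan_number (t *\<^sub>R v) a = t * cartan_number v a"
  "cartan_number 0 a = 0"
  "cartan_number v (- a) = - cartan_number v a"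
  by (simp_all add: cartan_number_def inner_simps add_divide_distrib diff_divide_distrib)

lemma cartan_number_sum: "cartan_number (\<Sum>i\<in>I. f i) a = (\<Sum>i\<in>I. cartan_number (f i) a)"
  by (induction I rule: infinite_finite_induct) (simp_all add: cartan_number_simps)

lemma cartan_number_self: "a \<noteq> 0 \<Longrightarrow> cartan_number a a = 2"
  by (simp add: cartan_number_def)

lemma reflection_linear: "linear (reflection a)"
  by (rule linearI) (simp_all add: reflection_def cartan_number_simps algebra_simps)

lemma reflection_uminus: "reflection (- a) = reflection a"
  by (rule ext) (simp add: reflection_def cartan_number_simps)

lemma reflection_inner: "inner (reflection a v) (reflection a w) = inner v w"
proof (cases "a = 0")
  case False
  then show ?thesis
    by (simp add: reflection_def cartan_number_def inner_simps inner_commute)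
qed (simp add: reflection_def)

lemma reflection_reflection: "reflection a (reflection a v) = v"
proof (cases "a = 0")
  case False
  then show ?thesis
    by (simp add: reflection_def cartan_number_simps cartan_number_self)
qed (simp add: reflection_def)

lemma reflection_conjugate:
  assumes "linear g" and "\<And>v w. inner (g v) (g w) = inner v w"
  shows "g (reflection a v) = reflection (g a) (g v)"
  using assms(2)
  by (simp add: reflection_def cartan_number_def linear_diff[OF assms(1)] linear_scale[OF assms(1)])

definition reflect_word :: "(nat \<Rightarrow> 'a::real_inner) \<Rightarrow> nat list \<Rightarrow> 'a \<Rightarrow> 'a" where
  "reflect_word \<alpha> js = foldr (\<lambda>j g. reflection (\<alpha> j) \<circ> g) js id"

lemma reflect_word_simps [simp]:
  "reflect_word \<alpha> [] v = v"
  "reflect_word \<alpha> (j # js) v = reflection (\<alpha> j) (reflect_word \<alpha> js v)"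
  by (simp_all add: reflect_word_def)

lemma reflect_word_append: "reflect_word \<alpha> (is @ js) v = reflect_word \<alpha> is (reflect_word \<alpha> js v)"
  by (induction "is") simp_all

lemma reflect_word_linear: "linear (reflect_word \<alpha> js)"
proof (induction js)
  case Nil
  show ?case by (rule linearI) simp_all
next
  case (Cons j js)
  have "reflect_word \<alpha> (j # js) = reflection (\<alpha> j) \<circ> reflect_word \<alpha> js" by (simp add: fun_eq_iff)
  then show ?case by (simp only: linear_compose[OF Cons reflection_linear])
qed

lemma reflect_word_inner: "inner (reflect_word \<alpha> js v) (reflect_word \<alpha> js w) = inner v w"
  by (induction js) (simp_all add: reflection_inner)

lemma reflect_word_inverse: "reflect_word \<alpha> (rev js) (reflect_word \<alpha> js v) = v"
  by (induction js arbitrary: v) (simp_all add: reflect_word_append reflection_reflection)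

lemma reflect_word_bij: "bij (reflect_word \<alpha> js)"
  using reflect_word_inverse[of \<alpha> js] reflect_word_inverse[of \<alpha> "rev js"]
  by (intro bij_betw_byWitness[where f' = "reflect_word \<alpha> (rev js)"]) auto

lemma linear_funpow: "linear (g :: 'a::real_vector \<Rightarrow> 'a) \<Longrightarrow> linear (g ^^ k)"
proof (induction k)
  case 0
  show ?case by (rule linearI) simp_all
next
  case (Suc k)
  then show ?case unfolding funpow.simps by (intro linear_compose)
qed

lemma reflect_word_funpow_inner:
  "inner ((reflect_word \<alpha> js ^^ k) v) ((reflect_word \<alpha> js ^^ k) w) = inner v w"
  by (induction k) (simp_all add: reflect_word_inner)

lemma reflect_word_funpow_bij: "bij (reflect_word \<alpha> js ^^ k)"
  by (simp add: bij_fn reflect_word_bij)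

section \<open>Star-shaped Dynkin diagrams\<close>

text \<open>
  The vertex \<open>x l j\<close> is at position \<open>j\<close> of leg \<open>l\<close>, counted from the outer end. Legs may be empty
  (\<open>p l = 1\<close>), which covers an end of a diagram of type \<open>A\<close> as centre. Only the bond at the centre
  may be multiple, and the centre is then the long end.
\<close>

definition star_diagram ::
    "(nat \<Rightarrow> nat \<Rightarrow> real) \<Rightarrow> nat \<Rightarrow> nat \<Rightarrow> nat \<Rightarrow> (nat \<Rightarrow> nat) \<Rightarrow> (nat \<Rightarrow> nat) \<Rightarrow> (nat \<Rightarrow> nat \<Rightarrow> nat) \<Rightarrow> bool"
  where
  "star_diagram C n b r p a x \<longleftrightarrow>
     b \<in> {1..n} \<and> (\<forall>l<r. 1 \<le> p l) \<and>
     bij_betw (\<lambda>(l, j). x l j) (SIGMA l:{..<r}. {1..<p l}) ({1..n} - {b}) \<and>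
     C b b = 2 \<and>
     (\<forall>l<r. \<forall>j\<in>{1..<p l}.
        C b (x l j) = (if Suc j = p l then - real (a l) else 0) \<and>
        C (x l j) b = (if Suc j = p l then -1 else 0)) \<and>
     (\<forall>l<r. \<forall>j\<in>{1..<p l}. \<forall>l'<r. \<forall>j'\<in>{1..<p l'}.
        C (x l j) (x l' j') =
          (if l = l' then (if j = j' then 2 else if j' = Suc j \<or> j = Suc j' then -1 else 0) else 0))"

locale indexed_basis =
  fixes \<alpha> :: "nat \<Rightarrow> 'a::euclidean_space" and n :: nat
  assumes inj: "inj_on \<alpha> {1..n}"
    and indep: "independent (\<alpha> ` {1..n})"
    and span: "span (\<alpha> ` {1..n}) = UNIV"
begin

lemma coefficients_unique:
  assumes "(\<Sum>i=1..n. s i *\<^sub>R \<alpha> i) = (\<Sum>i=1..n. t i *\<^sub>R \<alpha> i)" and "i \<in> {1..n}"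
  shows "s i = t i"
proof -
  let ?g = "\<lambda>i. s i - t i"
  have "(\<Sum>v\<in>\<alpha> ` {1..n}. ?g (inv_into {1..n} \<alpha> v) *\<^sub>R v) = (\<Sum>i=1..n. ?g i *\<^sub>R \<alpha> i)"
    by (subst sum.reindex[OF inj]) (simp add: inj)
  also have "\<dots> = 0" using assms(1) by (simp add: scaleR_diff_left sum_subtractf)
  finally have "?g (inv_into {1..n} \<alpha> (\<alpha> i)) = 0"
    using assms(2) by (intro independentD[OF indep, of "\<alpha> ` {1..n}"]) auto
  then show ?thesis using inj assms(2) by simp
qed

lemma coefficients_exist: obtains s where "v = (\<Sum>i=1..n. s i *\<^sub>R \<alpha> i)"
proof -
  have "v \<in> span (\<alpha> ` {1..n})" using span by simp
  then obtain u where "v = (\<Sum>w\<in>\<alpha> ` {1..n}. u w *\<^sub>R w)"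
    by (auto simp: span_finite)
  then have "v = (\<Sum>i=1..n. u (\<alpha> i) *\<^sub>R \<alpha> i)" by (simp add: sum.reindex[OF inj])
  then show ?thesis by (rule that)
qed

lemma root_nonzero: "i \<in> {1..n} \<Longrightarrow> \<alpha> i \<noteq> 0"
  using indep dependent_zero by (metis imageI)

lemma orthogonal_zero:
  assumes "\<And>i. i \<in> {1..n} \<Longrightarrow> cartan_number v (\<alpha> i) = 0"
  shows "v = 0"
proof -
  obtain s where s: "v = (\<Sum>i=1..n. s i *\<^sub>R \<alpha> i)" by (rule coefficients_exist)
  have "inner v (\<alpha> i) = 0" if "i \<in> {1..n}" for i
    using assms[OF that] root_nonzero[OF that] by (simp add: cartan_number_def)
  then have "inner v v = 0" by (subst (2) s) (simp add: inner_sum_right)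
  then show ?thesis by simp
qed

end

locale star_basis = indexed_basis \<alpha> n
  for \<alpha> :: "nat \<Rightarrow> 'a::euclidean_space" and n +
  fixes b r :: nat and p a :: "nat \<Rightarrow> nat" and x :: "nat \<Rightarrow> nat \<Rightarrow> nat"
  assumes star: "star_diagram (cartan \<alpha>) n b r p a x"
begin

definition places :: "(nat \<times> nat) set" where
  "places = (SIGMA l:{..<r}. {1..<p l})"

definition node_fun :: "'b \<Rightarrow> (nat \<Rightarrow> nat \<Rightarrow> 'b) \<Rightarrow> nat \<Rightarrow> 'b" where
  "node_fun A u i = (if i = b then A else (\<lambda>(l, j). u l j) (inv_into places (\<lambda>(l, j). x l j) i))"

lemma b_in: "b \<in> {1..n}"
  and p_pos: "l < r \<Longrightarrow> 1 \<le> p l"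
  and x_bij: "bij_betw (\<lambda>(l, j). x l j) places ({1..n} - {b})"
  using star unfolding star_diagram_def places_def by blast+

lemma x_in: "l < r \<Longrightarrow> 1 \<le> j \<Longrightarrow> j < p l \<Longrightarrow> x l j \<in> {1..n}"
  and x_neq_b: "l < r \<Longrightarrow> 1 \<le> j \<Longrightarrow> j < p l \<Longrightarrow> x l j \<noteq> b"
  using bij_betwE[OF x_bij] by (auto simp: places_def)

lemma node_cases:
  assumes "i \<in> {1..n}"
  obtains "i = b" | l j where "l < r" "1 \<le> j" "j < p l" "i = x l j"
proof (cases "i = b")
  case False
  then have "i \<in> (\<lambda>(l, j). x l j) ` places"
    using assms(1) bij_betw_imp_surj_on[OF x_bij] by simp
  then show ?thesis using that(2) by (auto simp: places_def)
qed (rule that(1))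

lemma x_inj:
  assumes "l < r" "1 \<le> j" "j < p l" "l' < r" "1 \<le> j'" "j' < p l'" "x l j = x l' j'"
  shows "l = l' \<and> j = j'"
  using inj_onD[OF bij_betw_imp_inj_on[OF x_bij], of "(l, j)" "(l', j')"] assms
  by (auto simp: places_def)

lemma node_fun_b [simp]: "node_fun A u b = A"
  by (simp add: node_fun_def)

lemma node_fun_x [simp]: "l < r \<Longrightarrow> 1 \<le> j \<Longrightarrow> j < p l \<Longrightarrow> node_fun A u (x l j) = u l j"
  using inv_into_f_f[OF bij_betw_imp_inj_on[OF x_bij], of "(l, j)"] x_neq_b[of l j]
  by (auto simp: node_fun_def places_def)

lemma sum_nodes:
  fixes f :: "nat \<Rightarrow> 'b::comm_monoid_add"
  shows "(\<Sum>i=1..n. f i) = f b + (\<Sum>l<r. \<Sum>j\<in>{1..<p l}. f (x l j))"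
proof -
  have "(\<Sum>i=1..n. f i) = f b + (\<Sum>i\<in>{1..n} - {b}. f i)"
    using b_in by (intro sum.remove) auto
  also have "(\<Sum>i\<in>{1..n} - {b}. f i) = (\<Sum>(l, j)\<in>places. f (x l j))"
    by (subst sum.reindex_bij_betw[OF x_bij, symmetric]) (simp add: case_prod_unfold)
  also have "\<dots> = (\<Sum>l<r. \<Sum>j\<in>{1..<p l}. f (x l j))"
    unfolding places_def by (subst sum.Sigma) auto
  finally show ?thesis .
qed

lemma prod_nodes:
  fixes f :: "nat \<Rightarrow> 'b::comm_monoid_mult"
  shows "(\<Prod>i=1..n. f i) = f b * (\<Prod>l<r. \<Prod>j\<in>{1..<p l}. f (x l j))"
proof -
  have "(\<Prod>i=1..n. f i) = f b * (\<Prod>i\<in>{1..n} - {b}. f i)"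
    using b_in by (intro prod.remove) auto
  also have "(\<Prod>i\<in>{1..n} - {b}. f i) = (\<Prod>(l, j)\<in>places. f (x l j))"
    by (subst prod.reindex_bij_betw[OF x_bij, symmetric]) (simp add: case_prod_unfold)
  also have "\<dots> = (\<Prod>l<r. \<Prod>j\<in>{1..<p l}. f (x l j))"
    unfolding places_def by (subst prod.Sigma) auto
  finally show ?thesis .
qed

text \<open>
  Only the values \<open>u l j\<close> at positions \<open>0 < j < p l\<close> enter. The lemmas below fix the values at \<open>0\<close> and
  \<open>p l\<close> in the way that makes the two ends of a leg look like its interior.
\<close>

definition star_vec :: "real \<Rightarrow> (nat \<Rightarrow> nat \<Rightarrow> real) \<Rightarrow> 'a" where
  "star_vec A u = A *\<^sub>R \<alpha> b + (\<Sum>l<r. \<Sum>j\<in>{1..<p l}. u l j *\<^sub>R \<alpha> (x l j))"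

lemma star_vec_node_fun: "star_vec A u = (\<Sum>i=1..n. node_fun A u i *\<^sub>R \<alpha> i)"
  by (simp add: sum_nodes star_vec_def)

lemma star_vec_cong:
  "A = A' \<Longrightarrow> (\<And>l j. l < r \<Longrightarrow> 1 \<le> j \<Longrightarrow> j < p l \<Longrightarrow> u l j = u' l j) \<Longrightarrow> star_vec A u = star_vec A' u'"
  by (simp add: star_vec_def)

lemma star_vec_unique:
  assumes "star_vec A u = star_vec A' u'"
  shows "A = A'" and "l < r \<Longrightarrow> 1 \<le> j \<Longrightarrow> j < p l \<Longrightarrow> u l j = u' l j"
proof -
  have eq: "node_fun A u i = node_fun A' u' i" if "i \<in> {1..n}" for i
    using assms that unfolding star_vec_node_fun by (rule coefficients_unique)
  show "A = A'" using eq[OF b_in] by simp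
  show "u l j = u' l j" if "l < r" "1 \<le> j" "j < p l" using eq[OF x_in[OF that]] that by simp
qed

lemma cartan_b_b: "cartan \<alpha> b b = 2"
  and cartan_b_x: "l < r \<Longrightarrow> 1 \<le> j \<Longrightarrow> j < p l \<Longrightarrow>
        cartan \<alpha> b (x l j) = (if Suc j = p l then - real (a l) else 0)"
  and cartan_x_b: "l < r \<Longrightarrow> 1 \<le> j \<Longrightarrow> j < p l \<Longrightarrow>
        cartan \<alpha> (x l j) b = (if Suc j = p l then -1 else 0)"
  and cartan_x_x: "l < r \<Longrightarrow> 1 \<le> j \<Longrightarrow> j < p l \<Longrightarrow> l' < r \<Longrightarrow> 1 \<le> j' \<Longrightarrow> j' < p l' \<Longrightarrow>
        cartan \<alpha> (x l j) (x l' j') =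
          (if l = l' then (if j = j' then 2 else if j' = Suc j \<or> j = Suc j' then -1 else 0) else 0)"
  using star unfolding star_diagram_def by auto

lemma second_difference_sum:
  fixes u :: "nat \<Rightarrow> real"
  assumes "1 \<le> j" "j < q" "u 0 = 0"
  shows "(\<Sum>i\<in>{1..<q}. u i * (if i = j then 2 else if j = Suc i \<or> i = Suc j then -1 else 0)) =
         2 * u j - u (j - 1) - (if Suc j < q then u (Suc j) else 0)"
proof -
  let ?e = "\<lambda>i k. if i = k then 1 else (0::real)"
  have "(\<Sum>i\<in>{1..<q}. u i * (if i = j then 2 else if j = Suc i \<or> i = Suc j then -1 else 0)) =
        (\<Sum>i\<in>{1..<q}. 2 * (u i * ?e i j) - u i * ?e i (j - 1) - u i * ?e i (Suc j))"
    using assms by (intro sum.cong) auto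
  also have "\<dots> = 2 * u j - (if 1 \<le> j - 1 then u (j - 1) else 0) - (if Suc j < q then u (Suc j) else 0)"
    using assms unfolding sum_subtractf sum_distrib_left[symmetric] by (auto simp: if_distrib sum.delta cong: if_cong)
  also have "(if 1 \<le> j - 1 then u (j - 1) else 0) = u (j - 1)"
    using assms by (cases "j = 1") auto
  finally show ?thesis .
qed

text \<open>
  The entry of the Cartan matrix between the centre and the leg is \<open>- a l\<close>, hence the value \<open>a l * A\<close>
  at position \<open>p l\<close>: it lets the centre contribute as if it were a node of the leg.
\<close>

lemma pairing_leg:
  fixes u :: "nat \<Rightarrow> nat \<Rightarrow> real"
  assumes l: "l < r" and j: "1 \<le> j" "j < p l" and u: "u l 0 = 0" "u l (p l) = real (a l) * A"
  shows "cartan_number (star_vec A u) (\<alpha> (x l j)) = 2 * u l j - u l (j - 1) - u l (Suc j)"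
proof -
  let ?t = "\<lambda>l' j'. u l' j' * cartan \<alpha> (x l' j') (x l j)"
  have "cartan_number (star_vec A u) (\<alpha> (x l j)) =
      A * cartan \<alpha> b (x l j) + (\<Sum>l'<r. \<Sum>j'\<in>{1..<p l'}. ?t l' j')"
    by (simp add: star_vec_def cartan_number_simps cartan_number_sum cartan_def)
  also have "(\<Sum>l'<r. \<Sum>j'\<in>{1..<p l'}. ?t l' j') = (\<Sum>l'<r. if l' = l then \<Sum>j'\<in>{1..<p l}. ?t l j' else 0)"
    using assms by (intro sum.cong) (auto simp: cartan_x_x)
  also have "\<dots> = (\<Sum>j'\<in>{1..<p l}. ?t l j')" using l by simp
  also have "\<dots> = (\<Sum>i\<in>{1..<p l}. u l i * (if i = j then 2 else if j = Suc i \<or> i = Suc j then -1 else 0))"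
    using assms by (intro sum.cong) (auto simp: cartan_x_x)
  also have "\<dots> = 2 * u l j - u l (j - 1) - (if Suc j < p l then u l (Suc j) else 0)"
    using assms by (intro second_difference_sum)
  finally have "cartan_number (star_vec A u) (\<alpha> (x l j)) =
      A * cartan \<alpha> b (x l j) + (2 * u l j - u l (j - 1) - (if Suc j < p l then u l (Suc j) else 0))" .
  moreover have "Suc j < p l \<or> p l = Suc j" using j by linarith
  ultimately show ?thesis using assms by (auto simp: cartan_b_x)
qed

lemma pairing_centre:
  fixes u :: "nat \<Rightarrow> nat \<Rightarrow> real"
  assumes u: "\<And>l. l < r \<Longrightarrow> u l 0 = 0"
  shows "cartan_number (star_vec A u) (\<alpha> b) = 2 * A - (\<Sum>l<r. u l (p l - 1))"
proof -
  have "cartan_number (star_vec A u) (\<alpha> b) =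
      A * cartan \<alpha> b b + (\<Sum>l<r. \<Sum>j\<in>{1..<p l}. u l j * cartan \<alpha> (x l j) b)"
    by (simp add: star_vec_def cartan_number_simps cartan_number_sum cartan_def)
  also have "(\<Sum>l<r. \<Sum>j\<in>{1..<p l}. u l j * cartan \<alpha> (x l j) b) = (\<Sum>l<r. - u l (p l - 1))"
  proof (rule sum.cong[OF refl])
    fix l assume "l \<in> {..<r}"
    then have l: "l < r" "1 \<le> p l" by (auto simp: p_pos)
    have "(\<Sum>j\<in>{1..<p l}. u l j * cartan \<alpha> (x l j) b) = (\<Sum>j\<in>{1..<p l}. if j = p l - 1 then - u l j else 0)"
      using l by (intro sum.cong) (auto simp: cartan_x_b)
    also have "\<dots> = - u l (p l - 1)" using l u[of l] by (cases "p l = 1") (auto simp: sum.delta)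
    finally show "(\<Sum>j\<in>{1..<p l}. u l j * cartan \<alpha> (x l j) b) = - u l (p l - 1)" .
  qed
  finally show ?thesis by (simp add: cartan_b_b sum_negf)
qed

end

context star_basis
begin

section \<open>The Coxeter element of the legs\<close>

text \<open>
  The last factor of a product acts first. Every leg is therefore listed from the centre outwards, so
  that its outer end is reflected first.
\<close>

definition leg_word :: "nat list" where
  "leg_word = concat (map (\<lambda>l. map (x l) (rev [1..<p l])) [0..<r])"

abbreviation leg_coxeter :: "'a \<Rightarrow> 'a" where
  "leg_coxeter \<equiv> reflect_word \<alpha> leg_word"

abbreviation coxeter :: "'a \<Rightarrow> 'a" where
  "coxeter \<equiv> reflect_word \<alpha> (b # leg_word)"

lemma reflection_leg:
  fixes u :: "nat \<Rightarrow> nat \<Rightarrow> real"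
  assumes "l < r" "1 \<le> j" "j < p l" "u l 0 = 0" "u l (p l) = real (a l) * A"
  shows "reflection (\<alpha> (x l j)) (star_vec A u) =
         star_vec A (u(l := (u l)(j := u l (j - 1) + u l (Suc j) - u l j)))"
proof -
  let ?d = "u l (j - 1) + u l (Suc j) - 2 * u l j"
  let ?v = "u(l := (u l)(j := u l (j - 1) + u l (Suc j) - u l j))"
  have "star_vec A ?v = A *\<^sub>R \<alpha> b + (\<Sum>l'<r. \<Sum>j'\<in>{1..<p l'}. u l' j' *\<^sub>R \<alpha> (x l' j') +
          (if l' = l \<and> j' = j then ?d *\<^sub>R \<alpha> (x l j) else 0))"
    unfolding star_vec_def
    by (intro arg_cong2[of _ _ _ _ plus] refl sum.cong) (auto simp: scaleR_left_distrib[symmetric])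
  also have "\<dots> = star_vec A u + (\<Sum>l'<r. \<Sum>j'\<in>{1..<p l'}. if l' = l \<and> j' = j then ?d *\<^sub>R \<alpha> (x l j) else 0)"
    by (simp add: star_vec_def sum.distrib add.assoc)
  also have "(\<Sum>l'<r. \<Sum>j'\<in>{1..<p l'}. if l' = l \<and> j' = j then ?d *\<^sub>R \<alpha> (x l j) else 0) =
      (\<Sum>l'<r. if l' = l then \<Sum>j'\<in>{1..<p l}. if j' = j then ?d *\<^sub>R \<alpha> (x l j) else 0 else 0)"
    by (intro sum.cong) auto
  also have "\<dots> = ?d *\<^sub>R \<alpha> (x l j)"
    using assms by (simp add: sum.delta)
  finally have "star_vec A ?v = star_vec A u + ?d *\<^sub>R \<alpha> (x l j)" .
  moreover have "cartan_number (star_vec A u) (\<alpha> (x l j)) = - ?d"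
    using pairing_leg[of l j u A] assms by simp
  ultimately show ?thesis
    by (simp only: reflection_def scaleR_minus_left diff_minus_eq_add)
qed

text \<open>
  After the first \<open>t\<close> reflections the entry at position \<open>t\<close> is \<open>u (t + 1) - u 1\<close>, and the next reflection
  replaces \<open>u (t + 1)\<close> by \<open>(u (t + 1) - u 1) + u (t + 2) - u (t + 1)\<close>.
\<close>

lemma leg_rotation:
  fixes u :: "nat \<Rightarrow> nat \<Rightarrow> real"
  assumes "l < r" "u l 0 = 0" "u l (p l) = real (a l) * A" "t < p l"
  shows "reflect_word \<alpha> (map (x l) (rev [1..<Suc t])) (star_vec A u) =
         star_vec A (u(l := \<lambda>j. if 1 \<le> j \<and> j \<le> t then u l (Suc j) - u l 1 else u l j))"
  using \<open>t < p l\<close>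
proof (induction t)
  case 0
  have "u(l := \<lambda>j. if 1 \<le> j \<and> j \<le> 0 then u l (Suc j) - u l 1 else u l j) = u"
    by (intro ext) (auto simp: fun_upd_def)
  then show ?case by simp
next
  case (Suc t)
  let ?u = "\<lambda>t. u(l := \<lambda>j. if 1 \<le> j \<and> j \<le> t then u l (Suc j) - u l 1 else u l j)"
  have "reflect_word \<alpha> (map (x l) (rev [1..<Suc (Suc t)])) (star_vec A u) =
        reflection (\<alpha> (x l (Suc t))) (star_vec A (?u t))"
  proof -
    have "rev [1..<Suc (Suc t)] = Suc t # rev [1..<Suc t]" by simp
    moreover have "t < p l" using Suc.prems by simp
    ultimately show ?thesis by (simp only: list.map reflect_word_simps Suc.IH)
  qed
  also have "\<dots> = star_vec A ((?u t)(l := (?u t l)(Suc t := ?u t l (Suc t - 1) + ?u t l (Suc (Suc t)) - ?u t l (Suc t))))"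
    using Suc.prems assms by (intro reflection_leg) auto
  also have "\<dots> = star_vec A (?u (Suc t))"
    using assms(2) by (intro star_vec_cong refl) (cases "t = 0"; auto simp: One_nat_def le_Suc_eq)
  finally show ?case .
qed

text \<open>
  In terms of the differences \<open>d j = u l j - u l (j - 1)\<close> for \<open>1 \<le> j \<le> p l\<close> the map is the
  rotation \<open>d j \<mapsto> d (j + 1)\<close>: the sum of all differences is the boundary value \<open>a l * A\<close>, which is preserved.
\<close>

lemma leg_coxeter_star_vec:
  fixes u :: "nat \<Rightarrow> nat \<Rightarrow> real"
  assumes "\<And>l. l < r \<Longrightarrow> u l 0 = 0" and "\<And>l. l < r \<Longrightarrow> u l (p l) = real (a l) * A"
  shows "leg_coxeter (star_vec A u) = star_vec A (\<lambda>l j. u l (Suc j) - u l 1)"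
proof -
  have legs: "reflect_word \<alpha> (concat (map (\<lambda>l. map (x l) (rev [1..<p l])) [0..<m])) (star_vec A u) =
        star_vec A (\<lambda>l j. if l < m \<and> 1 \<le> j \<and> j < p l then u l (Suc j) - u l 1 else u l j)"
    if "m \<le> r" "\<And>l. l < r \<Longrightarrow> u l 0 = 0" "\<And>l. l < r \<Longrightarrow> u l (p l) = real (a l) * A"
    for m and u :: "nat \<Rightarrow> nat \<Rightarrow> real"
    using that
  proof (induction m arbitrary: u)
    case (Suc m)
    let ?u = "u(m := \<lambda>j. if 1 \<le> j \<and> j \<le> p m - 1 then u m (Suc j) - u m 1 else u m j)"
    have p: "p m = Suc (p m - 1)" using Suc.prems p_pos[of m] by simp
    have "reflect_word \<alpha> (map (x m) (rev [1..<p m])) (star_vec A u) = star_vec A ?u"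
      using leg_rotation[of m u A "p m - 1"] Suc.prems p by (simp add: less_eq_Suc_le)
    then have "reflect_word \<alpha> (concat (map (\<lambda>l. map (x l) (rev [1..<p l])) [0..<Suc m])) (star_vec A u) =
        reflect_word \<alpha> (concat (map (\<lambda>l. map (x l) (rev [1..<p l])) [0..<m])) (star_vec A ?u)"
      by (simp add: reflect_word_append)
    also have "\<dots> = star_vec A (\<lambda>l j. if l < m \<and> 1 \<le> j \<and> j < p l then ?u l (Suc j) - ?u l 1 else ?u l j)"
      using Suc.prems p p_pos[of m] by (intro Suc.IH) auto
    also have "\<dots> = star_vec A (\<lambda>l j. if l < Suc m \<and> 1 \<le> j \<and> j < p l then u l (Suc j) - u l 1 else u l j)"
      by (intro star_vec_cong refl) (auto simp: less_Suc_eq)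
    finally show ?case .
  qed simp
  have "leg_coxeter (star_vec A u) =
      star_vec A (\<lambda>l j. if l < r \<and> 1 \<le> j \<and> j < p l then u l (Suc j) - u l 1 else u l j)"
    unfolding leg_word_def using assms by (intro legs) auto
  also have "\<dots> = star_vec A (\<lambda>l j. u l (Suc j) - u l 1)"
    by (intro star_vec_cong) auto
  finally show ?thesis .
qed

text \<open>
  The rotation becomes a shift when the differences are continued periodically, that is, when \<open>u l\<close> is continued
  quasi-periodically with increment \<open>a l * A\<close>. Powers can then be read off without reduction modulo \<open>p l\<close>.
\<close>

lemma leg_coxeter_funpow:
  fixes u :: "nat \<Rightarrow> nat \<Rightarrow> real"
  assumes "\<And>l. l < r \<Longrightarrow> u l 0 = 0"
    and "\<And>l j. l < r \<Longrightarrow> u l (j + p l) = u l j + real (a l) * A"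
  shows "(leg_coxeter ^^ k) (star_vec A u) = star_vec A (\<lambda>l j. u l (j + k) - u l k)"
proof (induction k)
  case 0
  show ?case using assms(1) by (auto intro: star_vec_cong)
next
  case (Suc k)
  have "(leg_coxeter ^^ Suc k) (star_vec A u) = leg_coxeter (star_vec A (\<lambda>l j. u l (j + k) - u l k))"
    using Suc by simp
  also have "\<dots> = star_vec A (\<lambda>l j. (u l (Suc j + k) - u l k) - (u l (1 + k) - u l k))"
    using assms(2)[of _ k] by (intro leg_coxeter_star_vec) (simp_all add: add.commute)
  also have "\<dots> = star_vec A (\<lambda>l j. u l (j + Suc k) - u l (Suc k))"
    by (simp add: One_nat_def)
  finally show ?case .
qed

lemma quasi_periodic_star_vec:
  "\<exists>A (u :: nat \<Rightarrow> nat \<Rightarrow> real). v = star_vec A u \<and> (\<forall>l<r. u l 0 = 0) \<and>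
     (\<forall>l<r. \<forall>j. u l (j + p l) = u l j + real (a l) * A)"
proof -
  obtain s where s: "v = (\<Sum>i=1..n. s i *\<^sub>R \<alpha> i)" by (rule coefficients_exist)
  define A where "A = s b"
  define u where "u l j = (if j mod p l = 0 then 0 else s (x l (j mod p l))) +
      real (j div p l) * (real (a l) * A)" for l j
  have "v = star_vec A u"
    unfolding s star_vec_def sum_nodes A_def by (auto simp: u_def intro!: sum.cong)
  moreover have "u l 0 = 0" for l by (simp add: u_def)
  moreover have "u l (j + p l) = u l j + real (a l) * A" if "l < r" for l j
    using p_pos[OF that] by (simp add: u_def algebra_simps)
  ultimately show ?thesis by blast
qed

definition leg_period :: nat where
  "leg_period = Lcm (p ` {..<r})"

lemma leg_period_pos: "0 < leg_period"
proof -
  have "0 \<notin> p ` {..<r}" using p_pos by force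
  then show ?thesis by (simp add: leg_period_def Lcm_0_iff_nat zero_less_iff_neq_zero)
qed

lemma p_dvd_leg_period: "l < r \<Longrightarrow> p l dvd leg_period"
  by (simp add: leg_period_def)

text \<open>
  A shift by a common multiple of all \<open>p l\<close> changes a quasi-periodic function by a constant. Conversely, the
  periodic function which vanishes exactly at the multiples of \<open>p l\<close> detects that \<open>p l\<close> divides
  the exponent.
\<close>

lemma leg_coxeter_order: "leg_coxeter ^^ k = id \<longleftrightarrow> leg_period dvd k"
proof
  assume k: "leg_coxeter ^^ k = id"
  have "p l dvd k" if l: "l < r" for l
  proof (rule ccontr)
    assume ndvd: "\<not> p l dvd k"
    define u :: "nat \<Rightarrow> nat \<Rightarrow> real" where "u l j = (if p l dvd j then 0 else 1)" for l j
    have "star_vec 0 u = (leg_coxeter ^^ k) (star_vec 0 u)" by (simp add: k)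
    also have "\<dots> = star_vec 0 (\<lambda>l j. u l (j + k) - u l k)"
      by (rule leg_coxeter_funpow) (simp_all add: u_def)
    finally have eq: "star_vec 0 u = star_vec 0 (\<lambda>l j. u l (j + k) - u l k)" .
    have "1 < p l" using ndvd p_pos[OF l] by (cases "p l = 1") auto
    from star_vec_unique(2)[OF eq l _ this] have "u l 1 = u l (1 + k) - u l k" by simp
    then show False using ndvd \<open>1 < p l\<close> by (auto simp: u_def split: if_splits)
  qed
  then show "leg_period dvd k" by (auto simp: leg_period_def intro!: Lcm_least)
next
  assume k: "leg_period dvd k"
  show "leg_coxeter ^^ k = id"
  proof
    fix v
    obtain A u where v: "v = star_vec A u" and u0: "\<And>l. l < r \<Longrightarrow> u l 0 = 0"
      and u: "\<And>l j. l < r \<Longrightarrow> u l (j + p l) = u l j + real (a l) * A"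
      using quasi_periodic_star_vec[of v] by blast
    have shift: "u l (j + m * p l) = u l j + real m * (real (a l) * A)" if "l < r" for l j m
    proof (induction m)
      case (Suc m)
      have "u l (j + Suc m * p l) = u l (j + m * p l + p l)" by (simp add: ac_simps)
      also have "\<dots> = u l (j + m * p l) + real (a l) * A" by (rule u[OF that])
      finally show ?case using Suc by (simp add: algebra_simps)
    qed simp
    have "u l (j + k) - u l k = u l j" if l: "l < r" for l j
    proof -
      obtain m where "k = m * p l"
        using dvd_trans[OF p_dvd_leg_period[OF l] k] by (metis dvd_def mult.commute)
      then show ?thesis using shift[OF l, of j m] shift[OF l, of 0 m] u0[OF l] by simp
    qed
    then have "star_vec A (\<lambda>l j. u l (j + k) - u l k) = star_vec A u"
      by (intro star_vec_cong) simp_all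
    then show "(leg_coxeter ^^ k) v = id v"
      by (simp add: v leg_coxeter_funpow u0 u)
  qed
qed

section \<open>The orbit of the branch root\<close>

end

definition ceil_div :: "nat \<Rightarrow> nat \<Rightarrow> nat" where
  "ceil_div m q = (m + q - 1) div q"

lemma ceil_div_step:
  assumes "1 \<le> q"
  shows "ceil_div (Suc m) q = ceil_div (Suc m - q) q + 1"
proof -
  have "ceil_div (Suc m) q = m div q + 1" using assms by (simp add: ceil_div_def)
  moreover have "ceil_div (Suc m - q) q = m div q"
  proof (cases "q \<le> Suc m")
    case True
    then have "Suc m - q + q - 1 = m" by linarith
    then show ?thesis by (simp only: ceil_div_def)
  next
    case False
    then show ?thesis using assms by (simp add: ceil_div_def)
  qed
  ultimately show ?thesis by (simp only:)
qed

lemma ceil_div_mono: "m \<le> m' \<Longrightarrow> ceil_div m q \<le> ceil_div m' q"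
  by (simp add: ceil_div_def div_le_mono)

lemma ceil_div_0 [simp]: "1 \<le> q \<Longrightarrow> ceil_div 0 q = 0"
  and ceil_div_1 [simp]: "1 \<le> q \<Longrightarrow> ceil_div 1 q = 1"
  by (simp_all add: ceil_div_def)

lemma ceil_div_le: "1 \<le> q \<Longrightarrow> ceil_div m q \<le> m"
proof (induction m rule: less_induct)
  case (less m)
  show ?case
  proof (cases m)
    case (Suc k)
    then show ?thesis using less.IH[of "m - q"] less.prems ceil_div_step[of q k] by simp
  qed (use less.prems in simp)
qed

text \<open>
  Passing from \<open>m\<close> to \<open>m + 1\<close> shifts the summands by one place. It drops \<open>\<lceil>(m + 1 - q) / q\<rceil>\<close> at one
  end and adds \<open>\<lceil>(m + 1) / q\<rceil>\<close>, which is larger by one, at the other.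
\<close>

lemma sum_ceil_div: "1 \<le> q \<Longrightarrow> (\<Sum>i<q. ceil_div (m - i) q) = m"
proof (induction m)
  case (Suc m)
  obtain q' where q: "q = Suc q'" using Suc.prems by (cases q) auto
  have "(\<Sum>i<q. ceil_div (Suc m - i) q) = ceil_div (Suc m) q + (\<Sum>i<q'. ceil_div (m - i) q)"
    unfolding q by (subst sum.lessThan_Suc_shift) simp
  also have "ceil_div (Suc m) q = ceil_div (m - q') q + 1"
    using ceil_div_step[of q m] Suc.prems q by simp
  also have "ceil_div (m - q') q + 1 + (\<Sum>i<q'. ceil_div (m - i) q) = (\<Sum>i<q. ceil_div (m - i) q) + 1"
    unfolding q by simp
  finally show ?case using Suc by simp
qed simp

text \<open>
  The sum over the legs of \<open>a l * s\<close> minus the outermost coefficient of the orbit vector with central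
  coefficient \<open>s\<close>. By \<open>coxeter_orbit_step\<close> the next central coefficient is this number minus \<open>s\<close>.
\<close>

definition star_defect :: "nat \<Rightarrow> (nat \<Rightarrow> nat) \<Rightarrow> (nat \<Rightarrow> nat) \<Rightarrow> nat \<Rightarrow> nat" where
  "star_defect r p a s = (\<Sum>l<r. a l * (s - ceil_div s (p l)))"

context star_basis
begin

abbreviation leg_defect :: "nat \<Rightarrow> nat" where
  "leg_defect \<equiv> star_defect r p a"

text \<open>
  The coefficients along leg \<open>l\<close> of the orbit vector with central coefficient \<open>s\<close>. Their differences are
  \<open>a l * \<lceil>(s - j) / p l\<rceil>\<close>, which is what the rotation of the leg and the decrease of the central
  coefficient by one at every step lead to.
\<close>

definition orbit_coeff :: "nat \<Rightarrow> nat \<Rightarrow> nat \<Rightarrow> real" where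
  "orbit_coeff s l j = real (a l * (\<Sum>i<j. ceil_div (s - i) (p l)))"

lemma orbit_coeff_0 [simp]: "orbit_coeff s l 0 = 0"
  by (simp add: orbit_coeff_def)

text \<open>
  The boundary condition at the centre; this is where rounding up is needed.
\<close>

lemma orbit_coeff_p: "l < r \<Longrightarrow> orbit_coeff s l (p l) = real (a l) * real s"
  using sum_ceil_div[OF p_pos, of l s] by (simp add: orbit_coeff_def del: of_nat_sum)

lemma star_vec_centre_shift: "star_vec A u - t *\<^sub>R \<alpha> b = star_vec (A - t) u"
  by (simp add: star_vec_def scaleR_left_diff_distrib)

lemma coxeter_orbit_step:
  assumes "1 \<le> s"
  shows "coxeter (star_vec (real s) (orbit_coeff s)) =
         star_vec (real (leg_defect s) - real s) (orbit_coeff (s - 1))"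
proof -
  let ?u = "orbit_coeff s"
  define v where "v = (\<lambda>l j. ?u l (Suc j) - ?u l 1)"
  have shift: "v l j = orbit_coeff (s - 1) l j" for l j
  proof -
    have "s - Suc i = s - 1 - i" for i by simp
    then have "(\<Sum>i<Suc j. ceil_div (s - i) (p l)) = ceil_div s (p l) + (\<Sum>i<j. ceil_div (s - 1 - i) (p l))"
      by (simp only: sum.lessThan_Suc_shift) simp
    then show ?thesis
      by (simp add: v_def orbit_coeff_def One_nat_def distrib_left del: sum.lessThan_Suc of_nat_sum)
  qed
  have v0: "v l 0 = 0" for l by (simp add: v_def One_nat_def)
  have last: "v l (p l - 1) = real (a l * (s - ceil_div s (p l)))" if "l < r" for l
  proof -
    have "Suc (p l - 1) = p l" using p_pos[OF that] by simp
    then have "v l (p l - 1) = real (a l) * real s - real (a l) * real (ceil_div s (p l))"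
      by (simp add: v_def orbit_coeff_p[OF that]) (simp add: orbit_coeff_def One_nat_def)
    then show ?thesis
      using ceil_div_le[OF p_pos[OF that], of s] by (simp add: of_nat_diff right_diff_distrib)
  qed
  have "leg_coxeter (star_vec (real s) ?u) = star_vec (real s) v"
    unfolding v_def by (rule leg_coxeter_star_vec) (simp_all add: orbit_coeff_p)
  then have "coxeter (star_vec (real s) ?u) = reflection (\<alpha> b) (star_vec (real s) v)" by simp
  also have "\<dots> = star_vec (real s) v - (2 * real s - real (leg_defect s)) *\<^sub>R \<alpha> b"
    by (simp add: reflection_def pairing_centre v0 last star_defect_def)
  also have "\<dots> = star_vec (real s - (2 * real s - real (leg_defect s))) v"
    by (rule star_vec_centre_shift)
  also have "\<dots> = star_vec (real (leg_defect s) - real s) v"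
    by simp
  finally show ?thesis by (simp add: shift cong: star_vec_cong)
qed

text \<open>
  The central coefficient runs through \<open>s, s - 1, \<dots>, 1\<close>. At level \<open>1\<close> the defect is \<open>0\<close>, so the last
  step leads to the central coefficient \<open>-1\<close>, and the coefficients of the legs at level \<open>0\<close> vanish.
\<close>

lemma coxeter_orbit:
  assumes "1 \<le> s" and "\<And>t. 2 \<le> t \<Longrightarrow> t \<le> s \<Longrightarrow> leg_defect t = 2 * t - 1"
  shows "(coxeter ^^ s) (star_vec (real s) (orbit_coeff s)) = - \<alpha> b"
  using assms
proof (induction s)
  case (Suc s)
  have step: "(coxeter ^^ Suc s) (star_vec (real (Suc s)) (orbit_coeff (Suc s))) =
        (coxeter ^^ s) (star_vec (real (leg_defect (Suc s)) - real (Suc s)) (orbit_coeff s))"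
    unfolding funpow_Suc_right o_apply using coxeter_orbit_step[of "Suc s"] by simp
  show ?case
  proof (cases "s = 0")
    case True
    have "leg_defect 1 = 0" by (auto simp: star_defect_def p_pos)
    moreover have "orbit_coeff 0 l j = 0" if "l < r" for l j
      using p_pos[OF that] by (simp add: orbit_coeff_def)
    ultimately show ?thesis unfolding step using True by (simp add: star_vec_def One_nat_def)
  next
    case False
    then have "leg_defect (Suc s) = 2 * Suc s - 1" by (intro Suc.prems) auto
    then have "real (leg_defect (Suc s)) - real (Suc s) = real s" by simp
    moreover have "(coxeter ^^ s) (star_vec (real s) (orbit_coeff s)) = - \<alpha> b"
      using False Suc.prems by (intro Suc.IH) auto
    ultimately show ?thesis unfolding step by (simp only:)
  qed
qed simp

text \<open>
  Along a leg the differences do not increase, so the coefficients are concave. At the centre the pairing is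
  \<open>2 * s\<close> minus the sum of the neighbouring coefficients, which is the defect of the next level.
\<close>

lemma orbit_vector_dominant:
  assumes "leg_defect (Suc s) \<le> 2 * s" and "i \<in> {1..n}"
  shows "0 \<le> cartan_number (star_vec (real s) (orbit_coeff s)) (\<alpha> i)"
  using assms(2)
proof (cases rule: node_cases)
  case 1
  have eq: "orbit_coeff s l (p l - 1) = real (a l * (Suc s - ceil_div (Suc s) (p l)))" if l: "l < r" for l
  proof -
    obtain q where q: "p l = Suc q" using p_pos[OF l] by (cases "p l") auto
    have "(\<Sum>i<q. ceil_div (s - i) (p l)) + ceil_div (s - q) (p l) = s"
      using sum_ceil_div[OF p_pos[OF l], of s] q by simp
    moreover have "ceil_div (Suc s) (p l) = ceil_div (s - q) (p l) + 1"
      using ceil_div_step[OF p_pos[OF l], of s] q by simp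
    ultimately have "(\<Sum>i<q. ceil_div (s - i) (p l)) = Suc s - ceil_div (Suc s) (p l)" by linarith
    then show ?thesis by (simp add: orbit_coeff_def q One_nat_def del: of_nat_sum)
  qed
  have "cartan_number (star_vec (real s) (orbit_coeff s)) (\<alpha> b) = 2 * real s - real (leg_defect (Suc s))"
    by (simp add: pairing_centre eq star_defect_def)
  then show ?thesis using assms(1) 1 by simp
next
  case (2 l j)
  obtain k where k: "j = Suc k" using 2 by (cases j) auto
  have "cartan_number (star_vec (real s) (orbit_coeff s)) (\<alpha> (x l j)) =
      real (a l * ceil_div (s - k) (p l)) - real (a l * ceil_div (s - j) (p l))"
    using 2 by (subst pairing_leg) (simp_all add: orbit_coeff_p, simp add: orbit_coeff_def k algebra_simps)
  also have "\<dots> \<ge> 0" using ceil_div_mono[of "s - j" "s - k" "p l"] k by (simp add: mult_left_mono)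
  finally show ?thesis using 2 by simp
qed

end

section \<open>Roots and the highest root\<close>

lemma simple_roots_combination:
  assumes "simple_roots \<Phi> n \<alpha>" and "g \<in> \<Phi>"
  obtains k :: "nat \<Rightarrow> nat" where
    "g = (\<Sum>i=1..n. real (k i) *\<^sub>R \<alpha> i) \<or> g = - (\<Sum>i=1..n. real (k i) *\<^sub>R \<alpha> i)"
  using assms by (auto simp: simple_roots_def dest!: bspec[of \<Phi> _ g])

lemma simple_roots_indexed_basis:
  fixes \<Phi> :: "'a::euclidean_space set"
  assumes "root_system \<Phi>" and "simple_roots \<Phi> n \<alpha>"
  shows "indexed_basis \<alpha> n"
proof
  show "inj_on \<alpha> {1..n}" and "independent (\<alpha> ` {1..n})"
    using assms(2) by (auto simp: simple_roots_def)
  have "g \<in> span (\<alpha> ` {1..n})" if g: "g \<in> \<Phi>" for g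
  proof -
    obtain k :: "nat \<Rightarrow> nat" where
      "g = (\<Sum>i=1..n. real (k i) *\<^sub>R \<alpha> i) \<or> g = - (\<Sum>i=1..n. real (k i) *\<^sub>R \<alpha> i)"
      by (rule simple_roots_combination[OF assms(2) g])
    moreover have "(\<Sum>i=1..n. real (k i) *\<^sub>R \<alpha> i) \<in> span (\<alpha> ` {1..n})"
      by (intro span_sum span_scale span_base) auto
    ultimately show ?thesis by (auto intro: span_neg)
  qed
  then have "span \<Phi> \<subseteq> span (\<alpha> ` {1..n})" by (intro span_minimal subsetI) auto
  then show "span (\<alpha> ` {1..n}) = UNIV" using assms(1) by (auto simp: root_system_def)
qed

lemma reflection_in_roots:
  "root_system \<Phi> \<Longrightarrow> a \<in> \<Phi> \<Longrightarrow> v \<in> \<Phi> \<Longrightarrow> reflection a v \<in> \<Phi>"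
  by (auto simp: root_system_def reflection_def)

lemma reflect_word_in_roots:
  "root_system \<Phi> \<Longrightarrow> \<alpha> ` set js \<subseteq> \<Phi> \<Longrightarrow> v \<in> \<Phi> \<Longrightarrow> reflect_word \<alpha> js v \<in> \<Phi>"
  by (induction js) (auto simp: reflection_in_roots)

lemma uminus_in_roots:
  assumes "root_system \<Phi>" "v \<in> \<Phi>"
  shows "- v \<in> \<Phi>"
proof -
  have "v \<noteq> 0" using assms by (auto simp: root_system_def)
  then have "reflection v v = - v" by (simp add: reflection_def cartan_number_self scaleR_2)
  then show ?thesis using reflection_in_roots[OF assms(1) assms(2) assms(2)] by simp
qed

text \<open>
  A positive root which is not simple has a positive inner product with some simple root in its support. The
  reflection in this simple root keeps some other positive coefficient, so the result is again a
  positive root. It has the same length and smaller height.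
\<close>

lemma positive_root_norm:
  fixes \<Phi> :: "'a::euclidean_space set" and k :: "nat \<Rightarrow> nat"
  assumes \<Phi>: "root_system \<Phi>" and simple: "simple_roots \<Phi> n \<alpha>"
    and "(\<Sum>i=1..n. real (k i) *\<^sub>R \<alpha> i) \<in> \<Phi>"
  shows "\<exists>i\<in>{1..n}. inner (\<Sum>i=1..n. real (k i) *\<^sub>R \<alpha> i) (\<Sum>i=1..n. real (k i) *\<^sub>R \<alpha> i) =
           inner (\<alpha> i) (\<alpha> i)"
  using assms(3)
proof (induction "\<Sum>i=1..n. k i" arbitrary: k rule: less_induct)
  case less
  interpret indexed_basis \<alpha> n by (rule simple_roots_indexed_basis[OF \<Phi> simple])
  let ?\<gamma> = "\<Sum>i=1..n. real (k i) *\<^sub>R \<alpha> i"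
  have simple_in: "\<alpha> i \<in> \<Phi>" if "i \<in> {1..n}" for i
    using simple that by (auto simp: simple_roots_def)
  have "?\<gamma> \<noteq> 0" using less.prems \<Phi> by (auto simp: root_system_def)
  then have "0 < inner ?\<gamma> ?\<gamma>" by simp
  also have "inner ?\<gamma> ?\<gamma> = (\<Sum>i=1..n. real (k i) * inner (\<alpha> i) ?\<gamma>)"
    by (subst inner_sum_left) simp
  finally obtain i where i: "i \<in> {1..n}" and pos: "0 < real (k i) * inner (\<alpha> i) ?\<gamma>"
    by (meson not_less sum_nonpos)
  have k_pos: "0 < k i" and "0 < inner (\<alpha> i) ?\<gamma>"
    using pos by (auto simp: zero_less_mult_iff)
  then have N_pos: "0 < cartan_number ?\<gamma> (\<alpha> i)"
    using root_nonzero[OF i] by (simp add: cartan_number_def inner_commute)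
  show ?case
  proof (cases "\<forall>j\<in>{1..n} - {i}. k j = 0")
    case True
    have "?\<gamma> = real (k i) *\<^sub>R \<alpha> i"
      using i True by (subst sum.remove[of _ i]) auto
    moreover from this have "real (k i) = 1 \<or> real (k i) = -1"
      using \<Phi> simple_in[OF i] less.prems unfolding root_system_def by metis
    ultimately have "?\<gamma> = \<alpha> i" by auto
    then show ?thesis using i by auto
  next
    case False
    then obtain j where "j \<in> {1..n} - {i}" "k j \<noteq> 0" by blast
    then have j: "j \<in> {1..n}" "j \<noteq> i" "0 < k j" by auto
    let ?\<gamma>' = "reflection (\<alpha> i) ?\<gamma>"
    let ?N = "cartan_number ?\<gamma> (\<alpha> i)"
    have \<gamma>'_in: "?\<gamma>' \<in> \<Phi>" using reflection_in_roots \<Phi> simple_in[OF i] less.prems by blast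
    have \<gamma>': "?\<gamma>' = (\<Sum>m=1..n. (real (k m) - (if m = i then ?N else 0)) *\<^sub>R \<alpha> m)"
      using i by (simp add: reflection_def scaleR_left_diff_distrib sum_subtractf if_distrib[of "\<lambda>t. t *\<^sub>R _"] cong: if_cong)
    obtain k' :: "nat \<Rightarrow> nat" where k':
      "?\<gamma>' = (\<Sum>m=1..n. real (k' m) *\<^sub>R \<alpha> m) \<or> ?\<gamma>' = - (\<Sum>m=1..n. real (k' m) *\<^sub>R \<alpha> m)"
      by (rule simple_roots_combination[OF simple \<gamma>'_in])
    moreover have "?\<gamma>' \<noteq> - (\<Sum>m=1..n. real (k' m) *\<^sub>R \<alpha> m)"
    proof
      assume "?\<gamma>' = - (\<Sum>m=1..n. real (k' m) *\<^sub>R \<alpha> m)"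
      then have "(\<Sum>m=1..n. (real (k m) - (if m = i then ?N else 0)) *\<^sub>R \<alpha> m) =
          (\<Sum>m=1..n. (- real (k' m)) *\<^sub>R \<alpha> m)"
        unfolding \<gamma>' by (simp add: sum_negf)
      from coefficients_unique[OF this j(1)] show False using j by simp
    qed
    ultimately have k': "?\<gamma>' = (\<Sum>m=1..n. real (k' m) *\<^sub>R \<alpha> m)" by blast
    have coeff: "real (k' m) = real (k m) - (if m = i then ?N else 0)" if "m \<in> {1..n}" for m
      using coefficients_unique[OF trans[OF k'[symmetric] \<gamma>'] that] .
    have "(\<Sum>m=1..n. k' m) < (\<Sum>m=1..n. k m)"
    proof (rule sum_strict_mono_ex1)
      show "\<forall>m\<in>{1..n}. k' m \<le> k m"
      proof
        fix m assume "m \<in> {1..n}"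
        then have "real (k' m) \<le> real (k m)" using coeff[of m] N_pos by (cases "m = i") simp_all
        then show "k' m \<le> k m" by simp
      qed
      have "real (k' i) < real (k i)" using coeff[OF i] N_pos by simp
      then show "\<exists>m\<in>{1..n}. k' m < k m" using i by (intro bexI[of _ i]) simp_all
    qed simp
    from less.hyps[OF this] show ?thesis using \<gamma>'_in
      unfolding k'[symmetric] by (simp add: reflection_inner)
  qed
qed

lemma root_norm:
  fixes \<Phi> :: "'a::euclidean_space set"
  assumes "root_system \<Phi>" and "simple_roots \<Phi> n \<alpha>" and "\<gamma> \<in> \<Phi>"
  obtains i where "i \<in> {1..n}" "inner \<gamma> \<gamma> = inner (\<alpha> i) (\<alpha> i)"
proof -
  obtain k :: "nat \<Rightarrow> nat" where
    k: "\<gamma> = (\<Sum>i=1..n. real (k i) *\<^sub>R \<alpha> i) \<or> \<gamma> = - (\<Sum>i=1..n. real (k i) *\<^sub>R \<alpha> i)"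
    by (rule simple_roots_combination[OF assms(2,3)])
  have "(\<Sum>i=1..n. real (k i) *\<^sub>R \<alpha> i) \<in> \<Phi>"
    using k assms(3) uminus_in_roots[OF assms(1,3)] by auto
  from positive_root_norm[OF assms(1,2) this] show ?thesis using k that by auto
qed

text \<open>
  The difference \<open>\<delta> = \<theta> - \<theta>'\<close> is a non-negative combination of simple roots. Therefore
  \<open>\<theta> \<bullet> \<theta> = \<theta>' \<bullet> \<theta>' + 2 * (\<theta>' \<bullet> \<delta>) + \<delta> \<bullet> \<delta>\<close> exceeds \<open>\<theta>' \<bullet> \<theta>'\<close> unless \<open>\<delta> = 0\<close>.
\<close>

lemma dominant_long_root_unique:
  assumes \<theta>: "highest_root \<Phi> n \<alpha> \<theta>" and "\<theta>' \<in> \<Phi>"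
    and dominant: "\<And>i. i \<in> {1..n} \<Longrightarrow> 0 \<le> inner \<theta>' (\<alpha> i)"
    and long: "\<And>\<gamma>. \<gamma> \<in> \<Phi> \<Longrightarrow> inner \<gamma> \<gamma> \<le> inner \<theta>' \<theta>'"
  shows "\<theta> = \<theta>'"
proof -
  obtain k :: "nat \<Rightarrow> nat" where k: "\<theta> - \<theta>' = (\<Sum>i=1..n. real (k i) *\<^sub>R \<alpha> i)"
    using \<theta> \<open>\<theta>' \<in> \<Phi>\<close> unfolding highest_root_def by blast
  let ?\<delta> = "\<theta> - \<theta>'"
  have "0 \<le> inner \<theta>' ?\<delta>"
    unfolding k inner_sum_right using dominant by (auto intro!: sum_nonneg)
  moreover have "inner \<theta> \<theta> = inner \<theta>' \<theta>' + 2 * inner \<theta>' ?\<delta> + inner ?\<delta> ?\<delta>"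
    by (simp add: inner_diff_left inner_diff_right inner_commute)
  moreover have "inner \<theta> \<theta> \<le> inner \<theta>' \<theta>'"
    using long \<theta> by (simp add: highest_root_def)
  ultimately have "inner ?\<delta> ?\<delta> \<le> 0" by linarith
  then have "inner ?\<delta> ?\<delta> = 0" by (intro antisym inner_ge_zero)
  then show ?thesis by simp
qed

context star_basis
begin

text \<open>
  Simple bonds join roots of equal length, and the ratio of the two Cartan entries at the centre gives
  the factor \<open>a l\<close>.
\<close>

lemma leg_node_norm:
  assumes l: "l < r" and j: "1 \<le> j" "j < p l"
  shows "inner (\<alpha> b) (\<alpha> b) = real (a l) * inner (\<alpha> (x l j)) (\<alpha> (x l j))"
proof -
  have norm: "inner (\<alpha> i) (\<alpha> i) \<noteq> 0" if "i \<in> {1..n}" for i using root_nonzero[OF that] by simp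
  have "j \<le> p l - 1" using j by simp
  then show ?thesis
    using \<open>1 \<le> j\<close>
  proof (induction rule: inc_induct)
    case base
    have p: "1 \<le> p l - 1" "p l - 1 < p l" using j by auto
    have "cartan \<alpha> b (x l (p l - 1)) = - real (a l)" "cartan \<alpha> (x l (p l - 1)) b = -1"
      using cartan_b_x[OF l p] cartan_x_b[OF l p] j by simp_all
    then show ?case
      using norm[OF b_in] norm[OF x_in[OF l p]]
      by (simp add: cartan_def cartan_number_def inner_commute field_simps)
  next
    case (step m)
    have m: "1 \<le> m" "m < p l" "1 \<le> Suc m" "Suc m < p l" using step j by auto
    have "cartan \<alpha> (x l m) (x l (Suc m)) = -1" "cartan \<alpha> (x l (Suc m)) (x l m) = -1"
      using cartan_x_x[OF l m(1,2) l m(3,4)] cartan_x_x[OF l m(3,4) l m(1,2)] by simp_all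
    then have "inner (\<alpha> (x l m)) (\<alpha> (x l m)) = inner (\<alpha> (x l (Suc m))) (\<alpha> (x l (Suc m)))"
      using norm[OF x_in[OF l m(1,2)]] norm[OF x_in[OF l m(3,4)]]
      by (simp add: cartan_def cartan_number_def inner_commute field_simps)
    then show ?case using step m by simp
  qed
qed

lemma leg_multiplicity_pos: "l < r \<Longrightarrow> 1 < p l \<Longrightarrow> 1 \<le> a l"
  using leg_node_norm[of l 1] root_nonzero[OF b_in] by (cases "a l") auto

lemma centre_longest:
  assumes "i \<in> {1..n}"
  shows "inner (\<alpha> i) (\<alpha> i) \<le> inner (\<alpha> b) (\<alpha> b)"
  using assms
proof (cases rule: node_cases)
  case (2 l j)
  then have "1 * inner (\<alpha> i) (\<alpha> i) \<le> real (a l) * inner (\<alpha> i) (\<alpha> i)"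
    using leg_multiplicity_pos[of l] by (intro mult_right_mono) auto
  then show ?thesis using leg_node_norm[of l j] 2 by simp
qed simp

lemma set_leg_word: "set leg_word = {1..n} - {b}"
proof -
  have "set leg_word = (\<Union>l<r. x l ` {1..<p l})" by (auto simp: leg_word_def)
  also have "\<dots> = (\<lambda>(l, j). x l j) ` places" by (force simp: places_def)
  finally show ?thesis using bij_betw_imp_surj_on[OF x_bij] by (rule trans)
qed

text \<open>
  The orbit vector is a root, being an image of \<open>- \<alpha> b\<close> under the Weyl group. It is dominant and of
  maximal length, hence it is the highest root.
\<close>

lemma highest_root_in_orbit:
  assumes \<Phi>: "root_system \<Phi>" and simple: "simple_roots \<Phi> n \<alpha>" and \<theta>: "highest_root \<Phi> n \<alpha> \<theta>"
    and s: "1 \<le> s" and defect: "\<And>t. 2 \<le> t \<Longrightarrow> t \<le> s \<Longrightarrow> leg_defect t = 2 * t - 1"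
    and stop: "leg_defect (Suc s) \<le> 2 * s"
  shows "(coxeter ^^ s) \<theta> = - \<alpha> b"
proof -
  let ?v = "star_vec (real s) (orbit_coeff s)"
  have orbit: "(coxeter ^^ s) ?v = - \<alpha> b"
    using s defect by (rule coxeter_orbit)
  let ?back = "reflect_word \<alpha> (rev (b # leg_word))"
  have simple_in: "\<alpha> ` {1..n} \<subseteq> \<Phi>" using simple by (simp add: simple_roots_def)
  have undo: "(?back ^^ k) ((coxeter ^^ k) v) = v" for k v
  proof (induction k arbitrary: v)
    case (Suc k)
    have "(?back ^^ Suc k) ((coxeter ^^ Suc k) v) = (?back ^^ k) (?back (coxeter ((coxeter ^^ k) v)))"
      by (subst funpow_Suc_right) (simp only: funpow.simps(2) o_apply)
    also have "\<dots> = v" using reflect_word_inverse Suc by metis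
    finally show ?case .
  qed simp
  have "(?back ^^ k) w \<in> \<Phi>" if "w \<in> \<Phi>" for k w
  proof (induction k)
    case (Suc k)
    have "\<alpha> ` set (rev (b # leg_word)) \<subseteq> \<Phi>" using simple_in b_in by (auto simp: set_leg_word)
    then show ?case using reflect_word_in_roots[OF \<Phi> _ Suc] by simp
  qed (use that in simp)
  moreover have "- \<alpha> b \<in> \<Phi>"
    using simple_in b_in by (intro uminus_in_roots[OF \<Phi>]) auto
  ultimately have "(?back ^^ s) (- \<alpha> b) \<in> \<Phi>" .
  then have v_in: "?v \<in> \<Phi>" using undo[of s ?v] unfolding orbit by (simp only:)
  have norm: "inner ?v ?v = inner (\<alpha> b) (\<alpha> b)"
    using reflect_word_funpow_inner[of s \<alpha> "b # leg_word" ?v ?v] unfolding orbit by simp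
  have "\<theta> = ?v"
  proof (rule dominant_long_root_unique[OF \<theta> v_in])
    fix i assume i: "i \<in> {1..n}"
    show "0 \<le> inner ?v (\<alpha> i)"
    proof -
      have "0 < inner (\<alpha> i) (\<alpha> i)" using root_nonzero[OF i] by simp
      then show ?thesis
        using orbit_vector_dominant[OF stop i] unfolding cartan_number_def zero_le_divide_iff by argo
    qed
  next
    fix \<gamma> assume "\<gamma> \<in> \<Phi>"
    then show "inner \<gamma> \<gamma> \<le> inner ?v ?v"
      unfolding norm using root_norm[OF \<Phi> simple] centre_longest by metis
  qed
  then show ?thesis using orbit by simp
qed

text \<open>
  With \<open>g = coxeter ^^ s\<close> the reflection in \<open>\<theta>\<close> is conjugate under \<open>g\<close> to the reflection in
  \<open>g \<theta> = - \<alpha> b\<close>, and this reflection cancels the first letter of the Coxeter element.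
\<close>

lemma affine_coxeter_conjugate:
  assumes "\<alpha> 0 = - \<theta>" and "(coxeter ^^ s) \<theta> = - \<alpha> b"
  shows "(coxeter ^^ s) (reflect_word \<alpha> (0 # b # leg_word) v) = leg_coxeter ((coxeter ^^ s) v)"
proof -
  have "(coxeter ^^ s) (reflect_word \<alpha> (0 # b # leg_word) v) =
        (coxeter ^^ s) (reflection \<theta> (coxeter v))"
    by (simp add: assms(1) reflection_uminus)
  also have "\<dots> = reflection (- \<alpha> b) ((coxeter ^^ s) (coxeter v))"
    unfolding assms(2)[symmetric]
    by (intro reflection_conjugate linear_funpow reflect_word_linear reflect_word_funpow_inner)
  also have "(coxeter ^^ s) (coxeter v) = coxeter ((coxeter ^^ s) v)"
    by (rule funpow_swap1[symmetric])
  also have "reflection (- \<alpha> b) (coxeter ((coxeter ^^ s) v)) = leg_coxeter ((coxeter ^^ s) v)"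
    by (simp add: reflection_uminus reflection_reflection)
  finally show ?thesis .
qed

lemma affine_coxeter_order:
  assumes "\<alpha> 0 = - \<theta>" and "(coxeter ^^ s) \<theta> = - \<alpha> b"
  shows "reflect_word \<alpha> (0 # b # leg_word) ^^ k = id \<longleftrightarrow> leg_period dvd k"
proof -
  let ?w = "reflect_word \<alpha> (0 # b # leg_word)" and ?g = "coxeter ^^ s"
  have conj: "?g ((?w ^^ k) v) = (leg_coxeter ^^ k) (?g v)" for v
    by (induction k arbitrary: v) (simp_all only: funpow_0 funpow.simps o_apply id_apply affine_coxeter_conjugate[OF assms])
  have bij: "bij ?g" by (rule reflect_word_funpow_bij)
  have "?w ^^ k = id \<longleftrightarrow> (\<forall>v. ?g ((?w ^^ k) v) = ?g v)"
    using bij_is_inj[OF bij] by (auto simp: fun_eq_iff inj_eq)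
  also have "\<dots> \<longleftrightarrow> (\<forall>v. (leg_coxeter ^^ k) (?g v) = ?g v)" by (simp only: conj)
  also have "\<dots> \<longleftrightarrow> leg_coxeter ^^ k = id"
    using bij_is_surj[OF bij] by (auto simp: fun_eq_iff) (metis surjD)
  finally show ?thesis by (simp only: leg_coxeter_order)
qed

end

section \<open>Coxeter transformations on V\<close>

text \<open>
  For \<open>f = \<alpha>\<close> this is the map from \<open>V\<close> to the root space which sends the symbol \<open>\<alpha>\<^sub>0\<close> to minus the
  highest root; its kernel is the line through the null vector. Composed with a power of the
  Coxeter element it is used with \<open>f\<close> other than \<open>\<alpha>\<close>.
\<close>

definition combination :: "(nat \<Rightarrow> 'a::real_vector) \<Rightarrow> nat \<Rightarrow> real Matrix.vec \<Rightarrow> 'a" where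
  "combination f n v = (\<Sum>i=0..n. vec_index v i *\<^sub>R f i)"

lemma combination_diff:
  assumes "u \<in> carrier_vec (n + 1)" "v \<in> carrier_vec (n + 1)"
  shows "combination f n (u - v) = combination f n u - combination f n v"
  using assms by (simp add: combination_def scaleR_left_diff_distrib sum_subtractf)

lemma combination_smult:
  "v \<in> carrier_vec (n + 1) \<Longrightarrow> combination f n (t \<cdot>\<^sub>v v) = t *\<^sub>R combination f n v"
  by (simp add: combination_def scaleR_sum_right)

lemma index_range: "{0..<n + 1} = {0..n::nat}" "{..<n + 1} = {0..n::nat}"
  by auto

lemma combination_image:
  assumes "linear g"
  shows "combination (\<lambda>i. g (f i)) n v = g (combination f n v)"
  by (simp add: combination_def linear_sum[OF assms] linear_scale[OF assms])

lemma affine_reflection_carrier: "affine_reflection n C j \<in> carrier_mat (n + 1) (n + 1)"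
  by (simp add: affine_reflection_def)

lemma combination_affine_reflection:
  assumes "j \<le> n" and v: "v \<in> carrier_vec (n + 1)"
  shows "combination \<alpha> n (affine_reflection n (cartan \<alpha>) j *\<^sub>v v) = reflection (\<alpha> j) (combination \<alpha> n v)"
proof -
  let ?N = "\<Sum>i=0..n. vec_index v i * cartan \<alpha> i j"
  have "vec_index (affine_reflection n (cartan \<alpha>) j *\<^sub>v v) k = vec_index v k - (if k = j then ?N else 0)"
    if "k \<in> {0..n}" for k
  proof -
    have "vec_index (affine_reflection n (cartan \<alpha>) j *\<^sub>v v) k =
        (\<Sum>i=0..n. ((if k = i then 1 else 0) - (if k = j then cartan \<alpha> i j else 0)) * vec_index v i)"
      using that v
      by (simp add: affine_reflection_def scalar_prod_def index_range)
    also have "\<dots> = (\<Sum>i=0..n. (if k = i then vec_index v i else 0)) -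
        (\<Sum>i=0..n. if k = j then vec_index v i * cartan \<alpha> i j else 0)"
      unfolding sum_subtractf[symmetric] by (intro sum.cong) (auto simp: algebra_simps)
    finally show ?thesis using that by simp
  qed
  then have "combination \<alpha> n (affine_reflection n (cartan \<alpha>) j *\<^sub>v v) =
      (\<Sum>k=0..n. vec_index v k *\<^sub>R \<alpha> k - (if k = j then ?N *\<^sub>R \<alpha> j else 0))"
    unfolding combination_def by (intro sum.cong) (auto simp: scaleR_left_diff_distrib)
  also have "\<dots> = combination \<alpha> n v - ?N *\<^sub>R \<alpha> j"
    using assms(1) by (simp add: sum_subtractf combination_def)
  finally show ?thesis
    by (simp add: reflection_def combination_def cartan_number_sum cartan_number_simps cartan_def)
qed

definition affine_product :: "nat \<Rightarrow> (nat \<Rightarrow> nat \<Rightarrow> real) \<Rightarrow> nat list \<Rightarrow> real mat" where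
  "affine_product n C js = foldr (\<lambda>j M. affine_reflection n C j * M) js (1\<^sub>m (n + 1))"

lemma affine_product_carrier: "affine_product n C js \<in> carrier_mat (n + 1) (n + 1)"
  by (induction js)
    (simp_all add: affine_product_def mult_carrier_mat[OF affine_reflection_carrier])

lemma combination_affine_product:
  assumes "set js \<subseteq> {0..n}" and "v \<in> carrier_vec (n + 1)"
  shows "combination \<alpha> n (affine_product n (cartan \<alpha>) js *\<^sub>v v) = reflect_word \<alpha> js (combination \<alpha> n v)"
  using assms(1)
proof (induction js)
  case Nil
  show ?case using assms(2) by (simp add: affine_product_def)
next
  case (Cons j js)
  let ?P = "affine_product n (cartan \<alpha>)"
  have "?P (j # js) *\<^sub>v v = affine_reflection n (cartan \<alpha>) j *\<^sub>v (?P js *\<^sub>v v)"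
    using assoc_mult_mat_vec[OF affine_reflection_carrier affine_product_carrier assms(2)]
    by (simp add: affine_product_def)
  moreover have "?P js *\<^sub>v v \<in> carrier_vec (n + 1)"
    using affine_product_carrier assms(2) by (rule mult_mat_vec_carrier)
  ultimately show ?case
    using Cons by (simp add: combination_affine_reflection)
qed

lemma combination_pow:
  assumes "\<And>v. v \<in> carrier_vec (n + 1) \<Longrightarrow> combination f n (S *\<^sub>v v) = g (combination f n v)"
    and S: "S \<in> carrier_mat (n + 1) (n + 1)" and v: "v \<in> carrier_vec (n + 1)"
  shows "combination f n ((S ^\<^sub>m k) *\<^sub>v v) = (g ^^ k) (combination f n v)"
  using v
proof (induction k arbitrary: v)
  case 0
  then show ?case using S by simp
next
  case (Suc k)
  have "(S ^\<^sub>m Suc k) *\<^sub>v v = (S ^\<^sub>m k) *\<^sub>v (S *\<^sub>v v)"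
    using assoc_mult_mat_vec[OF pow_carrier_mat[OF S] S Suc.prems] by simp
  then show ?case
    using Suc.IH[of "S *\<^sub>v v"] assms(1)[OF Suc.prems] mult_mat_vec_carrier[OF S Suc.prems]
    by (simp add: funpow_swap1)
qed

lemma coxeter_transformation_of_word:
  assumes "distinct js" and "set js = {0..n}"
  obtains \<pi> where "\<pi> permutes {0..n}" "coxeter_transformation n C \<pi> = affine_product n C js"
proof -
  have len: "length js = n + 1" using distinct_card[OF assms(1)] assms(2) by simp
  define \<pi> where "\<pi> i = (if i \<le> n then js ! i else i)" for i
  have "bij_betw ((!) js) {..<length js} (set js)"
    using assms(1) by (intro bij_betw_nth) auto
  then have "bij_betw \<pi> {0..n} {0..n}"
    using assms(2) len
    by (subst bij_betw_cong[of _ _ "(!) js"])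
      (auto simp: \<pi>_def index_range)
  then have "\<pi> permutes {0..n}"
    by (rule bij_imp_permutes) (simp add: \<pi>_def)
  moreover have map_js: "map \<pi> [0..<n + 1] = js"
    using len by (intro nth_equalityI) (auto simp: \<pi>_def less_Suc_eq_le simp del: upt_Suc)
  have "coxeter_transformation n C \<pi> = affine_product n C js"
    unfolding coxeter_transformation_def affine_product_def
    by (simp only: map_js[symmetric] foldr_map o_def)
  ultimately show ?thesis using that by blast
qed

context indexed_basis
begin

abbreviation null_vec :: "(nat \<Rightarrow> int) \<Rightarrow> real Matrix.vec" where
  "null_vec z \<equiv> Matrix.vec (n + 1) (\<lambda>i. of_int (z i))"

lemma combination_split: "combination \<alpha> n v = vec_index v 0 *\<^sub>R \<alpha> 0 + (\<Sum>i=1..n. vec_index v i *\<^sub>R \<alpha> i)"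
  by (simp add: combination_def sum.atLeast_Suc_atMost One_nat_def)

lemma combination_surj:
  obtains v where "v \<in> carrier_vec (n + 1)" "combination \<alpha> n v = e"
proof -
  obtain s where s: "e = (\<Sum>i=1..n. s i *\<^sub>R \<alpha> i)" by (rule coefficients_exist)
  have "combination \<alpha> n (Matrix.vec (n + 1) (\<lambda>i. if i = 0 then 0 else s i)) = e"
    unfolding s combination_split by simp
  then show ?thesis by (intro that) auto
qed

lemma combination_null_vec:
  assumes "null_vector n (cartan \<alpha>) z"
  shows "combination \<alpha> n (null_vec z) = 0"
proof (rule orthogonal_zero)
  fix j assume "j \<in> {1..n}"
  then have "(\<Sum>i=0..n. of_int (z i) * cartan \<alpha> i j) = 0"
    using assms by (auto simp: null_vector_def)
  then show "cartan_number (combination \<alpha> n (null_vec z)) (\<alpha> j) = 0"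
    by (simp add: combination_def cartan_number_sum cartan_number_simps cartan_def)
qed

lemma kernel_vanishes:
  assumes "v \<in> carrier_vec (n + 1)" "combination \<alpha> n v = 0" "vec_index v 0 = 0"
  shows "v = 0\<^sub>v (n + 1)"
proof (rule eq_vecI)
  fix i assume i: "i < dim_vec (0\<^sub>v (n + 1) :: real Matrix.vec)"
  have "(\<Sum>i=1..n. vec_index v i *\<^sub>R \<alpha> i) = (\<Sum>i=1..n. 0 *\<^sub>R \<alpha> i)"
    using assms(2,3) by (simp add: combination_split)
  from coefficients_unique[OF this, of i] show "vec_index v i = vec_index (0\<^sub>v (n + 1)) i"
    using i assms(3) by (cases "i = 0") auto
qed (use assms(1) in simp)

lemma null_vec_0:
  assumes "null_vector n (cartan \<alpha>) z"
  shows "z 0 \<noteq> 0"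
proof
  assume "z 0 = 0"
  then have "null_vec z = 0\<^sub>v (n + 1)"
    by (intro kernel_vanishes combination_null_vec assms) auto
  moreover obtain i where "i \<le> n" "z i \<noteq> 0" using assms by (auto simp: null_vector_def)
  ultimately show False
    by (metis index_vec index_zero_vec(1) le_imp_less_Suc of_int_eq_0_iff Suc_eq_plus1)
qed

text \<open>
  A linear relation between \<open>\<alpha> 0, \<dots>, \<alpha> n\<close> is determined by its coefficient at \<open>\<alpha> 0\<close>.
\<close>

lemma combination_kernel:
  assumes z: "null_vector n (cartan \<alpha>) z" and v: "v \<in> carrier_vec (n + 1)"
  shows "combination \<alpha> n v = 0 \<longleftrightarrow> (\<exists>t. v = t \<cdot>\<^sub>v null_vec z)"
proof
  assume 0: "combination \<alpha> n v = 0"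
  let ?t = "vec_index v 0 / of_int (z 0)"
  have eq: "v - ?t \<cdot>\<^sub>v null_vec z = 0\<^sub>v (n + 1)"
  proof (rule kernel_vanishes)
    show "combination \<alpha> n (v - ?t \<cdot>\<^sub>v null_vec z) = 0"
      using v by (simp add: combination_diff combination_smult 0 combination_null_vec[OF z])
  qed (use v null_vec_0[OF z] in auto)
  then have "v = ?t \<cdot>\<^sub>v null_vec z"
  proof (intro eq_vecI)
    fix i assume i: "i < dim_vec (?t \<cdot>\<^sub>v null_vec z)"
    have "vec_index (v - ?t \<cdot>\<^sub>v null_vec z) i = 0" using i by (simp add: eq)
    then show "vec_index v i = vec_index (?t \<cdot>\<^sub>v null_vec z) i" using i v by simp
  qed (use v in simp)
  then show "\<exists>t. v = t \<cdot>\<^sub>v null_vec z" ..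
qed (auto simp: combination_smult combination_null_vec[OF z])

lemma trivial_mod_null_iff:
  assumes z: "null_vector n (cartan \<alpha>) z" and S: "S \<in> carrier_mat (n + 1) (n + 1)"
    and g: "\<And>v. v \<in> carrier_vec (n + 1) \<Longrightarrow> combination \<alpha> n (S *\<^sub>v v) = g (combination \<alpha> n v)"
  shows "trivial_mod_null n z (S ^\<^sub>m k) \<longleftrightarrow> g ^^ k = id"
proof -
  have Sk: "S ^\<^sub>m k *\<^sub>v v \<in> carrier_vec (n + 1)" if "v \<in> carrier_vec (n + 1)" for v
    using pow_carrier_mat[OF S] that by (rule mult_mat_vec_carrier)
  have "trivial_mod_null n z (S ^\<^sub>m k) \<longleftrightarrow>
      (\<forall>v\<in>carrier_vec (n + 1). combination \<alpha> n (S ^\<^sub>m k *\<^sub>v v - v) = 0)"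
    unfolding trivial_mod_null_def
  proof (intro ball_cong refl)
    fix v :: "real Matrix.vec" assume v: "v \<in> carrier_vec (n + 1)"
    show "(\<exists>t. S ^\<^sub>m k *\<^sub>v v - v = t \<cdot>\<^sub>v null_vec z) \<longleftrightarrow> combination \<alpha> n (S ^\<^sub>m k *\<^sub>v v - v) = 0"
      by (rule combination_kernel[OF z, symmetric]) (use Sk[OF v] v in simp)
  qed
  also have "\<dots> \<longleftrightarrow> (\<forall>v\<in>carrier_vec (n + 1). (g ^^ k) (combination \<alpha> n v) = combination \<alpha> n v)"
    using combination_diff[OF Sk, of _ _ \<alpha>] combination_pow[OF g S] by (intro ball_cong) simp_all
  also have "\<dots> \<longleftrightarrow> g ^^ k = id"
    by (metis combination_surj eq_id_iff)
  finally show ?thesis .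
qed

lemma null_vec_fixed:
  assumes z: "null_vector n (cartan \<alpha>) z" and j: "j \<le> n"
  shows "affine_reflection n (cartan \<alpha>) j *\<^sub>v null_vec z = null_vec z"
proof (rule eq_vecI)
  fix k assume k: "k < dim_vec (null_vec z)"
  have "vec_index (affine_reflection n (cartan \<alpha>) j *\<^sub>v null_vec z) k =
      (\<Sum>i=0..n. ((if k = i then 1 else 0) - (if k = j then cartan \<alpha> i j else 0)) * of_int (z i))"
    using k by (simp add: affine_reflection_def scalar_prod_def index_range)
  also have "\<dots> = (\<Sum>i=0..n. (if k = i then of_int (z i) else 0)) -
      (\<Sum>i=0..n. if k = j then of_int (z i) * cartan \<alpha> i j else 0)"
    unfolding sum_subtractf[symmetric] by (intro sum.cong) (auto simp: algebra_simps)
  also have "\<dots> = vec_index (null_vec z) k"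
    using k z j by (cases "k = j") (auto simp: null_vector_def)
  finally show "vec_index (affine_reflection n (cartan \<alpha>) j *\<^sub>v null_vec z) k = vec_index (null_vec z) k" .
qed (simp add: affine_reflection_def)

lemma affine_product_null_vec:
  assumes "null_vector n (cartan \<alpha>) z" and "set js \<subseteq> {0..n}"
  shows "affine_product n (cartan \<alpha>) js *\<^sub>v null_vec z = null_vec z"
  using assms(2)
proof (induction js)
  case Nil
  show ?case by (simp add: affine_product_def)
next
  case (Cons j js)
  have "affine_product n (cartan \<alpha>) (j # js) *\<^sub>v null_vec z =
      affine_reflection n (cartan \<alpha>) j *\<^sub>v (affine_product n (cartan \<alpha>) js *\<^sub>v null_vec z)"
    using assoc_mult_mat_vec[OF affine_reflection_carrier affine_product_carrier, of "null_vec z"]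
    by (simp add: affine_product_def)
  then show ?case using Cons null_vec_fixed[OF assms(1), of j] by simp
qed

end

section \<open>The characteristic polynomial\<close>

text \<open>
  If a permutation contributes to the determinant, it does not increase \<open>rank\<close> anywhere. As it preserves the sum of
  all ranks, it fixes every index. The rank function avoids a rearrangement of
  rows and columns.
\<close>

lemma det_triangular_rank:
  fixes A :: "'b::comm_ring_1 mat" and rank :: "nat \<Rightarrow> nat"
  assumes A: "A \<in> carrier_mat N N"
    and tri: "\<And>i j. i < N \<Longrightarrow> j < N \<Longrightarrow> A $$ (i, j) \<noteq> 0 \<Longrightarrow> i = j \<or> rank j < rank i"
  shows "det A = (\<Prod>i<N. A $$ (i, i))"
proof -
  have "(\<Prod>i=0..<N. A $$ (i, \<pi> i)) = 0" if \<pi>: "\<pi> permutes {0..<N}" and "\<pi> \<noteq> id" for \<pi>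
  proof (rule ccontr)
    assume nz: "(\<Prod>i=0..<N. A $$ (i, \<pi> i)) \<noteq> 0"
    have entry: "\<pi> i = i \<or> rank (\<pi> i) < rank i" if i: "i \<in> {0..<N}" for i
    proof -
      have "A $$ (i, \<pi> i) \<noteq> 0" using nz i by (metis finite_atLeastLessThan prod_zero)
      moreover have "\<pi> i < N" using permutes_in_image[OF \<pi>, of i] i by simp
      ultimately show ?thesis using tri[of i "\<pi> i"] i by auto
    qed
    obtain i where i: "\<pi> i \<noteq> i" using \<open>\<pi> \<noteq> id\<close> by (auto simp: fun_eq_iff)
    then have iN: "i \<in> {0..<N}" using permutes_not_in[OF \<pi>] by blast
    have "(\<Sum>i=0..<N. rank (\<pi> i)) < (\<Sum>i=0..<N. rank i)"
    proof (rule sum_strict_mono_ex1)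
      show "\<forall>i\<in>{0..<N}. rank (\<pi> i) \<le> rank i" using entry by fastforce
      show "\<exists>i\<in>{0..<N}. rank (\<pi> i) < rank i" using entry[OF iN] i iN by blast
    qed simp
    then show False using sum.permute[OF \<pi>, of rank] by (simp add: o_def)
  qed
  then have "det A = (\<Sum>\<pi>\<in>{\<pi>. \<pi> permutes {0..<N}}. if \<pi> = id then \<Prod>i=0..<N. A $$ (i, i) else 0)"
    unfolding det_def'[OF A] by (intro sum.cong) auto
  also have "\<dots> = (\<Prod>i<N. A $$ (i, i))"
    by (simp add: finite_permutations permutes_id atLeast0LessThan)
  finally show ?thesis .
qed

lemma similar_mat_of_injective:
  fixes P :: "'b::field mat"
  assumes S: "S \<in> carrier_mat N N" and P: "P \<in> carrier_mat N N" and T: "T \<in> carrier_mat N N"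
    and eq: "S * P = P * T"
    and inj: "\<And>v. v \<in> carrier_vec N \<Longrightarrow> P *\<^sub>v v = 0\<^sub>v N \<Longrightarrow> v = 0\<^sub>v N"
  shows "similar_mat S T"
proof -
  have "det P \<noteq> 0" using det_0_iff_vec_prod_zero_field[OF P] inj by blast
  from det_non_zero_imp_unit[OF P this, unfolded Units_def, of "()"]
  obtain Q where Q: "Q \<in> carrier_mat N N" "Q * P = 1\<^sub>m N" "P * Q = 1\<^sub>m N"
    by (auto simp: ring_mat_def)
  have "P * T * Q = S * P * Q" by (simp add: eq)
  also have "\<dots> = S * (P * Q)" using S P Q by (intro assoc_mult_mat)
  also have "\<dots> = S" using S Q by simp
  finally show ?thesis
    using S T P Q by (intro similar_matI[of S T P Q N]) auto
qed

lemma combination_mult_mat_vec: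
  assumes P: "P \<in> carrier_mat (n + 1) (n + 1)" and v: "v \<in> carrier_vec (n + 1)"
  shows "combination f n (P *\<^sub>v v) = (\<Sum>i=0..n. vec_index v i *\<^sub>R combination f n (col P i))"
proof -
  have "combination f n (P *\<^sub>v v) = (\<Sum>k=0..n. \<Sum>i=0..n. (vec_index v i * P $$ (k, i)) *\<^sub>R f k)"
    unfolding combination_def
  proof (rule sum.cong[OF refl])
    fix k assume "k \<in> {0..n}"
    then have "vec_index (P *\<^sub>v v) k = (\<Sum>i=0..n. vec_index v i * P $$ (k, i))"
      using P v by (simp add: scalar_prod_def index_range mult.commute)
    then show "vec_index (P *\<^sub>v v) k *\<^sub>R f k = (\<Sum>i=0..n. (vec_index v i * P $$ (k, i)) *\<^sub>R f k)"
      by (simp add: scaleR_sum_left)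
  qed
  also have "\<dots> = (\<Sum>i=0..n. \<Sum>k=0..n. (vec_index v i * P $$ (k, i)) *\<^sub>R f k)"
    by (rule sum.swap)
  also have "\<dots> = (\<Sum>i=0..n. vec_index v i *\<^sub>R combination f n (col P i))"
    using P by (simp add: combination_def scaleR_sum_right)
  finally show ?thesis .
qed

text \<open>
  The matrix of a map which fixes the basis vector with index \<open>0\<close> and induces \<open>W\<close> on the quotient.
\<close>

definition bordered_mat :: "nat \<Rightarrow> (nat \<Rightarrow> real) \<Rightarrow> (nat \<Rightarrow> nat \<Rightarrow> real) \<Rightarrow> real mat" where
  "bordered_mat n t W = Matrix.mat (n + 1) (n + 1)
     (\<lambda>(i, j). if j = 0 then (if i = 0 then 1 else 0) else if i = 0 then t j else W i j)"

text \<open>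
  The preimages of the basis \<open>e\<close> together with the fixed vector \<open>y\<close> form a basis of \<open>V\<close>. In this basis \<open>S\<close>
  is block triangular; only the row \<open>t\<close> depends on the choice of the preimages.
\<close>

lemma char_poly_quotient:
  fixes S :: "real mat" and f e :: "nat \<Rightarrow> 'a::real_vector"
  assumes S: "S \<in> carrier_mat (n + 1) (n + 1)"
    and y: "y \<in> carrier_vec (n + 1)" "y \<noteq> 0\<^sub>v (n + 1)" "S *\<^sub>v y = y"
    and kernel: "\<And>v. v \<in> carrier_vec (n + 1) \<Longrightarrow> combination f n v = 0 \<longleftrightarrow> (\<exists>t. v = t \<cdot>\<^sub>v y)"
    and surj: "\<And>j. \<exists>v\<in>carrier_vec (n + 1). combination f n v = e j"
    and act: "\<And>v. v \<in> carrier_vec (n + 1) \<Longrightarrow> combination f n (S *\<^sub>v v) = g (combination f n v)"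
    and W: "\<And>j. j \<in> {1..n} \<Longrightarrow> g (e j) = (\<Sum>i=1..n. W i j *\<^sub>R e i)"
    and indep: "\<And>s i. (\<Sum>i=1..n. s i *\<^sub>R e i) = 0 \<Longrightarrow> i \<in> {1..n} \<Longrightarrow> s i = 0"
  obtains t where "char_poly S = char_poly (bordered_mat n t W)"
proof -
  obtain q where q: "\<And>j. q j \<in> carrier_vec (n + 1)" "\<And>j. combination f n (q j) = e j"
    using surj by metis
  define P where "P = Matrix.mat (n + 1) (n + 1) (\<lambda>(k, i). vec_index (if i = 0 then y else q i) k)"
  have P: "P \<in> carrier_mat (n + 1) (n + 1)" by (simp add: P_def)
  have col0: "col P 0 = y"
    using y(1) by (intro eq_vecI) (auto simp: P_def)
  have col: "col P j = q j" if "j \<in> {1..n}" for j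
    using q(1)[of j] that by (intro eq_vecI) (auto simp: P_def)
  have y0: "combination f n y = 0" using kernel[OF y(1)] by (metis one_smult_vec)
  have comb: "combination f n (P *\<^sub>v v) = (\<Sum>i=1..n. vec_index v i *\<^sub>R e i)"
    if "v \<in> carrier_vec (n + 1)" for v
    unfolding combination_mult_mat_vec[OF P that]
    by (simp add: sum.atLeast_Suc_atMost One_nat_def col0 y0 col q(2))
  have "\<exists>t. j \<in> {1..n} \<longrightarrow> S *\<^sub>v q j = P *\<^sub>v Matrix.vec (n + 1) (\<lambda>i. if i = 0 then t else W i j)" for j
  proof (cases "j \<in> {1..n}")
    case True
    let ?u = "\<lambda>t. Matrix.vec (n + 1) (\<lambda>i. if i = 0 then t else W i j)"
    have Sq: "S *\<^sub>v q j \<in> carrier_vec (n + 1)" using S q(1) by (rule mult_mat_vec_carrier)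
    have Pu: "P *\<^sub>v ?u t \<in> carrier_vec (n + 1)" for t using P by (rule mult_mat_vec_carrier) simp
    have "combination f n (S *\<^sub>v q j - P *\<^sub>v ?u 0) = 0"
      using Sq Pu[of 0] True by (simp add: combination_diff act[OF q(1)] q(2) comb W)
    then obtain t where t: "S *\<^sub>v q j - P *\<^sub>v ?u 0 = t \<cdot>\<^sub>v y"
      using kernel[of "S *\<^sub>v q j - P *\<^sub>v ?u 0"] Sq Pu[of 0] by auto
    have "S *\<^sub>v q j = P *\<^sub>v ?u t"
    proof (rule eq_vecI)
      fix k assume "k < dim_vec (P *\<^sub>v ?u t)"
      then have k: "k < n + 1" using P by simp
      have "vec_index (S *\<^sub>v q j) k - vec_index (P *\<^sub>v ?u 0) k = t * vec_index y k"
        using arg_cong[OF t, of "\<lambda>v. vec_index v k"] k Sq Pu[of 0] y(1) P by simp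
      moreover have "vec_index (P *\<^sub>v ?u t) k = vec_index (P *\<^sub>v ?u 0) k + t * vec_index y k"
      proof -
        have entry: "vec_index (P *\<^sub>v ?u t) k = vec_index y k * t + (\<Sum>i=1..n. P $$ (k, i) * W i j)" for t
        proof -
          have "vec_index (P *\<^sub>v ?u t) k = (\<Sum>i=0..n. P $$ (k, i) * (if i = 0 then t else W i j))"
            using k P by (simp add: scalar_prod_def index_range)
          also have "\<dots> = P $$ (k, 0) * t + (\<Sum>i=1..n. P $$ (k, i) * W i j)"
            by (simp add: sum.atLeast_Suc_atMost One_nat_def)
          finally show ?thesis using k by (simp add: P_def)
        qed
        show ?thesis unfolding entry by (simp add: mult.commute)
      qed
      ultimately show "vec_index (S *\<^sub>v q j) k = vec_index (P *\<^sub>v ?u t) k" by simp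
    qed (use S P in simp)
    then show ?thesis by blast
  next
    case False
    then show ?thesis by blast
  qed
  then obtain t where t: "\<And>j. j \<in> {1..n} \<Longrightarrow>
      S *\<^sub>v q j = P *\<^sub>v Matrix.vec (n + 1) (\<lambda>i. if i = 0 then t j else W i j)"
    by metis
  let ?T = "bordered_mat n t W"
  have T: "?T \<in> carrier_mat (n + 1) (n + 1)" by (simp add: bordered_mat_def)
  have "S * P = P * ?T"
  proof (rule eq_matI)
    fix k j assume "k < dim_row (P * ?T)" "j < dim_col (P * ?T)"
    then have kj: "k < n + 1" "j < n + 1" using P T by auto
    have "S *\<^sub>v col P j = P *\<^sub>v col ?T j"
    proof (cases "j = 0")
      case True
      have "col ?T 0 = unit_vec (n + 1) 0"
        by (intro eq_vecI) (auto simp: bordered_mat_def)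
      then have "P *\<^sub>v col ?T 0 = col P 0"
        using P by (intro eq_vecI) auto
      then show ?thesis using True y(3) by (simp add: col0)
    next
      case False
      then have j: "j \<in> {1..n}" using kj by auto
      have "col ?T j = Matrix.vec (n + 1) (\<lambda>i. if i = 0 then t j else W i j)"
        using j by (intro eq_vecI) (auto simp: bordered_mat_def)
      then show ?thesis by (simp add: col[OF j] t[OF j])
    qed
    then have "col (S * P) j = col (P * ?T) j"
      by (simp only: col_mult2[OF S P kj(2)] col_mult2[OF P T kj(2)])
    then have "vec_index (col (S * P) j) k = vec_index (col (P * ?T) j) k" by simp
    then show "(S * P) $$ (k, j) = (P * ?T) $$ (k, j)"
      using kj S P T by simp
  qed (use S P T in auto)
  moreover have "v = 0\<^sub>v (n + 1)" if v: "v \<in> carrier_vec (n + 1)" and 0: "P *\<^sub>v v = 0\<^sub>v (n + 1)" for v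
  proof -
    have "combination f n (0\<^sub>v (n + 1)) = 0" by (simp add: combination_def)
    then have "(\<Sum>i=1..n. vec_index v i *\<^sub>R e i) = 0" using comb[OF v] 0 by simp
    then have vi: "vec_index v i = 0" if "i \<in> {1..n}" for i using indep that by blast
    obtain k where k: "k < n + 1" "vec_index y k \<noteq> 0"
      using y(1,2) by (metis carrier_vecD eq_vecI index_zero_vec)
    have "vec_index (P *\<^sub>v v) k = (\<Sum>i=0..n. P $$ (k, i) * vec_index v i)"
      using k(1) P v by (simp add: scalar_prod_def index_range)
    also have "\<dots> = vec_index y k * vec_index v 0"
      using k(1) vi by (simp add: sum.atLeast_Suc_atMost One_nat_def P_def)
    finally have "vec_index v 0 = 0" using k 0 by simp
    then show ?thesis
    proof (intro eq_vecI)
      fix i assume "i < dim_vec (0\<^sub>v (n + 1) :: real Matrix.vec)"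
      then show "vec_index v i = vec_index (0\<^sub>v (n + 1)) i"
        using vi[of i] \<open>vec_index v 0 = 0\<close> by (cases "i = 0") auto
    qed (use v in simp)
  qed
  ultimately have "similar_mat S ?T" using similar_mat_of_injective[OF S P T] by blast
  then show ?thesis using that char_poly_similar by blast
qed

lemma char_poly_matrix_index:
  "i < N \<Longrightarrow> j < N \<Longrightarrow> M \<in> carrier_mat N N \<Longrightarrow>
     char_poly_matrix M $$ (i, j) = (if i = j then [:0, 1:] else 0) - [:M $$ (i, j):]"
  by (auto simp: char_poly_matrix_def)

definition geometric_poly :: "nat \<Rightarrow> 'b::comm_ring_1 poly" where
  "geometric_poly q = (\<Sum>i<q. [:0, 1:] ^ i)"

context star_basis
begin

text \<open>
  The matrix of \<open>leg_coxeter\<close> in the basis of simple roots: it moves every leg outwards by one place, maps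
  the root at the outer end of a leg to minus the sum of the leg, and adds \<open>a l\<close> times
  the innermost root of every leg \<open>l\<close> to \<open>\<alpha> b\<close>.
\<close>

definition leg_matrix :: "nat \<Rightarrow> nat \<Rightarrow> real" where
  "leg_matrix i k = node_fun (node_fun 1 (\<lambda>l j. if Suc j = p l then real (a l) else 0))
     (\<lambda>l' k'. node_fun 0 (\<lambda>l j. if l = l' then (if k' = 1 then -1 else if Suc j = k' then 1 else 0) else 0)) k i"

lemma leg_matrix_column:
  assumes "k \<in> {1..n}"
  shows "leg_coxeter (\<alpha> k) = (\<Sum>i=1..n. leg_matrix i k *\<^sub>R \<alpha> i)"
  using assms
proof (cases rule: node_cases)
  case 1
  define u where "u l j = (if j = p l then real (a l) else 0)" for l j
  have u0: "u l 0 = 0" if "l < r" for l using p_pos[OF that] by (simp add: u_def)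
  have \<alpha>_b: "\<alpha> b = star_vec 1 u" by (simp add: star_vec_def u_def)
  have "leg_coxeter (star_vec 1 u) = star_vec 1 (\<lambda>l j. u l (Suc j) - u l 1)"
    using u0 by (intro leg_coxeter_star_vec) (auto simp: u_def)
  also have "\<dots> = star_vec 1 (\<lambda>l j. if Suc j = p l then real (a l) else 0)"
    by (intro star_vec_cong refl) (auto simp: u_def)
  finally show ?thesis using 1 unfolding \<alpha>_b[symmetric]
    by (simp add: star_vec_node_fun leg_matrix_def)
next
  case (2 l' k')
  define u where "u l j = (if l = l' \<and> j = k' then 1 else 0 :: real)" for l j
  have "star_vec 0 u = (\<Sum>l<r. \<Sum>j\<in>{1..<p l}. u l j *\<^sub>R \<alpha> (x l j))"
    by (simp add: star_vec_def)
  also have "\<dots> = (\<Sum>l<r. if l = l' then \<Sum>j\<in>{1..<p l'}. (if j = k' then 1 else 0) *\<^sub>R \<alpha> (x l' j) else 0)"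
    by (rule sum.cong[OF refl]) (simp add: u_def)
  also have "\<dots> = \<alpha> k" using 2 by (simp add: if_distrib[of "\<lambda>t. t *\<^sub>R _"] cong: if_cong)
  finally have \<alpha>_k: "star_vec 0 u = \<alpha> k" .
  have "leg_coxeter (star_vec 0 u) = star_vec 0 (\<lambda>l j. u l (Suc j) - u l 1)"
    using 2 by (intro leg_coxeter_star_vec) (auto simp: u_def)
  also have "\<dots> = star_vec 0 (\<lambda>l j. if l = l' then (if k' = 1 then -1 else if Suc j = k' then 1 else 0) else 0)"
    by (intro star_vec_cong refl) (auto simp: u_def One_nat_def)
  finally show ?thesis using 2 unfolding \<alpha>_k
    by (simp add: star_vec_node_fun leg_matrix_def)
qed

text \<open>
  After the row operation in \<open>char_poly_leg_matrix\<close> every row has nonzero entries only on the diagonal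
  and in columns of smaller rank. Index \<open>0\<close>, whose row is arbitrary, gets the largest rank.
\<close>

definition leg_rank :: "nat \<Rightarrow> nat" where
  "leg_rank i = (if i = 0 then (\<Sum>l<r. p l) + 2
     else node_fun 0 (\<lambda>l j. if j = 1 then 1 else 1 + p l - j) i)"

text \<open>
  On a leg the characteristic matrix is of companion type. Replacing the row of the outer end by the sum
  of the rows of the leg, where position \<open>m\<close> is weighted by \<open>X ^ (p l - 1 - m)\<close>, leaves
  \<open>1 + X + \<dots> + X ^ (p l - 1)\<close> in the column of the outer end and clears the rest of the leg. The
  matrix becomes triangular, and the determinant of the row operation, a power of \<open>X\<close>, cancels.
\<close>

lemma char_poly_leg_matrix:
  "char_poly (bordered_mat n t leg_matrix) = [:-1, 1:] ^ 2 * (\<Prod>l<r. geometric_poly (p l))"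
proof -
  let ?T = "bordered_mat n t leg_matrix" and ?X = "[:0, 1:] :: real poly" and ?N = "n + 1"
  have T: "?T \<in> carrier_mat ?N ?N" by (simp add: bordered_mat_def)
  define M where "M i j = char_poly_matrix ?T $$ (i, j)" for i j
  have M: "M i j = (if i = j then ?X else 0) -
      [:if j = 0 then (if i = 0 then 1 else 0) else if i = 0 then t j else leg_matrix i j:]"
    if "i \<le> n" "j \<le> n" for i j
    using that unfolding M_def by (subst char_poly_matrix_index[OF _ _ T]) (auto simp: bordered_mat_def)
  \<comment> \<open>\<open>comb F\<close> applies the row operation to the matrix \<open>F\<close>; its own matrix is \<open>comb\<close> of the unit matrix.\<close>
  define comb :: "(nat \<Rightarrow> nat \<Rightarrow> real poly) \<Rightarrow> nat \<Rightarrow> nat \<Rightarrow> real poly" where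
    "comb F i = (if i = 0 then F 0 else node_fun (F b)
       (\<lambda>l j. if j = 1 then (\<lambda>k. \<Sum>m\<in>{1..<p l}. ?X ^ (p l - 1 - m) * F (x l m) k) else F (x l j)) i)" for F i
  have comb_0: "comb F 0 = F 0" and comb_b: "comb F b = F b" for F
    using b_in by (simp_all add: comb_def)
  have comb_x: "comb F (x l j) =
      (if j = 1 then (\<lambda>k. \<Sum>m\<in>{1..<p l}. ?X ^ (p l - 1 - m) * F (x l m) k) else F (x l j))"
    if "l < r" "1 \<le> j" "j < p l" for F l j
    using that x_in[OF that] by (simp add: comb_def)
  define D :: "nat \<Rightarrow> nat \<Rightarrow> real poly" where "D i k = (if i = k then 1 else 0)" for i k
  define Q where "Q = Matrix.mat ?N ?N (\<lambda>(i, k). comb D i k)"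
  define R where "R = Matrix.mat ?N ?N (\<lambda>(i, k). comb M i k)"
  have carriers: "Q \<in> carrier_mat ?N ?N" "R \<in> carrier_mat ?N ?N" by (simp_all add: Q_def R_def)

  have expand: "(\<Sum>k=0..n. comb D i k * F k j) = comb F i j" if i: "i \<le> n" for i j F
  proof -
    have unit: "(\<Sum>k=0..n. D m k * F k j) = F m j" if "m \<le> n" for m
      using that by (simp add: D_def if_distrib[of "\<lambda>t. t * _"] cong: if_cong)
    consider "i = 0" | "i = b" | l m where "l < r" "1 \<le> m" "m < p l" "i = x l m"
      using i node_cases[of i] by (cases "i = 0") auto
    then show ?thesis
    proof cases
      case (3 l m)
      have x_le: "x l m' \<le> n" if "1 \<le> m'" "m' < p l" for m' using x_in[OF 3(1) that] by simp
      show ?thesis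
      proof (cases "m = 1")
        case True
        have "(\<Sum>k=0..n. comb D i k * F k j) =
            (\<Sum>k=0..n. \<Sum>m\<in>{1..<p l}. ?X ^ (p l - 1 - m) * (D (x l m) k * F k j))"
          using 3 True by (simp add: comb_x sum_distrib_right mult.assoc)
        also have "\<dots> = (\<Sum>m\<in>{1..<p l}. ?X ^ (p l - 1 - m) * (\<Sum>k=0..n. D (x l m) k * F k j))"
          by (subst sum.swap) (simp add: sum_distrib_left)
        also have "\<dots> = comb F i j"
          using 3 True x_le by (simp add: comb_x unit)
        finally show ?thesis .
      qed (use 3 x_le in \<open>simp add: comb_x unit\<close>)
    qed (use b_in in \<open>simp_all add: comb_0 comb_b unit\<close>)
  qed
  have "Q * char_poly_matrix ?T = R"
  proof (rule eq_matI)
    fix i j assume "i < dim_row R" "j < dim_col R"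
    then have ij: "i < ?N" "j < ?N" using carriers by auto
    then have "(Q * char_poly_matrix ?T) $$ (i, j) = (\<Sum>k=0..n. comb D i k * M k j)"
      using char_poly_matrix_closed[OF T] by (simp add: Q_def scalar_prod_def index_range M_def)
    then show "(Q * char_poly_matrix ?T) $$ (i, j) = R $$ (i, j)"
      using ij expand[of i M j] by (simp add: R_def)
  qed (use carriers char_poly_matrix_closed[OF T] in auto)
  then have dets: "det Q * char_poly ?T = det R"
    unfolding char_poly_def using det_mult[OF carriers(1) char_poly_matrix_closed[OF T]] by simp

  have diagonal: "(\<Prod>i<?N. f i) = f 0 * (f b * (\<Prod>l<r. \<Prod>j\<in>{1..<p l}. f (x l j)))"
    for f :: "nat \<Rightarrow> real poly"
  proof -
    have "(\<Prod>i<?N. f i) = f 0 * (\<Prod>i=1..n. f i)"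
      unfolding index_range by (simp add: prod.atLeast_Suc_atMost One_nat_def)
    then show ?thesis by (simp only: prod_nodes)
  qed

  let ?rank = "node_fun 0 (\<lambda>l j. if j = 1 then 1 else 0) :: nat \<Rightarrow> nat"
  have "det Q = (\<Prod>i<?N. Q $$ (i, i))"
  proof (rule det_triangular_rank[OF carriers(1), of ?rank])
    fix i k assume ik: "i < ?N" "k < ?N" and nz: "Q $$ (i, k) \<noteq> 0"
    then have nz: "comb D i k \<noteq> 0" by (simp add: Q_def)
    consider "i = 0" | "i = b" | l m where "l < r" "1 \<le> m" "m < p l" "i = x l m"
      using ik(1) node_cases[of i] by (cases "i = 0") auto
    then show "i = k \<or> ?rank k < ?rank i"
    proof cases
      case (3 l m)
      show ?thesis
      proof (cases "m = 1")
        case True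
        have "\<exists>m'\<in>{1..<p l}. D (x l m') k \<noteq> 0"
        proof (rule ccontr)
          assume "\<not> ?thesis"
          then show False using nz 3 True by (simp add: comb_x)
        qed
        then obtain m' where m': "1 \<le> m'" "m' < p l" "k = x l m'"
          by (auto simp: D_def split: if_splits)
        then show ?thesis using 3 True by (cases "m' = 1") auto
      next
        case False
        then show ?thesis using nz 3 by (auto simp: comb_x D_def split: if_splits)
      qed
    qed (use nz in \<open>auto simp: comb_0 comb_b D_def split: if_splits\<close>)
  qed
  also have "\<dots> = (\<Prod>l<r. \<Prod>j\<in>{1..<p l}. if j = 1 then ?X ^ (p l - 2) else 1)"
  proof -
    have "Q $$ (x l j, x l j) = (if j = 1 then ?X ^ (p l - 2) else 1)"
      if lj: "l < r" "1 \<le> j" "j < p l" for l j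
    proof (cases "j = 1")
      case True
      have "(\<Sum>m\<in>{1..<p l}. ?X ^ (p l - 1 - m) * D (x l m) (x l 1)) =
          (\<Sum>m\<in>{1..<p l}. if m = 1 then ?X ^ (p l - 1 - m) else 0)"
        using lj True x_inj[of l _ l 1] by (intro sum.cong) (auto simp: D_def)
      also have "\<dots> = ?X ^ (p l - 2)" using lj True by (simp add: numeral_2_eq_2 One_nat_def)
      finally show ?thesis using lj True x_in[OF lj] by (simp add: Q_def comb_x)
    next
      case False
      then show ?thesis using lj x_in[OF lj] by (simp add: Q_def comb_x D_def)
    qed
    then show ?thesis
      using b_in unfolding diagonal by (simp add: Q_def comb_0 comb_b D_def)
  qed
  finally have detQ: "det Q = (\<Prod>l<r. \<Prod>j\<in>{1..<p l}. if j = 1 then ?X ^ (p l - 2) else 1)" .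

  have M_x: "M (x l j) k = (if x l j = k then ?X else 0) - [:if k = 0 then 0 else leg_matrix (x l j) k:]"
    if "l < r" "1 \<le> j" "j < p l" "k \<le> n" for l j k
    using M[of "x l j" k] x_in[OF that(1-3)] that(4) by auto
  have first: "comb M (x l 1) (x l' k) =
      (if l' = l then (if k = 1 then geometric_poly (p l) else 0) else 0)"
    if l: "l < r" "1 < p l" and l': "l' < r" "1 \<le> k" "k < p l'" for l l' k
  proof -
    have k: "x l' k \<in> {1..n}" by (rule x_in[OF l'])
    have entry: "M (x l m) (x l' k) = (if l' = l then (if m = k then ?X else 0) -
        [:if k = 1 then -1 else if Suc m = k then 1 else 0:] else 0)"
      if m: "m \<in> {1..<p l}" for m
      using M_x[of l m "x l' k"] k l l' m x_inj[of l m l' k] by (auto simp: leg_matrix_def)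
    have start: "comb M (x l 1) (x l' k) = (\<Sum>m\<in>{1..<p l}. ?X ^ (p l - 1 - m) *
        (if l' = l then (if m = k then ?X else 0) -
          [:if k = 1 then -1 else if Suc m = k then 1 else 0:] else 0))"
      using l by (simp add: comb_x entry)
    show ?thesis
    proof (cases "l' = l")
      case True
      let ?c = "\<lambda>m. [:if k = 1 then -1 else if Suc m = k then 1 else 0:] :: real poly"
      have "?X ^ (p l - 1 - k) * ?X = ?X ^ Suc (p l - 1 - k)" by (rule power_Suc2[symmetric])
      also have "Suc (p l - 1 - k) = p l - k" using l' True by simp
      finally have "?X ^ (p l - 1 - k) * ?X = ?X ^ (p l - k)" .
      moreover have "comb M (x l 1) (x l' k) =
          (\<Sum>m\<in>{1..<p l}. if m = k then ?X ^ (p l - 1 - m) * ?X else 0) -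
          (\<Sum>m\<in>{1..<p l}. ?X ^ (p l - 1 - m) * ?c m)"
        unfolding start sum_subtractf[symmetric] using True
        by (intro sum.cong) (auto simp: right_diff_distrib)
      ultimately have split: "comb M (x l 1) (x l' k) =
          ?X ^ (p l - k) - (\<Sum>m\<in>{1..<p l}. ?X ^ (p l - 1 - m) * ?c m)"
        using l' True by simp
      show ?thesis
      proof (cases "k = 1")
        case True
        have "geometric_poly (p l) = (\<Sum>m<p l. ?X ^ (p l - Suc m))"
          unfolding geometric_poly_def by (rule sum.nat_diff_reindex[symmetric])
        also have "\<dots> = ?X ^ (p l - 1) + (\<Sum>m\<in>{1..<p l}. ?X ^ (p l - Suc m))"
          using l by (simp add: lessThan_atLeast0 sum.atLeast_Suc_lessThan One_nat_def)
        finally show ?thesis using True \<open>l' = l\<close> unfolding split by (simp add: sum_negf One_nat_def flip: one_pCons)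
      next
        case False
        then obtain k' where k': "k = Suc k'" "1 \<le> k'" using l' by (cases k) auto
        have "(\<Sum>m\<in>{1..<p l}. ?X ^ (p l - 1 - m) * ?c m) =
            (\<Sum>m\<in>{1..<p l}. if m = k' then ?X ^ (p l - 1 - m) else 0)"
          using False k' by (intro sum.cong) (auto simp flip: one_pCons)
        also have "\<dots> = ?X ^ (p l - k)" using l' True k' by (simp add: One_nat_def)
        finally show ?thesis using False \<open>l' = l\<close> unfolding split by simp
      qed
    qed (simp add: start)
  qed
  have "det R = (\<Prod>i<?N. R $$ (i, i))"
  proof (rule det_triangular_rank[OF carriers(2), of leg_rank])
    fix i k assume ik: "i < ?N" "k < ?N" and "R $$ (i, k) \<noteq> 0"
    then have nz: "comb M i k \<noteq> 0" by (simp add: R_def)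
    have k_cases: "k = 0 \<or> k = b \<or> (\<exists>l m. l < r \<and> 1 \<le> m \<and> m < p l \<and> k = x l m)"
      using ik(2) node_cases[of k] by (cases "k = 0") auto
    have rank_0: "leg_rank j < leg_rank 0" if "j \<in> {1..n}" for j
      using that
    proof (cases rule: node_cases)
      case (2 l m)
      have "p l \<le> (\<Sum>l<r. p l)" using 2 by (intro member_le_sum) auto
      then show ?thesis using 2 that by (auto simp: leg_rank_def)
    qed (use that in \<open>simp add: leg_rank_def\<close>)
    have rank_b: "leg_rank b = 0" using b_in by (simp add: leg_rank_def)
    have rank_x: "leg_rank (x l m) = (if m = 1 then 1 else 1 + p l - m)"
      if "l < r" "1 \<le> m" "m < p l" for l m
      using that x_in[OF that] by (simp add: leg_rank_def)
    consider "i = 0" | "i = b" | l m where "l < r" "1 \<le> m" "m < p l" "i = x l m"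
      using ik(1) node_cases[of i] by (cases "i = 0") auto
    then show "i = k \<or> leg_rank k < leg_rank i"
    proof cases
      case 1
      then show ?thesis using rank_0[of k] ik by (cases "k = 0") auto
    next
      case 2
      have "M b k = 0" if "k \<noteq> b"
        using M[of b k] that b_in ik k_cases by (auto simp: leg_matrix_def x_neq_b)
      then show ?thesis using nz 2 by (auto simp: comb_b)
    next
      case (3 l m)
      show ?thesis
      proof (cases "k \<in> {0, b}")
        case True
        have "M (x l m) 0 = 0" if "m \<in> {1..<p l}" for m
          using M_x[of l m 0] 3 that x_in[of l m] by auto
        then have "comb M i 0 = 0" using 3 by (simp add: comb_x)
        then have "k = b" using nz True by auto
        then show ?thesis using 3 rank_b rank_x by auto
      next
        case False
        then obtain l' m' where k: "l' < r" "1 \<le> m'" "m' < p l'" "k = x l' m'"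
          using k_cases by auto
        show ?thesis
        proof (cases "m = 1")
          case True
          then have "l' = l \<and> m' = 1"
            using first[of l l' m'] nz 3 k by (auto split: if_splits)
          then show ?thesis using 3 k True by simp
        next
          case m: False
          have "comb M i k = (if i = k then ?X else 0) - [:leg_matrix i k:]"
            using 3 m k M_x[of l m k] x_in[OF k(1-3)] by (auto simp: comb_x)
          then have "i = k \<or> leg_matrix i k \<noteq> 0" using nz by auto
          moreover have "leg_matrix i k \<noteq> 0 \<Longrightarrow> l' = l \<and> (m' = 1 \<or> m' = Suc m)"
            using 3 k by (auto simp: leg_matrix_def split: if_splits)
          ultimately show ?thesis using 3 k m by (auto simp: rank_x)
        qed
      qed
    qed
  qed
  also have "\<dots> = [:-1, 1:] ^ 2 * (\<Prod>l<r. \<Prod>j\<in>{1..<p l}. if j = 1 then geometric_poly (p l) else ?X)"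
  proof -
    have "R $$ (0, 0) = [:-1, 1:]" using M[of 0 0] by (simp add: R_def comb_0)
    moreover have "R $$ (b, b) = [:-1, 1:]"
      using M[of b b] b_in by (simp add: R_def comb_b leg_matrix_def)
    moreover have "R $$ (x l j, x l j) = (if j = 1 then geometric_poly (p l) else ?X)"
      if lj: "l < r" "1 \<le> j" "j < p l" for l j
    proof (cases "j = 1")
      case True
      then show ?thesis using first[of l l 1] lj x_in[OF lj] by (simp add: R_def)
    next
      case False
      then show ?thesis using lj x_in[OF lj] M_x[of l j "x l j"] by (auto simp: R_def comb_x leg_matrix_def)
    qed
    then have "(\<Prod>l<r. \<Prod>j\<in>{1..<p l}. R $$ (x l j, x l j)) =
        (\<Prod>l<r. \<Prod>j\<in>{1..<p l}. if j = 1 then geometric_poly (p l) else ?X)"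
      by (intro prod.cong refl) simp
    ultimately show ?thesis by (simp only: diagonal power2_eq_square mult.assoc)
  qed
  also have "\<dots> = [:-1, 1:] ^ 2 * (\<Prod>l<r. geometric_poly (p l)) * det Q"
  proof -
    have "(\<Prod>j\<in>{1..<p l}. if j = 1 then geometric_poly (p l) else ?X) =
        geometric_poly (p l) * (\<Prod>j\<in>{1..<p l}. if j = 1 then ?X ^ (p l - 2) else 1)" if l: "l < r" for l
    proof (cases "p l = 1")
      case False
      then have "p l = Suc (Suc (p l - 2))" using p_pos[OF l] by simp
      then obtain q where q: "p l = Suc (Suc q)" by blast
      have "{1..<p l} = insert 1 {2..<p l}" unfolding q by auto
      then show ?thesis by (simp add: q numeral_2_eq_2)
    qed (simp add: geometric_poly_def One_nat_def)
    then show ?thesis by (simp add: detQ prod.distrib mult.assoc)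
  qed
  finally have "det Q * char_poly ?T = det Q * ([:-1, 1:] ^ 2 * (\<Prod>l<r. geometric_poly (p l)))"
    unfolding dets by (simp only: mult.commute)
  moreover have "det Q \<noteq> 0"
    unfolding detQ by (auto simp: prod_zero_iff)
  ultimately show ?thesis by simp
qed

end

text \<open>
  Both sides are monic of degree \<open>q - 1\<close> and vanish at the \<open>q\<close>-th roots of unity other than \<open>1\<close>.
\<close>

lemma geometric_poly_complex:
  assumes "1 \<le> q"
  shows "map_poly complex_of_real (geometric_poly q) =
    (\<Prod>k\<in>{1..<q}. [:- cis (2 * pi * real k / real q), 1:])" (is "?P = ?Q")
proof -
  have map: "?P = (\<Sum>i<q. monom 1 i)"
  proof -
    have "geometric_poly q = (\<Sum>i<q. monom (1::real) i)"
      by (simp add: geometric_poly_def monom_altdef)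
    then show ?thesis by (intro poly_eqI) (simp add: coeff_map_poly coeff_sum)
  qed
  let ?z = "\<lambda>k. cis (2 * pi * real k / real q)"
  have inj: "inj_on ?z {..<q}"
    using bij_betw_roots_unity[of q] assms by (simp add: bij_betw_def)
  show ?thesis
  proof (rule poly_eqI_degree_lead_coeff)
    have deg: "degree ?Q = q - 1"
      by (subst degree_prod_eq_sum_degree) auto
    then show "degree ?Q \<le> q - 1" by simp
    show "degree ?P \<le> q - 1"
      unfolding map by (intro degree_sum_le) (auto intro: order_trans[OF degree_monom_le])
    have "poly.coeff ?P (q - 1) = 1"
      unfolding map using assms by (simp add: coeff_sum)
    moreover have "poly.coeff ?Q (q - 1) = 1"
      using lead_coeff_prod[of "\<lambda>k. [:- ?z k, 1:]" "{1..<q}"] deg by simp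
    ultimately show "poly.coeff ?P (q - 1) = poly.coeff ?Q (q - 1)" by simp
    show "q - 1 \<le> card (?z ` {1..<q})"
      using inj by (subst card_image) (auto elim: inj_on_subset)
    fix y assume "y \<in> ?z ` {1..<q}"
    then obtain k where k: "k \<in> {1..<q}" "y = ?z k" by auto
    have "y ^ q = 1" using bij_betwE[OF bij_betw_roots_unity[of q]] k assms by auto
    moreover have "y \<noteq> 1"
      using inj_onD[OF inj, of k 0] k by auto
    ultimately have "(\<Sum>i<q. y ^ i) = 0" by (simp add: sum_gp_strict)
    moreover have "poly ?P y = (\<Sum>i<q. y ^ i)" unfolding map by (simp add: poly_sum poly_monom)
    moreover have "poly ?Q y = 0" using k by (auto simp: poly_prod prod_zero_iff)
    ultimately show "poly ?P y = poly ?Q y" by simp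
  qed
qed

lemma inner_coroot: "inner v (coroot a) = cartan_number v a"
  by (simp add: coroot_def cartan_number_def)

context star_basis
begin

section \<open>Exponents and the fundamental weight\<close>

text \<open>
  Linear along every leg, from \<open>0\<close> beyond its outer end to the period at the centre.
\<close>

definition exponent :: "nat \<Rightarrow> int" where
  "exponent i = int (if i = 0 then 0 else node_fun leg_period (\<lambda>l j. leg_period div p l * j) i)"

lemma exponent_0: "exponent 0 = 0"
  and exponent_b: "exponent b = int leg_period"
  and exponent_x: "l < r \<Longrightarrow> 1 \<le> j \<Longrightarrow> j < p l \<Longrightarrow> exponent (x l j) = int (leg_period div p l * j)"
  using b_in x_in[of l j] by (auto simp: exponent_def)

lemma exponent_x_bounds:
  assumes "l < r" "1 \<le> j" "j < p l"
  shows "0 < exponent (x l j)" and "exponent (x l j) < int leg_period"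
proof -
  have "leg_period div p l * p l = leg_period"
    using p_dvd_leg_period[OF assms(1)] by simp
  moreover from this have "0 < leg_period div p l"
    using leg_period_pos by (metis mult_is_0 neq0_conv)
  moreover from this have "leg_period div p l * j < leg_period div p l * p l"
    using assms by simp
  ultimately show "0 < exponent (x l j)" and "exponent (x l j) < int leg_period"
    using assms by (simp_all add: exponent_x del: of_nat_mult)
qed

lemma affine_exponents_legs:
  assumes S: "char_poly S = [:-1, 1:] ^ 2 * (\<Prod>l<r. geometric_poly (p l))"
  shows "affine_exponents S leg_period (image_mset exponent (mset_set {0..n}))"
proof -
  interpret of_real: map_poly_comm_ring_hom complex_of_real by unfold_locales auto
  let ?F = "\<lambda>m. [:- cis (2 * pi * real_of_int m / real leg_period), 1:]"
  have range: "i = 0 \<or> i = b \<or> 0 < exponent i \<and> exponent i < int leg_period" if "i \<in> {0..n}" for i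
  proof (cases "i = 0")
    case False
    then have "i \<in> {1..n}" using that by simp
    then show ?thesis
    proof (cases rule: node_cases)
      case (2 l j)
      then show ?thesis using exponent_x_bounds[of l j] by simp
    qed simp
  qed simp
  have "map_poly complex_of_real (char_poly S) =
      map_poly complex_of_real [:-1, 1:] ^ 2 * (\<Prod>l<r. map_poly complex_of_real (geometric_poly (p l)))"
    unfolding S by (simp only: of_real.hom_mult of_real.hom_power of_real.hom_prod)
  also have "map_poly complex_of_real [:-1, 1:] = [:-1, 1:]"
    by (simp add: map_poly_pCons)
  also have "(\<Prod>l<r. map_poly complex_of_real (geometric_poly (p l))) =
      (\<Prod>l<r. \<Prod>j\<in>{1..<p l}. ?F (exponent (x l j)))"
  proof (intro prod.cong refl)
    fix l assume "l \<in> {..<r}"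
    then have l: "l < r" by simp
    have "real (leg_period div p l) = real leg_period / real (p l)"
      using p_dvd_leg_period[OF l] by (rule real_of_nat_div)
    then have "2 * pi * real_of_int (exponent (x l j)) / real leg_period = 2 * pi * real j / real (p l)"
      if "1 \<le> j" "j < p l" for j
      using leg_period_pos l that by (simp add: exponent_x field_simps)
    then show "map_poly complex_of_real (geometric_poly (p l)) = (\<Prod>j\<in>{1..<p l}. ?F (exponent (x l j)))"
      using geometric_poly_complex[OF p_pos[OF l]] by simp
  qed
  also have "[:-1, 1:] ^ 2 * (\<Prod>l<r. \<Prod>j\<in>{1..<p l}. ?F (exponent (x l j))) =
      (\<Prod>i=0..n. ?F (exponent i))"
  proof -
    have "(\<Prod>i=0..n. ?F (exponent i)) = ?F (exponent 0) * (\<Prod>i=1..n. ?F (exponent i))"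
      by (simp add: prod.atLeast_Suc_atMost One_nat_def)
    also have "(\<Prod>i=1..n. ?F (exponent i)) =
        ?F (exponent b) * (\<Prod>l<r. \<Prod>j\<in>{1..<p l}. ?F (exponent (x l j)))"
      by (rule prod_nodes)
    finally have "(\<Prod>i=0..n. ?F (exponent i)) = ?F (exponent 0) *
        (?F (exponent b) * (\<Prod>l<r. \<Prod>j\<in>{1..<p l}. ?F (exponent (x l j))))" .
    moreover have "?F (exponent 0) = [:-1, 1:]" by (simp add: exponent_0)
    moreover have "?F (exponent b) = [:-1, 1:]" using leg_period_pos by (simp add: exponent_b)
    ultimately show ?thesis by (simp only: power2_eq_square mult.assoc)
  qed
  also have "\<dots> = (\<Prod>m\<in>#image_mset exponent (mset_set {0..n}). ?F m)"
    by (simp add: prod_unfold_prod_mset multiset.map_comp o_def)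
  finally have poly: "map_poly complex_of_real (char_poly S) =
      (\<Prod>m\<in>#image_mset exponent (mset_set {0..n}). ?F m)" .
  have count: "count (image_mset exponent (mset_set {0..n})) v = card {i \<in> {0..n}. exponent i = v}" for v
  proof -
    have "count (image_mset exponent (mset_set {0..n})) v =
        (\<Sum>i\<in>{i \<in> {0..n}. exponent i = v}. count (mset_set {0..n}) i)"
      unfolding count_image_mset' by (rule sum.cong) auto
    also have "\<dots> = (\<Sum>i\<in>{i \<in> {0..n}. exponent i = v}. 1)" by (rule sum.cong) auto
    finally show ?thesis by simp
  qed
  have "i = 0" if "i \<in> {0..n}" "exponent i = 0" for i
    using range[OF that(1)] that(2) leg_period_pos exponent_b by auto
  then have "{i \<in> {0..n}. exponent i = 0} = {0}" by (auto simp: exponent_0)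
  moreover have "i = b" if "i \<in> {0..n}" "exponent i = int leg_period" for i
    using range[OF that(1)] that(2) leg_period_pos exponent_0 by auto
  then have "{i \<in> {0..n}. exponent i = int leg_period} = {b}" using b_in by (auto simp: exponent_b)
  moreover have "0 \<le> exponent i \<and> exponent i \<le> int leg_period" if "i \<in> {0..n}" for i
    using range[OF that] exponent_0 exponent_b by auto
  ultimately show ?thesis
    using poly by (auto simp: affine_exponents_def count)
qed

text \<open>
  The map \<open>combination\<close> followed by \<open>coxeter ^^ s\<close> intertwines the affine Coxeter transformation with
  \<open>leg_coxeter\<close>.
\<close>

lemma affine_coxeter_char_poly:
  assumes z: "null_vector n (cartan \<alpha>) z"
    and \<theta>: "\<alpha> 0 = - \<theta>" and orbit: "(coxeter ^^ s) \<theta> = - \<alpha> b"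
  shows "char_poly (affine_product n (cartan \<alpha>) (0 # b # leg_word)) =
    [:-1, 1:] ^ 2 * (\<Prod>l<r. geometric_poly (p l))"
proof -
  let ?js = "0 # b # leg_word" and ?g = "coxeter ^^ s"
  let ?S = "affine_product n (cartan \<alpha>) ?js"
  have js: "set ?js \<subseteq> {0..n}" using b_in by (auto simp: set_leg_word)
  have g: "linear ?g" by (intro linear_funpow reflect_word_linear)
  have bij: "bij ?g" by (rule reflect_word_funpow_bij)
  have comb: "combination (\<lambda>i. ?g (\<alpha> i)) n v = ?g (combination \<alpha> n v)" for v
    by (rule combination_image[OF g])
  have g0: "?g v = 0 \<longleftrightarrow> v = 0" for v
    using inj_eq[OF bij_is_inj[OF bij], of v 0] linear_0[OF g] by simp
  obtain t where "char_poly ?S = char_poly (bordered_mat n t leg_matrix)"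
  proof (rule char_poly_quotient[of ?S n "null_vec z" "\<lambda>i. ?g (\<alpha> i)" \<alpha> leg_coxeter leg_matrix])
    show "?S \<in> carrier_mat (n + 1) (n + 1)" by (rule affine_product_carrier)
    show "null_vec z \<noteq> 0\<^sub>v (n + 1)"
    proof
      assume "null_vec z = 0\<^sub>v (n + 1)"
      then have "vec_index (null_vec z) 0 = 0" by simp
      then show False using null_vec_0[OF z] by simp
    qed
    show "?S *\<^sub>v null_vec z = null_vec z" by (rule affine_product_null_vec[OF z js])
    show "combination (\<lambda>i. ?g (\<alpha> i)) n v = 0 \<longleftrightarrow> (\<exists>t. v = t \<cdot>\<^sub>v null_vec z)"
      if "v \<in> carrier_vec (n + 1)" for v
      using combination_kernel[OF z that] by (simp only: comb g0)
    show "\<exists>v\<in>carrier_vec (n + 1). combination (\<lambda>i. ?g (\<alpha> i)) n v = \<alpha> j" for j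
    proof -
      obtain e where e: "?g e = \<alpha> j" using bij_is_surj[OF bij] by (metis surjD)
      obtain v where "v \<in> carrier_vec (n + 1)" "combination \<alpha> n v = e" by (rule combination_surj)
      then show ?thesis using e by (auto simp: comb)
    qed
    show "combination (\<lambda>i. ?g (\<alpha> i)) n (?S *\<^sub>v v) = leg_coxeter (combination (\<lambda>i. ?g (\<alpha> i)) n v)"
      if "v \<in> carrier_vec (n + 1)" for v
      unfolding comb combination_affine_product[OF js that]
      by (rule affine_coxeter_conjugate[OF \<theta> orbit])
    show "leg_coxeter (\<alpha> j) = (\<Sum>i=1..n. leg_matrix i j *\<^sub>R \<alpha> i)" if "j \<in> {1..n}" for j
      by (rule leg_matrix_column[OF that])
    show "s i = 0" if "(\<Sum>i=1..n. s i *\<^sub>R \<alpha> i) = 0" "i \<in> {1..n}" for s i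
      using coefficients_unique[of s "\<lambda>_. 0" i] that by simp
  qed auto
  then show ?thesis by (simp add: char_poly_leg_matrix)
qed

text \<open>
  Let \<open>N\<close> be the right-hand side. Its pairings with the leg co-roots vanish, so \<open>N = c\<^sub>0 w\<close> for some \<open>c\<^sub>0\<close>, which is an integer
  because the exponents next to the centre are. It is positive because \<open>N \<bullet> N = h * c\<^sub>0\<close>.
  Conversely, a multiple of \<open>w\<close> in the co-root lattice has integral coordinates \<open>k\<close> proportional to the
  exponents, so \<open>k b\<close> equals \<open>p l\<close> times the coordinate at the outer end of leg \<open>l\<close>; thus \<open>k b\<close> is a multiple of \<open>h\<close>.
\<close>

lemma weight_coordinates:
  assumes norm: "inner (\<alpha> b) (\<alpha> b) = 2" and w: "fundamental_weight n \<alpha> b w"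
    and c: "0 < c" "real c *\<^sub>R w \<in> coroot_lattice n \<alpha>"
    and least: "\<And>k. 0 < k \<Longrightarrow> real k *\<^sub>R w \<in> coroot_lattice n \<alpha> \<Longrightarrow> c \<le> k"
  shows "real c *\<^sub>R w = (\<Sum>i=0..n. of_int (exponent i) *\<^sub>R coroot (\<alpha> i))"
proof -
  let ?L = leg_period and ?d = "\<lambda>i. 2 / inner (\<alpha> i) (\<alpha> i)"
  define N where "N = (\<Sum>i=1..n. of_int (exponent i) *\<^sub>R coroot (\<alpha> i))"
  define u where "u l j = real (a l) * real (?L div p l) * real j" for l j
  define c0 where "c0 = 2 * int ?L - (\<Sum>l<r. int (a l * (?L div p l) * (p l - 1)))"
  have L: "?L div p l * p l = ?L" if "l < r" for l using p_dvd_leg_period[OF that] by simp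
  have d: "?d i \<noteq> 0" if "i \<in> {1..n}" for i using root_nonzero[OF that] by simp

  \<comment> \<open>The co-root of a leg node is \<open>a l\<close> times the root, as the centre has squared length \<open>2\<close>.\<close>
  have d_x: "?d (x l j) = real (a l)" if "l < r" "1 \<le> j" "j < p l" for l j
    using leg_node_norm[OF that] norm root_nonzero[OF x_in[OF that]] by (simp add: field_simps)
  have N: "N = star_vec (real ?L) u"
    unfolding N_def sum_nodes star_vec_def
    by (intro arg_cong2[of _ _ _ _ plus] sum.cong)
      (auto simp: coroot_def exponent_b exponent_x norm d_x u_def mult_ac)
  have u0: "u l 0 = 0" for l by (simp add: u_def)
  have up: "u l (p l) = real (a l) * real ?L" if "l < r" for l
    using L[OF that] unfolding u_def by (metis mult.assoc of_nat_mult)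
  have N_b: "cartan_number N (\<alpha> b) = of_int c0"
    unfolding N using p_pos by (simp add: pairing_centre u0 c0_def) (simp add: u_def)
  have N_x: "cartan_number N (\<alpha> (x l j)) = 0" if "l < r" "1 \<le> j" "j < p l" for l j
    using that unfolding N by (simp add: pairing_leg u0 up) (simp add: u_def of_nat_diff algebra_simps)
  have N_w: "N = of_int c0 *\<^sub>R w"
  proof -
    have "N - of_int c0 *\<^sub>R w = 0"
    proof (rule orthogonal_zero)
      fix i assume i: "i \<in> {1..n}"
      then have w_i: "cartan_number w (\<alpha> i) = (if i = b then 1 else 0)"
        using w by (simp add: fundamental_weight_def inner_coroot)
      show "cartan_number (N - of_int c0 *\<^sub>R w) (\<alpha> i) = 0"
        using i
      proof (cases rule: node_cases)
        case 1
        then show ?thesis using w_i by (simp add: cartan_number_simps N_b)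
      next
        case (2 l j)
        then have "i \<noteq> b" using x_neq_b by blast
        then show ?thesis using 2 w_i by (simp add: cartan_number_simps N_x)
      qed
    qed
    then show ?thesis by simp
  qed
  have "inner N N = (\<Sum>i=1..n. of_int (exponent i) * cartan_number N (\<alpha> i))"
    by (subst (2) N_def) (simp add: inner_sum_right inner_coroot)
  also have "\<dots> = real ?L * of_int c0"
    by (simp add: sum_nodes N_b N_x exponent_b)
  finally have "inner N N = real ?L * of_int c0" .
  moreover have "N \<noteq> 0"
  proof
    assume "N = 0"
    then have "star_vec (real ?L) u = star_vec 0 (\<lambda>_ _. 0)" by (simp add: N[symmetric]) (simp add: star_vec_def)
    then show False using star_vec_unique(1) leg_period_pos by fastforce
  qed
  ultimately have "0 < real ?L * of_int c0" by (metis inner_gt_zero_iff)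
  then have c0_pos: "0 < c0" using leg_period_pos by (simp add: zero_less_mult_iff)

  have "c \<le> nat c0"
  proof (rule least)
    have "real (nat c0) *\<^sub>R w = N" using N_w c0_pos by simp
    then show "real (nat c0) *\<^sub>R w \<in> coroot_lattice n \<alpha>"
      unfolding N_def coroot_lattice_def by blast
  qed (use c0_pos in simp)
  moreover have "nat c0 \<le> c"
  proof -
    obtain k :: "nat \<Rightarrow> int" where k: "real c *\<^sub>R w = (\<Sum>i=1..n. of_int (k i) *\<^sub>R coroot (\<alpha> i))"
      using c(2) by (auto simp: coroot_lattice_def)
    have "of_int c0 *\<^sub>R (real c *\<^sub>R w) = real c *\<^sub>R N" by (simp add: N_w)
    then have "(\<Sum>i=1..n. (of_int (c0 * k i) * ?d i) *\<^sub>R \<alpha> i) =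
        (\<Sum>i=1..n. (of_int (int c * exponent i) * ?d i) *\<^sub>R \<alpha> i)"
      unfolding k N_def by (simp add: scaleR_sum_right coroot_def mult.assoc)
    from coefficients_unique[OF this]
    have "of_int (c0 * k i) * ?d i = of_int (int c * exponent i) * ?d i" if "i \<in> {1..n}" for i
      using that by blast
    then have eq: "c0 * k i = int c * exponent i" if "i \<in> {1..n}" for i
      using d[OF that] that by (metis mult_cancel_right of_int_eq_iff)
    have k_b: "c0 * k b = int c * int ?L" using eq[OF b_in] by (simp add: exponent_b)
    have "int (p l) dvd k b" if l: "l < r" for l
    proof (cases "p l = 1")
      case False
      then have l1: "1 < p l" using p_pos[OF l] by simp
      have "c0 * k (x l 1) = int c * int (?L div p l)"
        using eq[OF x_in[OF l _ l1]] exponent_x[OF l _ l1] by simp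
      then have "c0 * (k (x l 1) * int (p l)) = int c * int (?L div p l * p l)" by (simp add: mult.assoc)
      then have "c0 * (k (x l 1) * int (p l)) = c0 * k b" using k_b L[OF l] by simp
      then have "k b = k (x l 1) * int (p l)" using c0_pos by simp
      then show ?thesis by simp
    qed simp
    moreover have k_b_pos: "0 < k b"
      using k_b c0_pos c(1) leg_period_pos by (metis zero_less_mult_pos mult_pos_pos of_nat_0_less_iff)
    ultimately have "?L dvd nat (k b)"
      unfolding leg_period_def by (intro Lcm_least) (auto simp: int_dvd_int_iff[symmetric])
    then have "int ?L \<le> k b" using k_b_pos by (auto dest: dvd_imp_le)
    then have "c0 * int ?L \<le> int c * int ?L" using k_b c0_pos by (metis mult_left_mono less_imp_le)
    then show ?thesis using leg_period_pos by simp
  qed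
  ultimately have "real c = of_int c0" using c0_pos by simp
  then show ?thesis
    using N_w unfolding N_def by (simp add: sum.atLeast_Suc_atMost One_nat_def exponent_0)
qed

text \<open>
  The conclusion for all root systems whose diagram is a star with suitable defects; the
  witness is the word \<open>0, b, legs\<close>.
\<close>

theorem star_exponents:
  assumes \<Phi>: "root_system \<Phi>" "simple_roots \<Phi> n \<alpha>" and long: "long_roots_normalised \<Phi>"
    and highest: "highest_root \<Phi> n \<alpha> (- \<alpha> 0)" and z: "null_vector n (cartan \<alpha>) z"
    and s: "1 \<le> s" "\<And>t. 2 \<le> t \<Longrightarrow> t \<le> s \<Longrightarrow> leg_defect t = 2 * t - 1" "leg_defect (Suc s) \<le> 2 * s"
    and w: "fundamental_weight n \<alpha> b w" "0 < c" "real c *\<^sub>R w \<in> coroot_lattice n \<alpha>"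
      "\<And>k. 0 < k \<Longrightarrow> real k *\<^sub>R w \<in> coroot_lattice n \<alpha> \<Longrightarrow> c \<le> k"
  shows "\<exists>\<pi> (h::nat) (m :: nat \<Rightarrow> int).
           \<pi> permutes {0..n} \<and>
           affine_coxeter_number n z (coxeter_transformation n (cartan \<alpha>) \<pi>) h \<and>
           affine_exponents (coxeter_transformation n (cartan \<alpha>) \<pi>) h
             (image_mset m (mset_set {0..n})) \<and>
           real c *\<^sub>R w = (\<Sum>i=0..n. of_int (m i) *\<^sub>R coroot (\<alpha> i)) \<and>
           m 0 = 0 \<and> m b = int h"
proof -
  let ?js = "0 # b # leg_word"
  have orbit: "(coxeter ^^ s) (- \<alpha> 0) = - \<alpha> b"
    using \<Phi> highest s by (rule highest_root_in_orbit)
  have \<alpha>0: "\<alpha> 0 = - (- \<alpha> 0)" by simp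
  have set_js: "set ?js = {0..n}" using b_in by (auto simp: set_leg_word)
  have "distinct leg_word"
  proof (rule card_distinct)
    have "length leg_word = (\<Sum>l<r. p l - 1)"
      by (simp add: leg_word_def length_concat o_def interv_sum_list_conv_sum_set_nat atLeast0LessThan)
    also have "\<dots> = card places" by (simp add: places_def)
    also have "\<dots> = card (set leg_word)"
      using bij_betw_same_card[OF x_bij] by (simp only: set_leg_word)
    finally show "card (set leg_word) = length leg_word" ..
  qed
  then have "distinct ?js" using b_in by (auto simp: set_leg_word)
  then obtain \<pi> where \<pi>: "\<pi> permutes {0..n}"
    "coxeter_transformation n (cartan \<alpha>) \<pi> = affine_product n (cartan \<alpha>) ?js"
    using set_js by (rule coxeter_transformation_of_word)
  have trivial: "trivial_mod_null n z (affine_product n (cartan \<alpha>) ?js ^\<^sub>m k) \<longleftrightarrow> leg_period dvd k" for k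
    unfolding affine_coxeter_order[OF \<alpha>0 orbit, symmetric] using set_js
    by (intro trivial_mod_null_iff[OF z affine_product_carrier] combination_affine_product) auto
  have "affine_coxeter_number n z (coxeter_transformation n (cartan \<alpha>) \<pi>) leg_period"
    unfolding affine_coxeter_number_def \<pi> trivial using leg_period_pos by (auto dest: dvd_imp_le)
  moreover have "affine_exponents (coxeter_transformation n (cartan \<alpha>) \<pi>) leg_period
      (image_mset exponent (mset_set {0..n}))"
    unfolding \<pi> by (intro affine_exponents_legs affine_coxeter_char_poly[OF z \<alpha>0 orbit])
  moreover have "inner (\<alpha> b) (\<alpha> b) = 2"
  proof -
    obtain \<gamma> where \<gamma>: "\<gamma> \<in> \<Phi>" "inner \<gamma> \<gamma> = 2"
      using long by (auto simp: long_roots_normalised_def)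
    obtain i where "i \<in> {1..n}" "inner \<gamma> \<gamma> = inner (\<alpha> i) (\<alpha> i)"
      by (rule root_norm[OF \<Phi> \<gamma>(1)])
    then have "2 \<le> inner (\<alpha> b) (\<alpha> b)" using \<gamma>(2) centre_longest[of i] by simp
    moreover have "\<alpha> b \<in> \<Phi>" using \<Phi>(2) b_in by (auto simp: simple_roots_def)
    ultimately show ?thesis using long by (force simp: long_roots_normalised_def)
  qed
  then have "real c *\<^sub>R w = (\<Sum>i=0..n. of_int (exponent i) *\<^sub>R coroot (\<alpha> i))"
    using w by (rule weight_coordinates)
  ultimately show ?thesis using \<pi>(1) exponent_0 exponent_b by blast
qed

end

section \<open>Branch vertices\<close>

context star_basis
begin

text \<open>
  A leg node has one neighbour towards the centre and possibly one away from it, both with Cartan entry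
  \<open>-1\<close>. The correction for end vertices makes up for a missing second neighbour.
\<close>

lemma leg_node_branching:
  assumes l: "l < r" and j: "1 \<le> j" "j < p l"
  shows "branching n \<alpha> (x l j) = 2"
proof -
  let ?y = "x l j" and ?next = "if Suc j = p l then b else x l (Suc j)"
  let ?N = "if j = 1 then {?next} else {?next, x l (j - 1)}"
  have y: "?y \<in> {1..n}" by (rule x_in[OF l j])
  have next_in: "?next \<in> {1..n}" using b_in x_in[of l "Suc j"] l j by simp
  have next_neq: "?next \<noteq> ?y" using x_neq_b[OF l j] x_inj[of l "Suc j" l j] l j by auto
  have x_eq: "x l' j' = x l m \<longleftrightarrow> l' = l \<and> j' = m"
    if "l' < r" "1 \<le> j'" "j' < p l'" "1 \<le> m" "m < p l" for l' j' m
    using x_inj[of l' j' l m] that l by auto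
  have prev: "x l (j - 1) \<in> {1..n}" "x l (j - 1) \<noteq> ?y" "x l (j - 1) \<noteq> ?next" if "j \<noteq> 1"
  proof -
    have j1: "1 \<le> j - 1" "j - 1 < p l" using that j by auto
    show "x l (j - 1) \<in> {1..n}" by (rule x_in[OF l j1])
    show "x l (j - 1) \<noteq> ?y" using x_eq[OF l j1 j] j by simp
    show "x l (j - 1) \<noteq> ?next"
      using x_neq_b[OF l j1] x_eq[OF l j1, of "Suc j"] j by auto
  qed
  have C: "cartan \<alpha> ?y i = (if i \<in> ?N then -1 else 0)" if i: "i \<in> {1..n}" "i \<noteq> ?y" for i
    using i(1)
  proof (cases rule: node_cases)
    case 1
    have "x l (j - 1) \<noteq> b" if "j \<noteq> 1" by (intro x_neq_b l) (use that j in simp_all)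
    moreover have "x l (Suc j) \<noteq> b" if "Suc j \<noteq> p l" by (intro x_neq_b l) (use that j in simp_all)
    ultimately have "b \<in> ?N \<longleftrightarrow> Suc j = p l" by auto
    then show ?thesis using cartan_x_b[OF l j] 1 by simp
  next
    case (2 l' j')
    have next_iff: "i = ?next \<longleftrightarrow> l' = l \<and> j' = Suc j"
      using 2 x_neq_b[OF 2(1-3)] x_eq[OF 2(1-3), of "Suc j"] j by (cases "Suc j = p l") auto
    have prev_iff: "i = x l (j - 1) \<longleftrightarrow> l' = l \<and> j = Suc j'" if "j \<noteq> 1"
      using that 2 x_eq[OF 2(1-3), of "j - 1"] j by auto
    have "i \<in> ?N \<longleftrightarrow> l' = l \<and> (j' = Suc j \<or> j = Suc j')"
    proof (cases "j = 1")
      case True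
      then show ?thesis using next_iff 2(2) by simp
    next
      case False
      then show ?thesis using next_iff prev_iff by (simp only: insert_iff empty_iff if_False) blast
    qed
    moreover have "\<not> (l' = l \<and> j' = j)" using 2 i by auto
    moreover have "cartan \<alpha> ?y i = (if l = l' then (if j = j' then 2 else if j' = Suc j \<or> j = Suc j' then -1 else 0) else 0)"
      unfolding 2(4) by (rule cartan_x_x[OF l j 2(1-3)])
    ultimately show ?thesis by (simp only:) auto
  qed
  have neighbours: "neighbours n \<alpha> ?y = ?N"
    using C next_in next_neq prev by (auto simp: neighbours_def split: if_splits)
  have "(\<Sum>i\<in>{1..n} - {?y}. cartan \<alpha> ?y i) = (\<Sum>i\<in>{1..n} - {?y}. if i \<in> ?N then -1 else 0)"
    using C by (intro sum.cong) auto
  also have "\<dots> = - real (card (({1..n} - {?y}) \<inter> ?N))"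
    by (simp add: sum.inter_restrict[symmetric])
  also have "({1..n} - {?y}) \<inter> ?N = ?N" using next_in next_neq prev by auto
  finally show ?thesis
    using prev(3) unfolding branching_def neighbours by (cases "j = 1") auto
qed

text \<open>
  The defect at \<open>2\<close> is the sum of the \<open>a l\<close> over the nonempty legs.
\<close>

lemma centre_branching: "leg_defect 2 \<le> branching n \<alpha> b"
  and centre_branching_one_leg:
    "l < r \<Longrightarrow> 1 < p l \<Longrightarrow> (\<And>l'. l' < r \<Longrightarrow> l' \<noteq> l \<Longrightarrow> p l' = 1) \<Longrightarrow>
       branching n \<alpha> b = 1 + leg_defect 2"
proof -
  have row: "(\<Sum>j\<in>{1..<p l}. cartan \<alpha> b (x l j)) = - real (a l * (2 - ceil_div 2 (p l)))" if l: "l < r" for l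
  proof (cases "p l = 1")
    case False
    then have p: "2 \<le> p l" using p_pos[OF l] by simp
    have "(\<Sum>j\<in>{1..<p l}. cartan \<alpha> b (x l j)) = (\<Sum>j\<in>{1..<p l}. if j = p l - 1 then - real (a l) else 0)"
      using l by (intro sum.cong) (auto simp: cartan_b_x)
    also have "\<dots> = - real (a l)" using p by simp
    also have "ceil_div 2 (p l) = 1"
      using ceil_div_step[of "p l" 1] p by (simp add: numeral_2_eq_2 One_nat_def)
    then have "- real (a l) = - real (a l * (2 - ceil_div 2 (p l)))" by simp
    finally show ?thesis .
  qed (simp add: ceil_div_def)
  have "(\<Sum>j\<in>{1..n} - {b}. cartan \<alpha> b j) = (\<Sum>j=1..n. cartan \<alpha> b j) - cartan \<alpha> b b"
    using b_in by (simp add: sum_diff1)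
  also have "\<dots> = - real (leg_defect 2)"
    by (simp add: sum_nodes row star_defect_def sum_negf)
  finally have total: "(\<Sum>j\<in>{1..n} - {b}. cartan \<alpha> b j) = - real (leg_defect 2)" .
  then show "leg_defect 2 \<le> branching n \<alpha> b" by (simp add: branching_def)
  assume l: "l < r" "1 < p l" and other: "\<And>l'. l' < r \<Longrightarrow> l' \<noteq> l \<Longrightarrow> p l' = 1"
  have "neighbours n \<alpha> b = {x l (p l - 1)}"
  proof (intro equalityI subsetI)
    fix i assume "i \<in> neighbours n \<alpha> b"
    then have i: "i \<in> {1..n}" "i \<noteq> b" "cartan \<alpha> b i \<noteq> 0" by (auto simp: neighbours_def)
    from i(1) show "i \<in> {x l (p l - 1)}"
    proof (cases rule: node_cases)
      case (2 l' j)
      then have "l' = l" using other[of l'] by auto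
      moreover have "Suc j = p l'" using 2 i(3) cartan_b_x[OF 2(1-3)] by (auto split: if_splits)
      then have "j = p l' - 1" by simp
      ultimately show ?thesis using 2(4) by simp
    qed (use i in simp)
  next
    fix i assume "i \<in> {x l (p l - 1)}"
    moreover have "1 \<le> p l - 1" "p l - 1 < p l" using l by auto
    ultimately show "i \<in> neighbours n \<alpha> b"
      using l x_in[of l "p l - 1"] x_neq_b[of l "p l - 1"] cartan_b_x[of l "p l - 1"] leg_multiplicity_pos[OF l]
      by (auto simp: neighbours_def)
  qed
  then show "branching n \<alpha> b = 1 + leg_defect 2" by (simp add: branching_def total)
qed

lemma branch_vertex_is_centre:
  assumes "branch_vertex n \<alpha> i" and "2 < branching n \<alpha> b"
  shows "i = b"
proof -
  have "i \<in> {1..n}" and max: "branching n \<alpha> b \<le> branching n \<alpha> i"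
    using assms(1) b_in by (auto simp: branch_vertex_def)
  then show ?thesis
  proof (cases rule: node_cases)
    case (2 l j)
    then show ?thesis using leg_node_branching[of l j] max assms(2) by simp
  qed
qed

end

section \<open>The classification\<close>

lemma path_edge_iff:
  "{i, j} \<in> path_edges u v \<longleftrightarrow> u \<le> i \<and> i < v \<and> j = i + 1 \<or> u \<le> j \<and> j < v \<and> i = j + 1"
  by (auto simp: path_edges_def doubleton_eq_iff)

text \<open>
  The simple roots may be enumerated in any order, so the diagrams in standard numbering are relabelled.
\<close>

lemma star_diagram_transport:
  assumes star: "star_diagram C n b r p a x" and q: "bij_betw q {1..n} {1..n}"
    and C': "\<And>i j. i \<in> {1..n} \<Longrightarrow> j \<in> {1..n} \<Longrightarrow> C' (q i) (q j) = C i j"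
  shows "star_diagram C' n (q b) r p a (\<lambda>l j. q (x l j))"
proof -
  have b: "b \<in> {1..n}"
    and bij: "bij_betw (\<lambda>(l, j). x l j) (SIGMA l:{..<r}. {1..<p l}) ({1..n} - {b})"
    using star unfolding star_diagram_def by blast+
  have x: "x l j \<in> {1..n}" if "l < r" "j \<in> {1..<p l}" for l j
    using bij_betwE[OF bij] that by auto
  have "bij_betw q ({1..n} - {b}) ({1..n} - {q b})"
    using q b by (intro bij_betw_DiffI) (auto simp: bij_betw_def)
  from bij_betw_trans[OF bij this]
  have "bij_betw (\<lambda>(l, j). q (x l j)) (SIGMA l:{..<r}. {1..<p l}) ({1..n} - {q b})"
    by (simp add: o_def case_prod_unfold)
  moreover have "q b \<in> {1..n}" using bij_betwE[OF q] b by blast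
  ultimately show ?thesis
    using star b x unfolding star_diagram_def by (simp add: C')
qed

abbreviation real_cartan :: "cartan_type \<Rightarrow> nat \<Rightarrow> nat \<Rightarrow> real" where
  "real_cartan X i j \<equiv> of_int (type_cartan X i j)"

\<comment> \<open>For the concrete diagrams below, numerals are better normalised to successors.\<close>
declare One_nat_def [simp]

lemma star_diagramI:
  assumes "1 \<le> b" "b \<le> n" and "\<And>l. l < r \<Longrightarrow> 1 \<le> p l"
    and x: "\<And>l j. l < r \<Longrightarrow> 1 \<le> j \<Longrightarrow> j < p l \<Longrightarrow> 1 \<le> x l j \<and> x l j \<le> n \<and> x l j \<noteq> b"
    and left: "\<And>l j. l < r \<Longrightarrow> 1 \<le> j \<Longrightarrow> j < p l \<Longrightarrow> g (x l j) = (l, j)"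
    and right: "\<And>i. 1 \<le> i \<Longrightarrow> i \<le> n \<Longrightarrow> i \<noteq> b \<Longrightarrow>
      fst (g i) < r \<and> 1 \<le> snd (g i) \<and> snd (g i) < p (fst (g i)) \<and> x (fst (g i)) (snd (g i)) = i"
    and "C b b = 2"
    and "\<And>l j. l < r \<Longrightarrow> 1 \<le> j \<Longrightarrow> j < p l \<Longrightarrow> C b (x l j) = (if Suc j = p l then - int (a l) else 0)"
    and "\<And>l j. l < r \<Longrightarrow> 1 \<le> j \<Longrightarrow> j < p l \<Longrightarrow> C (x l j) b = (if Suc j = p l then -1 else 0)"
    and "\<And>l j l' j'. l < r \<Longrightarrow> 1 \<le> j \<Longrightarrow> j < p l \<Longrightarrow> l' < r \<Longrightarrow> 1 \<le> j' \<Longrightarrow> j' < p l' \<Longrightarrow>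
      C (x l j) (x l' j') =
        (if l = l' then (if j = j' then 2 else if j' = Suc j \<or> j = Suc j' then -1 else 0) else 0)"
  shows "star_diagram (\<lambda>i j. real_of_int (C i j)) n b r p a x"
proof -
  have "bij_betw (\<lambda>(l, j). x l j) (SIGMA l:{..<r}. {1..<p l}) ({1..n} - {b})"
  proof (rule bij_betw_byWitness[where f' = g])
    show "\<forall>q\<in>SIGMA l:{..<r}. {1..<p l}. g ((\<lambda>(l, j). x l j) q) = q" using left by auto
    show "\<forall>i\<in>{1..n} - {b}. (\<lambda>(l, j). x l j) (g i) = i" using right by (auto simp: case_prod_unfold)
    show "(\<lambda>(l, j). x l j) ` (SIGMA l:{..<r}. {1..<p l}) \<subseteq> {1..n} - {b}"
    proof (rule image_subsetI)
      fix q assume "q \<in> (SIGMA l:{..<r}. {1..<p l})"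
      then obtain l j where "q = (l, j)" "l < r" "1 \<le> j" "j < p l" by auto
      then show "(\<lambda>(l, j). x l j) q \<in> {1..n} - {b}" using x[of l j] by simp
    qed
    show "g ` ({1..n} - {b}) \<subseteq> (SIGMA l:{..<r}. {1..<p l})"
    proof
      fix q assume "q \<in> g ` ({1..n} - {b})"
      then obtain i where i: "i \<in> {1..n} - {b}" "q = g i" by blast
      then have "1 \<le> i" "i \<le> n" "i \<noteq> b" by auto
      moreover obtain l j where "g i = (l, j)" by fastforce
      ultimately show "q \<in> (SIGMA l:{..<r}. {1..<p l})" using right[of i] i(2) by simp
    qed
  qed
  then show ?thesis using assms by (simp add: star_diagram_def)
qed

lemma less_3_cases_iff: "l < 3 \<longleftrightarrow> l = 0 \<or> l = 1 \<or> l = (2::nat)"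
  by auto

lemma path_cartan:
  "1 \<le> i \<Longrightarrow> i \<le> m \<Longrightarrow> 1 \<le> j \<Longrightarrow> j \<le> m \<Longrightarrow>
     simply_laced_entry (path_edges 1 m) i j = (if i = j then 2 else if j = Suc i \<or> i = Suc j then -1 else 0)"
  by (auto simp: simply_laced_entry_def path_edge_iff)

lemmas path_cartan_simp = path_cartan[unfolded One_nat_def]

lemma type_D_cartan:
  "1 \<le> i \<Longrightarrow> i \<le> m + 4 \<Longrightarrow> 1 \<le> j \<Longrightarrow> j \<le> m + 4 \<Longrightarrow>
     type_cartan (TypeD (m + 4)) i j =
       (if i = j then 2
        else if i < m + 4 \<and> j < m + 4 \<and> (j = Suc i \<or> i = Suc j) \<or> i = m + 2 \<and> j = m + 4 \<or> i = m + 4 \<and> j = m + 2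
        then -1 else 0)"
  by (auto simp: simply_laced_entry_def path_edge_iff doubleton_eq_iff)

lemma type_E_cartan:
  "1 \<le> i \<Longrightarrow> i \<le> n \<Longrightarrow> 1 \<le> j \<Longrightarrow> j \<le> n \<Longrightarrow>
     type_cartan (TypeE n) i j =
       (if i = j then 2
        else if 3 \<le> i \<and> j = Suc i \<or> 3 \<le> j \<and> i = Suc j \<or> i = 1 \<and> j = 3 \<or> i = 3 \<and> j = 1 \<or>
          i = 2 \<and> j = 4 \<or> i = 4 \<and> j = 2
        then -1 else 0)"
  by (auto simp: simply_laced_entry_def path_edge_iff doubleton_eq_iff)

lemma star_A:
  assumes "k \<in> {1..n}"
  shows "star_diagram (real_cartan (TypeA n)) n k 2
    (\<lambda>l. if l = 0 then k else n + 1 - k) (\<lambda>_. 1) (\<lambda>l j. if l = 0 then j else n + 1 - j)"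
proof -
  have k: "1 \<le> k" "k \<le> n" using assms by auto
  show ?thesis
  proof (rule star_diagramI[where g = "\<lambda>i. if i < k then (0, i) else (1, n + 1 - i)"], goal_cases)
    case 1
    then show ?case using k by simp
  next
    case 2
    then show ?case using k by simp
  next
    case (3 l)
    then show ?case using k by (cases "l = 0") (simp_all add: Suc_diff_le)
  next
    case (4 l j)
    then show ?case using k by (cases "l = 0") auto
  next
    case (5 l j)
    then show ?case using k by (cases "l = 0") auto
  next
    case (6 i)
    then show ?case using k by (cases "i < k") auto
  next
    case 7
    then show ?case using k by (simp add: path_cartan_simp)
  next
    case (8 l j)
    then show ?case using k by (cases "l = 0") (auto simp: path_cartan_simp)
  next
    case (9 l j)
    then show ?case using k by (cases "l = 0") (auto simp: path_cartan_simp)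
  next
    case (10 l j l' j')
    have far: "1 \<le> n + 1 - t" "n + 1 - t \<le> n" "k < n + 1 - t" if "1 \<le> t" "t < n + 1 - k" for t
      using that k by auto
    show ?case
    proof (cases "l = 0"; cases "l' = 0")
      assume "l = 0" "l' = 0"
      then show ?thesis using 10 k by (simp add: path_cartan_simp)
    next
      assume "l = 0" "l' \<noteq> 0"
      then show ?thesis using 10 k far[of j'] by (simp add: path_cartan_simp)
    next
      assume "l \<noteq> 0" "l' = 0"
      then show ?thesis using 10 k far[of j] by (simp add: path_cartan_simp)
    next
      assume legs: "l \<noteq> 0" "l' \<noteq> 0"
      then have j: "1 \<le> j" "j < n + 1 - k" "1 \<le> j'" "j' < n + 1 - k" using 10 by simp_all
      then have "j \<le> n" "j' \<le> n" by linarith+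
      then have conv: "n + 1 - j = n + 1 - j' \<longleftrightarrow> j = j'" "n + 1 - j' = Suc (n + 1 - j) \<longleftrightarrow> j = Suc j'"
        "n + 1 - j = Suc (n + 1 - j') \<longleftrightarrow> j' = Suc j"
        using j by linarith+
      have "type_cartan (TypeA n) (n + 1 - j) (n + 1 - j') =
          (if j = j' then 2 else if j = Suc j' \<or> j' = Suc j then -1 else 0)"
        unfolding type_cartan.simps path_cartan[OF far(1,2)[OF j(1,2)] far(1,2)[OF j(3,4)]] conv ..
      moreover have "l = l'" using legs 10 by linarith
      ultimately show ?thesis using legs by (simp del: One_nat_def type_cartan.simps)
    qed
  qed
qed

lemma star_B:
  assumes "2 \<le> n"
  shows "star_diagram (real_cartan (TypeB n)) n (n - 1) 2
    (\<lambda>l. if l = 0 then n - 1 else 2) (\<lambda>l. if l = 0 then 1 else 2) (\<lambda>l j. if l = 0 then j else n)"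
proof -
  obtain m where n: "n = m + 2" using assms by (metis add.commute le_Suc_ex)
  show ?thesis unfolding n
  proof (rule star_diagramI[where g = "\<lambda>i. if i < m + 1 then (0, i) else (1, 1)"], goal_cases)
    case 1
    then show ?case by simp
  next
    case 2
    then show ?case by simp
  next
    case (3 l)
    then show ?case by simp
  next
    case (4 l j)
    then show ?case by (cases "l = 0") auto
  next
    case (5 l j)
    then show ?case by (cases "l = 0") (auto simp: less_2_cases_iff)
  next
    case (6 i)
    then show ?case by auto
  next
    case 7
    then show ?case by (simp add: path_cartan_simp)
  next
    case (8 l j)
    then show ?case by (cases "l = 0") (auto simp: path_cartan_simp)
  next
    case (9 l j)
    then show ?case by (cases "l = 0") (auto simp: path_cartan_simp)
  next
    case (10 l j l' j')
    have "j = 1" if "l \<noteq> 0" using that 10 by simp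
    moreover have "j' = 1" if "l' \<noteq> 0" using that 10 by simp
    ultimately show ?case using 10
      by (cases "l = 0"; cases "l' = 0") (auto simp: path_cartan_simp)
  qed
qed

lemma star_C:
  assumes "3 \<le> n"
  shows "star_diagram (real_cartan (TypeC n)) n n 1 (\<lambda>_. n) (\<lambda>_. 2) (\<lambda>_ j. j)"
  by (rule star_diagramI[where g = "\<lambda>i. (0, i)"])
    (use assms in \<open>auto simp:  simply_laced_entry_def path_edge_iff doubleton_eq_iff split: if_splits\<close>)

lemma star_D:
  assumes "4 \<le> n"
  shows "star_diagram (real_cartan (TypeD n)) n (n - 2) 3
    (\<lambda>l. if l = 0 then n - 2 else 2) (\<lambda>_. 1)
    (\<lambda>l j. if l = 0 then j else if l = 1 then n - 1 else n)"
proof -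
  obtain m where n: "n = m + 4" using assms by (metis add.commute le_Suc_ex)
  show ?thesis unfolding n
  proof (rule star_diagramI[where g = "\<lambda>i. if i < m + 2 then (0, i) else if i = m + 3 then (1, 1) else (2, 1)"], goal_cases)
    case 1
    then show ?case by simp
  next
    case 2
    then show ?case by simp
  next
    case (3 l)
    then show ?case by simp
  next
    case (4 l j)
    then show ?case by auto
  next
    case (5 l j)
    then show ?case by (auto simp: less_3_cases_iff)
  next
    case (6 i)
    then show ?case by auto
  next
    case 7
    then show ?case by (simp add: type_D_cartan del: type_cartan.simps)
  next
    case (8 l j)
    then show ?case by (auto simp: type_D_cartan less_3_cases_iff simp del: type_cartan.simps)
  next
    case (9 l j)
    then show ?case by (auto simp: type_D_cartan less_3_cases_iff simp del: type_cartan.simps)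
  next
    case (10 l j l' j')
    then show ?case unfolding less_3_cases_iff by (elim disjE; simp add: type_D_cartan del: type_cartan.simps)
  qed
qed

lemma star_E:
  assumes "n \<in> {6, 7, 8}"
  shows "star_diagram (real_cartan (TypeE n)) n 4 3
    (\<lambda>l. if l = 0 then 2 else if l = 1 then 3 else n - 3) (\<lambda>_. 1)
    (\<lambda>l j. if l = 0 then 2 else if l = 1 then (if j = 1 then 1 else 3) else n + 1 - j)"
proof -
  have n: "6 \<le> n" using assms by auto
  show ?thesis
  proof (rule star_diagramI[where g = "\<lambda>i. if i = 2 then (0, 1) else if i = 1 then (1, 1) else if i = 3 then (1, 2) else (2, n + 1 - i)"], goal_cases)
    case 1
    then show ?case using n by simp
  next
    case 2
    then show ?case using n by simp
  next
    case (3 l)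
    have "1 \<le> n - 3" using n by linarith
    then show ?case by simp
  next
    case (4 l j)
    then show ?case using n by (cases "l = 0"; cases "l = 1"; cases "j = 1") auto
  next
    case (5 l j)
    then show ?case using n unfolding less_3_cases_iff by (elim disjE) auto
  next
    case (6 i)
    then show ?case using n by (cases "i \<le> 3") auto
  next
    case 7
    then show ?case using n by (simp add: type_E_cartan del: type_cartan.simps)
  next
    case (8 l j)
    then show ?case using n unfolding less_3_cases_iff by (elim disjE; cases "j = 1") (auto simp: type_E_cartan simp del: type_cartan.simps)
  next
    case (9 l j)
    then show ?case using n unfolding less_3_cases_iff by (elim disjE; cases "j = 1") (auto simp: type_E_cartan simp del: type_cartan.simps)
  next
    case (10 l j l' j')
    define y where "y t = n + 1 - t" for t
    have y: "5 \<le> y t" "y t \<le> n" if "1 \<le> t" "t < n - 3" for t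
      using that by (auto simp: y_def)
    have conv: "y j = y j' \<longleftrightarrow> j = j'" "y j' = Suc (y j) \<longleftrightarrow> j = Suc j'" "y j = Suc (y j') \<longleftrightarrow> j' = Suc j"
      if "l = 2" "l' = 2"
      using that 10 unfolding y_def by (simp_all del: One_nat_def) linarith+
    have leg: "l = 0 \<and> j = 1 \<or> l = 1 \<and> j = 1 \<or> l = 1 \<and> j = 2 \<or> l = 2 \<and> 5 \<le> y j \<and> y j \<le> n"
      using 10(1-3) y[of j] unfolding less_3_cases_iff by (elim disjE) auto
    have leg': "l' = 0 \<and> j' = 1 \<or> l' = 1 \<and> j' = 1 \<or> l' = 1 \<and> j' = 2 \<or> l' = 2 \<and> 5 \<le> y j' \<and> y j' \<le> n"
      using 10(4-6) y[of j'] unfolding less_3_cases_iff by (elim disjE) auto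
    show ?case
      unfolding y_def[symmetric] using leg leg' n conv
      by (elim disjE conjE) (simp_all add: type_E_cartan del: type_cartan.simps)
  qed
qed

lemma star_F4:
  "star_diagram (real_cartan TypeF4) 4 2 2
    (\<lambda>l. if l = 0 then 2 else 3) (\<lambda>l. if l = 0 then 1 else 2) (\<lambda>l j. if l = 0 then 1 else if j = 1 then 4 else 3)"
proof (rule star_diagramI[where g = "\<lambda>i. if i = 1 then (0, 1) else if i = 4 then (1, 1) else (1, 2)"], goal_cases)
  case 1
  then show ?case by simp
next
  case 2
  then show ?case by simp
next
  case (3 l)
  then show ?case by simp
next
  case (4 l j)
  then show ?case by (cases "l = 0") auto
next
  case (5 l j)
  then show ?case by (cases "l = 0") (auto simp: less_2_cases_iff)
next
  case (6 i)
  then show ?case by auto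
next
  case 7
  then show ?case by (simp add: path_cartan_simp)
next
  case (8 l j)
  then show ?case by (cases "l = 0") (auto simp: path_cartan_simp)
next
  case (9 l j)
  then show ?case by (cases "l = 0") (auto simp: path_cartan_simp)
next
  case (10 l j l' j')
  have "l = 0 \<and> j = 1 \<or> l = 1 \<and> j = 1 \<or> l = 1 \<and> j = 2"
    using 10(1-3) by (cases "l = 0") auto
  moreover have "l' = 0 \<and> j' = 1 \<or> l' = 1 \<and> j' = 1 \<or> l' = 1 \<and> j' = 2"
    using 10(4-6) by (cases "l' = 0") auto
  ultimately show ?case
    by (elim disjE conjE) (simp_all add: path_cartan_simp)
qed

lemma star_G2:
  "star_diagram (real_cartan TypeG2) 2 2 1 (\<lambda>_. 2) (\<lambda>_. 3) (\<lambda>_ _. 1)"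
  by (rule star_diagramI[where g = "\<lambda>i. (0, 1)"])
    (use TrueI in \<open>auto simp:  simply_laced_entry_def path_edge_iff doubleton_eq_iff split: if_splits\<close>)

declare One_nat_def [simp del]

text \<open>
  The conditions under which the orbit vector with central coefficient \<open>s\<close> is reached from \<open>- \<alpha> b\<close> in \<open>s\<close>
  steps and is dominant.
\<close>

definition orbit_length :: "nat \<Rightarrow> (nat \<Rightarrow> nat) \<Rightarrow> (nat \<Rightarrow> nat) \<Rightarrow> nat \<Rightarrow> bool" where
  "orbit_length r p a s \<longleftrightarrow> 1 \<le> s \<and> (\<forall>t\<in>{2..s}. star_defect r p a t = 2 * t - 1) \<and>
     star_defect r p a (Suc s) \<le> 2 * s"

lemma ceil_div_eq_1: "1 \<le> m \<Longrightarrow> m \<le> q \<Longrightarrow> ceil_div m q = 1"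
  using ceil_div_step[of q "m - 1"] by (simp add: ceil_div_def[of 0])

lemma ceil_div_ge_1: "1 \<le> m \<Longrightarrow> 1 \<le> q \<Longrightarrow> 1 \<le> ceil_div m q"
  using ceil_div_mono[of 1 m q] by simp

lemma sum_less_2: "(\<Sum>l<2. f l) = f 0 + f (1::nat)"
  and sum_less_3: "(\<Sum>l<3. f l) = f 0 + f 1 + f (2::nat)"
  by (simp_all add: numeral_2_eq_2 numeral_3_eq_3 One_nat_def)

text \<open>
  The number \<open>s\<close> is the coefficient of the branch root in the highest root: \<open>1\<close> for \<open>A\<close>, \<open>C\<close> and \<open>B\<^sub>2\<close>, \<open>2\<close> for \<open>D\<close>,
  \<open>G\<^sub>2\<close> and the other \<open>B\<close>, \<open>3\<close> for \<open>E\<^sub>6\<close> and \<open>F\<^sub>4\<close>, \<open>4\<close> for \<open>E\<^sub>7\<close>, \<open>6\<close> for \<open>E\<^sub>8\<close>. In type \<open>A\<close> the centre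
  can be any vertex; in the other types the last alternatives force the branching number of the centre to exceed \<open>2\<close>.
\<close>

lemma star_of_type:
  assumes "valid_type X" and "k \<in> {1..type_rank X}"
  obtains b r p a x s where "star_diagram (real_cartan X) (type_rank X) b r p a x"
    and "orbit_length r p a s"
    and "b = k \<or> 3 \<le> star_defect r p a 2 \<or>
      2 \<le> star_defect r p a 2 \<and> (\<exists>l<r. 1 < p l \<and> (\<forall>l'<r. l' \<noteq> l \<longrightarrow> p l' = 1))"
proof (cases X)
  case (TypeA n)
  have "star_defect 2 (\<lambda>l. if l = 0 then k else n + 1 - k) (\<lambda>_. 1) 2 \<le> 2"
  proof -
    have "1 \<le> k" "1 \<le> n + 1 - k" using assms TypeA by auto
    then have "1 \<le> ceil_div 2 k" "1 \<le> ceil_div 2 (n + 1 - k)" by (simp_all add: ceil_div_ge_1)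
    then show ?thesis by (simp add: star_defect_def sum_less_2)
  qed
  then have "orbit_length 2 (\<lambda>l. if l = 0 then k else n + 1 - k) (\<lambda>_. 1) 1"
    by (simp add: orbit_length_def numeral_2_eq_2 One_nat_def)
  then show ?thesis using star_A[of k n] assms TypeA by (intro that) auto
next
  case (TypeB n)
  show ?thesis
  proof (cases "n = 2")
    case True
    have "star_defect 2 (\<lambda>l. if l = 0 then n - 1 else 2) (\<lambda>l. if l = 0 then 1 else 2) 2 = 2"
      using True by (simp add: star_defect_def sum_less_2 ceil_div_def)
    moreover from this have "orbit_length 2 (\<lambda>l. if l = 0 then n - 1 else 2) (\<lambda>l. if l = 0 then 1 else 2) 1"
      by (simp add: orbit_length_def numeral_2_eq_2 One_nat_def)
    ultimately show ?thesis using star_B[of n] TypeB True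
      by (intro that[OF _ _ disjI2[OF disjI2]]) (auto simp: less_2_cases_iff)
  next
    case False
    then have n: "3 \<le> n" using assms TypeB by simp
    have "star_defect 2 (\<lambda>l. if l = 0 then n - 1 else 2) (\<lambda>l. if l = 0 then 1 else 2) 2 = 3"
      using n ceil_div_eq_1[of 2 "n - 1"] by (simp add: star_defect_def sum_less_2 ceil_div_eq_1)
    moreover have "star_defect 2 (\<lambda>l. if l = 0 then n - 1 else 2) (\<lambda>l. if l = 0 then 1 else 2) 3 \<le> 4"
    proof -
      have "1 \<le> ceil_div 3 (n - 1)" using n by (intro ceil_div_ge_1) auto
      then show ?thesis by (simp add: star_defect_def sum_less_2 ceil_div_def[of 3 2])
    qed
    ultimately have "orbit_length 2 (\<lambda>l. if l = 0 then n - 1 else 2) (\<lambda>l. if l = 0 then 1 else 2) 2"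
      "3 \<le> star_defect 2 (\<lambda>l. if l = 0 then n - 1 else 2) (\<lambda>l. if l = 0 then 1 else 2) 2"
      by (simp_all add: orbit_length_def)
    then show ?thesis using star_B[of n] TypeB n by (intro that) auto
  qed
next
  case (TypeC n)
  then have n: "3 \<le> n" using assms by simp
  then have "star_defect 1 (\<lambda>_. n) (\<lambda>_. 2) 2 = 2"
    by (simp add: star_defect_def ceil_div_eq_1)
  moreover from this have "orbit_length 1 (\<lambda>_. n) (\<lambda>_. 2) 1"
    by (simp add: orbit_length_def numeral_2_eq_2 One_nat_def)
  ultimately show ?thesis using star_C[OF n] TypeC n
    by (intro that[OF _ _ disjI2[OF disjI2]]) auto
next
  case (TypeD n)
  then have n: "4 \<le> n" using assms by simp
  have "star_defect 3 (\<lambda>l. if l = 0 then n - 2 else 2) (\<lambda>_. 1) 2 = 3"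
    using n by (simp add: star_defect_def sum_less_3 ceil_div_eq_1)
  moreover have "star_defect 3 (\<lambda>l. if l = 0 then n - 2 else 2) (\<lambda>_. 1) 3 \<le> 4"
  proof -
    have "1 \<le> ceil_div 3 (n - 2)" using n by (intro ceil_div_ge_1) auto
    then show ?thesis by (simp add: star_defect_def sum_less_3 ceil_div_def[of 3 2])
  qed
  ultimately have "orbit_length 3 (\<lambda>l. if l = 0 then n - 2 else 2) (\<lambda>_. 1) 2"
    "3 \<le> star_defect 3 (\<lambda>l. if l = 0 then n - 2 else 2) (\<lambda>_. 1) 2"
    by (simp_all add: orbit_length_def)
  then show ?thesis using star_D[OF n] TypeD by (intro that) auto
next
  case (TypeE n)
  let ?p = "\<lambda>l. if l = 0 then 2 else if l = 1 then 3 else n - 3"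
  have n: "n \<in> {6, 7, 8}" using assms TypeE by simp
  define s where "s = (if n = 6 then 3 else if n = 7 then 4 else 6 :: nat)"
  have "{2..3::nat} = {2, 3}" "{2..4::nat} = {2, 3, 4}" "{2..6::nat} = {2, 3, 4, 5, 6}" by auto
  then have "orbit_length 3 ?p (\<lambda>_. 1) s" "3 \<le> star_defect 3 ?p (\<lambda>_. 1) 2"
    using n by (auto simp: orbit_length_def s_def star_defect_def sum_less_3 ceil_div_def)
  then show ?thesis using star_E[OF n] TypeE by (intro that) auto
next
  case TypeF4
  have "{2..3::nat} = {2, 3}" by auto
  then have "orbit_length 2 (\<lambda>l. if l = 0 then 2 else 3) (\<lambda>l. if l = 0 then 1 else 2) 3"
    "3 \<le> star_defect 2 (\<lambda>l. if l = 0 then 2 else 3) (\<lambda>l. if l = 0 then 1 else 2) 2"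
    by (simp_all add: orbit_length_def star_defect_def sum_less_2 ceil_div_def)
  then show ?thesis using star_F4 TypeF4 by (intro that) auto
next
  case TypeG2
  have "orbit_length 1 (\<lambda>_. 2) (\<lambda>_. 3) 2" "3 \<le> star_defect 1 (\<lambda>_. 2) (\<lambda>_. 3) 2"
    by (simp_all add: orbit_length_def star_defect_def ceil_div_def)
  then show ?thesis using star_G2 TypeG2 by (intro that) auto
qed

theorem proposition5:
  fixes X :: cartan_type and \<Phi> :: "'a::euclidean_space set" and n :: nat
    and \<alpha> :: "nat \<Rightarrow> 'a" and z :: "nat \<Rightarrow> int" and i\<^sub>0 c :: nat and w :: 'a
  assumes "irreducible_root_system \<Phi>" and "long_roots_normalised \<Phi>"
    and "simple_roots \<Phi> n \<alpha>" and "has_type X n \<alpha>"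
    and "highest_root \<Phi> n \<alpha> (- \<alpha> 0)"
    and "null_vector n (cartan \<alpha>) z"
    and "branch_vertex n \<alpha> i\<^sub>0"
    and "fundamental_weight n \<alpha> i\<^sub>0 w"
    and "0 < c" and "real c *\<^sub>R w \<in> coroot_lattice n \<alpha>"
    and "\<And>k. 0 < k \<Longrightarrow> real k *\<^sub>R w \<in> coroot_lattice n \<alpha> \<Longrightarrow> c \<le> k"
  shows "\<exists>p (h::nat) (m :: nat \<Rightarrow> int).
           p permutes {0..n} \<and>
           affine_coxeter_number n z (coxeter_transformation n (cartan \<alpha>) p) h \<and>
           affine_exponents (coxeter_transformation n (cartan \<alpha>) p) h
             (image_mset m (mset_set {0..n})) \<and>
           real c *\<^sub>R w = (\<Sum>i=0..n. of_int (m i) *\<^sub>R coroot (\<alpha> i)) \<and>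
           m 0 = 0 \<and> m i\<^sub>0 = int h"
proof -
  have \<Phi>: "root_system \<Phi>" using assms(1) by (simp add: irreducible_root_system_def)
  interpret indexed_basis \<alpha> n by (rule simple_roots_indexed_basis[OF \<Phi> assms(3)])
  obtain P where X: "valid_type X" "n = type_rank X" and P: "bij_betw P {1..n} {1..n}"
    and cartan: "\<And>i j. i \<in> {1..n} \<Longrightarrow> j \<in> {1..n} \<Longrightarrow> cartan \<alpha> i j = real_cartan X (P i) (P j)"
    using assms(4) by (auto simp: has_type_def)
  have i\<^sub>0: "i\<^sub>0 \<in> {1..n}" using assms(7) by (simp add: branch_vertex_def)
  let ?q = "inv_into {1..n} P"
  have q: "bij_betw ?q {1..n} {1..n}" by (rule bij_betw_inv_into[OF P])
  have "P i\<^sub>0 \<in> {1..type_rank X}" using bij_betwE[OF P] i\<^sub>0 X(2) by blast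
  from X(1) this obtain b r p a x s where star: "star_diagram (real_cartan X) (type_rank X) b r p a x"
    and s: "orbit_length r p a s"
    and centre: "b = P i\<^sub>0 \<or> 3 \<le> star_defect r p a 2 \<or>
      2 \<le> star_defect r p a 2 \<and> (\<exists>l<r. 1 < p l \<and> (\<forall>l'<r. l' \<noteq> l \<longrightarrow> p l' = 1))"
    by (rule star_of_type)
  have "star_diagram (cartan \<alpha>) n (?q b) r p a (\<lambda>l j. ?q (x l j))"
    using star unfolding X(2)[symmetric]
  proof (rule star_diagram_transport[OF _ q])
    fix i j assume ij: "i \<in> {1..n}" "j \<in> {1..n}"
    then have "?q i \<in> {1..n}" "?q j \<in> {1..n}" using bij_betwE[OF q] by blast+
    then show "cartan \<alpha> (?q i) (?q j) = real_cartan X i j"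
      using ij P by (simp add: cartan bij_betw_inv_into_right)
  qed
  then interpret star_basis \<alpha> n "?q b" r p a "\<lambda>l j. ?q (x l j)" by unfold_locales
  have "i\<^sub>0 = ?q b"
  proof (cases "b = P i\<^sub>0")
    case True
    then show ?thesis using bij_betw_inv_into_left[OF P i\<^sub>0] by simp
  next
    case False
    have "2 < branching n \<alpha> (?q b)"
    proof (cases "3 \<le> star_defect r p a 2")
      case True
      then show ?thesis using centre_branching by simp
    next
      case less: False
      then obtain l where "2 \<le> star_defect r p a 2" "l < r" "1 < p l" "\<forall>l'<r. l' \<noteq> l \<longrightarrow> p l' = 1"
        using centre False by blast
      then show ?thesis using centre_branching_one_leg[of l] by simp
    qed
    then show ?thesis by (rule branch_vertex_is_centre[OF assms(7)])
  qed
  moreover have "1 \<le> s" "\<And>t. 2 \<le> t \<Longrightarrow> t \<le> s \<Longrightarrow> leg_defect t = 2 * t - 1" "leg_defect (Suc s) \<le> 2 * s"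
    using s by (auto simp: orbit_length_def)
  ultimately show ?thesis
    using star_exponents[OF \<Phi> assms(3,2,5,6), of s w c] assms(8-11) by blast
qed

end
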